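(* Let $D$ be an integral domain such that $\operatorname{Int}(D)_P=\operatorname{Int}(D_P)$ for every $t$-maximal ideal $P$ of $D$. The following are equivalent: (1) $\operatorname{Int}(D)$ is a PvMD; (2) $D$ is a PvMD and $\operatorname{Int}(D_0)$ is a Prüfer domain.
   Context: For an integral domain $D$ with quotient field $K$: $\operatorname{Int}(D)=\{g\in K[X]:g(D)\subseteq D\}$, and for a prime $P$ of $D$, $\operatorname{Int}(D)_P$ denotes the localization of $\operatorname{Int}(D)$ at $D\setminus P$. For a nonzero fractional ideal $I$: $(D:I)=\{x\in K:xI\subseteq D\}$, $I^v=(D:(D:I))$, $I^t=\bigcup\{J^v:J\subseteq I \text{ finitely generated}\}$; $I$ is a $t$-ideal if $I=(0)$ or $I=I^t$; $t\text{-Spec}(D)$ is the set of prime $t$-ideals; $t$-maximal ideals are $t$-ideals maximal among proper $t$-ideals. $D$ is a PvMD if $D_{\mathfrak m}$ is a valuation domain for all $t$-maximal $\mathfrak m$. $\Lambda_0=\{P\in t\text{-Spec}(D):\operatorname{Int}(D)_P\neq D_P[X]\}$ and $D_0=\bigcap_{P\in\Lambda_0}D_P$ (with $D_0=K$ if $\Lambda_0=\emptyset$). *)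

theory Defs
  imports "HOL-Computational_Algebra.Polynomial" "HOL-Computational_Algebra.Fraction_Field"
begin

text \<open>An integral domain is modelled as a subring R (with 1) of an ambient field 'k;
  its quotient field is the set of fractions a/b with a, b in R, b nonzero.\<close>

definition is_subdomain :: "'k::field set \<Rightarrow> bool" where
  "is_subdomain R \<longleftrightarrow> 0 \<in> R \<and> 1 \<in> R \<and>
     (\<forall>x\<in>R. \<forall>y\<in>R. x + y \<in> R \<and> x * y \<in> R \<and> - x \<in> R)"

definition qfield :: "'k::field set \<Rightarrow> 'k set" where
  "qfield R = {a / b | a b. a \<in> R \<and> b \<in> R \<and> b \<noteq> 0}"

definition is_ideal :: "'k::field set \<Rightarrow> 'k set \<Rightarrow> bool" where
  "is_ideal R I \<longleftrightarrow> I \<subseteq> R \<and> 0 \<in> I \<and> (\<forall>x\<in>I. \<forall>y\<in>I. x + y \<in> I) \<and>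
     (\<forall>r\<in>R. \<forall>x\<in>I. r * x \<in> I)"

definition prime_ideal :: "'k::field set \<Rightarrow> 'k set \<Rightarrow> bool" where
  "prime_ideal R P \<longleftrightarrow> is_ideal R P \<and> P \<noteq> R \<and>
     (\<forall>x\<in>R. \<forall>y\<in>R. x * y \<in> P \<longrightarrow> x \<in> P \<or> y \<in> P)"

definition maximal_ideal :: "'k::field set \<Rightarrow> 'k set \<Rightarrow> bool" where
  "maximal_ideal R M \<longleftrightarrow> is_ideal R M \<and> M \<noteq> R \<and>
     (\<forall>J. is_ideal R J \<and> M \<subseteq> J \<and> J \<noteq> R \<longrightarrow> J = M)"

definition colon :: "'k::field set \<Rightarrow> 'k set \<Rightarrow> 'k set" where
  "colon R I = {x \<in> qfield R. \<forall>y\<in>I. x * y \<in> R}"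

definition vclos :: "'k::field set \<Rightarrow> 'k set \<Rightarrow> 'k set" where
  "vclos R I = colon R (colon R I)"

definition fgen :: "'k::field set \<Rightarrow> 'k set \<Rightarrow> 'k set" where
  "fgen R F = {y. \<exists>c. (\<forall>x\<in>F. c x \<in> R) \<and> y = (\<Sum>x\<in>F. c x * x)}"

definition tclos :: "'k::field set \<Rightarrow> 'k set \<Rightarrow> 'k set" where
  "tclos R I = \<Union>{vclos R (fgen R F) | F. finite F \<and> F \<subseteq> I \<and> \<not> F \<subseteq> {0}}"

definition t_ideal :: "'k::field set \<Rightarrow> 'k set \<Rightarrow> bool" where
  "t_ideal R I \<longleftrightarrow> is_ideal R I \<and> (I = {0} \<or> I = tclos R I)"

definition t_spec :: "'k::field set \<Rightarrow> 'k set set" where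
  "t_spec R = {P. prime_ideal R P \<and> t_ideal R P}"

definition t_maximal :: "'k::field set \<Rightarrow> 'k set \<Rightarrow> bool" where
  "t_maximal R M \<longleftrightarrow> t_ideal R M \<and> M \<noteq> R \<and>
     (\<forall>J. t_ideal R J \<and> J \<noteq> R \<and> M \<subseteq> J \<longrightarrow> J = M)"

definition loc :: "'k::field set \<Rightarrow> 'k set \<Rightarrow> 'k set" where
  "loc R P = {a / s | a s. a \<in> R \<and> s \<in> R \<and> s \<notin> P}"

definition valuation_domain :: "'k::field set \<Rightarrow> bool" where
  "valuation_domain V \<longleftrightarrow> is_subdomain V \<and>
     (\<forall>x\<in>qfield V. x \<noteq> 0 \<longrightarrow> x \<in> V \<or> inverse x \<in> V)"

definition PvMD :: "'k::field set \<Rightarrow> bool" where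
  "PvMD R \<longleftrightarrow> is_subdomain R \<and> (\<forall>M. t_maximal R M \<longrightarrow> valuation_domain (loc R M))"

definition Prufer :: "'k::field set \<Rightarrow> bool" where
  "Prufer R \<longleftrightarrow> is_subdomain R \<and> (\<forall>M. maximal_ideal R M \<longrightarrow> valuation_domain (loc R M))"

definition IntD :: "'a::field set \<Rightarrow> 'a poly set" where
  "IntD D = {g. (\<forall>i. coeff g i \<in> qfield D) \<and> (\<forall>d\<in>D. poly g d \<in> D)}"

definition poly_over :: "'a::field set \<Rightarrow> 'a poly set" where
  "poly_over R = {g. \<forall>i. coeff g i \<in> R}"

definition IntD_loc :: "'a::field set \<Rightarrow> 'a set \<Rightarrow> 'a poly set" where
  "IntD_loc D P = {smult (inverse s) f | f s. f \<in> IntD D \<and> s \<in> D \<and> s \<notin> P}"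

definition Lambda0 :: "'a::field set \<Rightarrow> 'a set set" where
  "Lambda0 D = {P \<in> t_spec D. IntD_loc D P \<noteq> poly_over (loc D P)}"

definition D0 :: "'a::field set \<Rightarrow> 'a set" where
  "D0 D = (if Lambda0 D = {} then qfield D else (\<Inter>P\<in>Lambda0 D. loc D P))"

definition poly_to_fract :: "'a::field poly \<Rightarrow> 'a poly fract" where
  "poly_to_fract p = Fract p 1"

end

theory Submission
  imports Defs
begin

text \<open>Both directions rest on the fact that an integer-valued polynomial \<open>f\<close> of degree \<open>n\<close> satisfies
  \<open>V f \<in> D[X]\<close> for every Vandermonde determinant \<open>V\<close> of \<open>n + 1\<close> elements of \<open>D\<close>. Taken at the
  powers of a single element, this shows that \<open>\<Lambda>\<^sub>0\<close> consists of t-maximal ideals \<open>P\<close>, and when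
  \<open>D\<^sub>P\<close> is a valuation domain its maximal ideal is principal with finite residue field.

  If \<open>Int(D)\<close> is a PvMD, each t-maximal \<open>M\<close> of \<open>D\<close> lies under a t-maximal \<open>Q\<close> of \<open>Int(D)\<close> such
  that \<open>D\<^sub>M\<close> is the trace of \<open>Int(D)\<^sub>Q\<close> on the quotient field, so \<open>D\<close> is a PvMD. For
  \<open>P \<in> \<Lambda>\<^sub>0\<close> all primes of \<open>Int(D)\<close> above \<open>P\<close> are t-ideals, so their localizations are
  valuation domains; \<open>D\<^sub>P\<close> is then a DVR, and a compactness argument shows that \<open>\<Lambda>\<^sub>0\<close> already
  provides all nonzero primes of \<open>D\<^sub>0\<close>. Hence \<open>Int(D\<^sub>0)\<close> is Pruefer.

  Conversely, let \<open>Q\<close> be t-maximal in \<open>Int(D)\<close> with trace \<open>P\<close>. For \<open>P = 0\<close> the localization contains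
  \<open>K[X]\<close>, and for \<open>P \<in> \<Lambda>\<^sub>0\<close> it contains \<open>Int(D\<^sub>0)\<close>. Otherwise \<open>P\<close> is not a limit of \<open>\<Lambda>\<^sub>0\<close>, because
  \<open>D\<^sub>P[X]\<close> cannot contain the Pruefer domain \<open>Int(D\<^sub>0)\<close>; invertibility of contents then gives
  \<open>Q = P D\<^sub>P[X] \<inter> Int(D)\<close>, whose localization is the valuation domain \<open>D\<^sub>P(X)\<close>.\<close>

section \<open>t-ideals and localizations\<close>

text \<open>No local finiteness of \<open>\<Lambda>\<^sub>0\<close> is available, so neither the
  primes of \<open>D\<^sub>0\<close> nor the limits of members of \<open>\<Lambda>\<^sub>0\<close>
  can be read off from the single rings \<open>D\<^sub>P\<close>. The recurring test compares
  \<open>X\<close> with a nonzero constant \<open>c\<close> at a prime that contains both: if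
  \<open>X / c\<close> or \<open>c / X\<close> equals \<open>f / g\<close> and the denominators of
  the coefficients of \<open>f\<close> and \<open>g\<close> are under control, then \<open>g\<close>
  is forced back into the prime, so the localization is not a valuation domain. The test shows that
  no nonzero element of \<open>D\<^sub>P\<close> is divisible by all powers of the uniformizer, that
  limits of evaluation ideals have their trace in \<open>\<Lambda>\<^sub>0\<close>, and that
  \<open>D\<^sub>P[X]\<close> with \<open>P\<close> nonzero is too small to contain a Pruefer domain
  \<open>Int(D\<^sub>0)\<close>. That a prime of \<open>Int(D)\<close> is a t-ideal rests on
  explicit multipliers. They are built over \<open>D\<^sub>P\<close>, where \<open>1 - a ^ r\<close>
  is a nonunit for every unit \<open>a\<close> and a unit for every nonunit \<open>a\<close>; the
  hypothesis \<open>Int(D)\<^sub>P = Int(D\<^sub>P)\<close> brings them back to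
  \<open>Int(D)\<close> at the cost of a factor outside \<open>P\<close>.\<close>

text \<open>Zorn's lemma for properties of finite character. The last conjunct is the form of
  maximality that gets used: an outside element is refuted by a finite subset. It yields t-maximal
  ideals, maximal ideals and limits of evaluation ideals.\<close>

lemma finite_character_maximal:
  assumes "S0 \<subseteq> U" and "\<And>F. finite F \<Longrightarrow> F \<subseteq> S0 \<Longrightarrow> good F"
  shows "\<exists>S. S0 \<subseteq> S \<and> S \<subseteq> U \<and> (\<forall>F. finite F \<longrightarrow> F \<subseteq> S \<longrightarrow> good F) \<and>
    (\<forall>x. x \<in> U \<longrightarrow> x \<notin> S \<longrightarrow> (\<exists>F. finite F \<and> F \<subseteq> S \<and> \<not> good (insert x F)))"
proof -
  let ?A = "{S. S0 \<subseteq> S \<and> S \<subseteq> U \<and> (\<forall>F. finite F \<and> F \<subseteq> S \<longrightarrow> good F)}"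
  have "\<exists>M\<in>?A. \<forall>X\<in>?A. M \<subseteq> X \<longrightarrow> X = M"
  proof (rule subset_Zorn_nonempty)
    show "?A \<noteq> {}" using assms by blast
  next
    fix C assume ne: "C \<noteq> {}" and ch: "subset.chain ?A C"
    have C: "C \<subseteq> ?A" using ch by (auto simp: subset.chain_def)
    have "good F" if F: "finite F" "F \<subseteq> \<Union>C" for F
    proof -
      obtain Y where "Y \<in> C" "F \<subseteq> Y"
        using finite_subset_Union_chain[OF F ne ch] by blast
      then show ?thesis using C F by blast
    qed
    then show "\<Union>C \<in> ?A" using C ne by blast
  qed
  then obtain S where S: "S \<in> ?A" and max: "\<forall>X\<in>?A. S \<subseteq> X \<longrightarrow> X = S" by (rule bexE)
  have "\<exists>F. finite F \<and> F \<subseteq> S \<and> \<not> good (insert x F)" if x: "x \<in> U" "x \<notin> S" for x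
  proof -
    have "insert x S \<noteq> S" using x by blast
    then have "insert x S \<notin> ?A" using bspec[OF max, of "insert x S"] by auto
    moreover have "S0 \<subseteq> insert x S" "insert x S \<subseteq> U" using S x by auto
    ultimately have "\<exists>F. finite F \<and> F \<subseteq> insert x S \<and> \<not> good F" by simp
    then obtain F where F: "finite F" "F \<subseteq> insert x S" "\<not> good F" by auto
    have "\<not> F \<subseteq> S" using S F by auto
    then have "insert x (F - {x}) = F" using F by auto
    then show ?thesis using F by (intro exI[of _ "F - {x}"]) auto
  qed
  then show ?thesis using S by (intro exI[of _ S]) auto
qed

section \<open>Subrings of a field, v-closures and t-maximal ideals\<close>

locale subdom =
  fixes R :: "'k::field set"
  assumes sub: "is_subdomain R"
begin

lemma zero_mem [simp]: "0 \<in> R" and one_mem [simp]: "1 \<in> R"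
  and add_mem: "x \<in> R \<Longrightarrow> y \<in> R \<Longrightarrow> x + y \<in> R"
  and mult_mem: "x \<in> R \<Longrightarrow> y \<in> R \<Longrightarrow> x * y \<in> R"
  and minus_mem: "x \<in> R \<Longrightarrow> - x \<in> R"
  using sub by (auto simp: is_subdomain_def)

lemma diff_mem: "x \<in> R \<Longrightarrow> y \<in> R \<Longrightarrow> x - y \<in> R"
  using add_mem[of x "- y"] minus_mem by simp

lemma power_mem: "x \<in> R \<Longrightarrow> x ^ n \<in> R"
  by (induction n) (auto intro: mult_mem)

lemma sum_mem: "(\<And>i. i \<in> I \<Longrightarrow> f i \<in> R) \<Longrightarrow> sum f I \<in> R"
  by (induction I rule: infinite_finite_induct) (auto intro: add_mem)

lemma prod_mem: "(\<And>i. i \<in> I \<Longrightarrow> f i \<in> R) \<Longrightarrow> prod f I \<in> R"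
  by (induction I rule: infinite_finite_induct) (auto intro: mult_mem)

lemma qfieldI: "a \<in> R \<Longrightarrow> b \<in> R \<Longrightarrow> b \<noteq> 0 \<Longrightarrow> a / b \<in> qfield R"
  by (auto simp: qfield_def)

lemma qfieldE:
  assumes "x \<in> qfield R"
  obtains a b where "x = a / b" "a \<in> R" "b \<in> R" "b \<noteq> 0"
  using assms by (auto simp: qfield_def)

lemma mem_qfield: "x \<in> R \<Longrightarrow> x \<in> qfield R"
  using qfieldI[of x 1] by simp

lemma subdom_qfield: "subdom (qfield R)"
proof -
  have "x + y \<in> qfield R \<and> x * y \<in> qfield R \<and> - x \<in> qfield R"
    if "x \<in> qfield R" "y \<in> qfield R" for x y
  proof -
    obtain a b where x: "x = a / b" "a \<in> R" "b \<in> R" "b \<noteq> 0"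
      using qfieldE \<open>x \<in> qfield R\<close> by blast
    obtain c d where y: "y = c / d" "c \<in> R" "d \<in> R" "d \<noteq> 0"
      using qfieldE \<open>y \<in> qfield R\<close> by blast
    have e: "x + y = (a * d + c * b) / (b * d)" "x * y = (a * c) / (b * d)" "- x = (- a) / b"
      using x y by (auto simp: field_simps)
    show ?thesis unfolding e using x y by (intro conjI qfieldI add_mem mult_mem minus_mem) auto
  qed
  then show ?thesis by unfold_locales (auto simp: is_subdomain_def mem_qfield)
qed

lemma qfield_inverse: "x \<in> qfield R \<Longrightarrow> inverse x \<in> qfield R"
  by (erule qfieldE) (metis inverse_divide divide_eq_0_iff inverse_zero mem_qfield qfieldI zero_mem)

lemma qfield_divide: "x \<in> qfield R \<Longrightarrow> y \<in> qfield R \<Longrightarrow> x / y \<in> qfield R"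
  using subdom.mult_mem[OF subdom_qfield, of x "inverse y"] qfield_inverse
  by (simp add: divide_inverse)

lemma qfield_eq_between:
  assumes "subdom B" "R \<subseteq> B" "B \<subseteq> qfield R"
  shows "qfield B = qfield R"
proof
  show "qfield B \<subseteq> qfield R"
    by (rule subsetI, erule subdom.qfieldE[OF assms(1)]) (use assms(3) qfield_divide in auto)
  show "qfield R \<subseteq> qfield B" using assms(2) by (auto simp: qfield_def)
qed

lemma qfield_common_denominator:
  assumes "finite C" "C \<subseteq> qfield R"
  shows "\<exists>d\<in>R. d \<noteq> 0 \<and> (\<forall>c\<in>C. d * c \<in> R)"
  using assms
proof (induction C)
  case empty
  show ?case by (intro bexI[of _ 1]) auto
next
  case (insert x C)
  then obtain d where d: "d \<in> R" "d \<noteq> 0" "\<forall>c\<in>C. d * c \<in> R" by auto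
  obtain a b where x: "x = a / b" "a \<in> R" "b \<in> R" "b \<noteq> 0"
    using qfieldE insert.prems by blast
  have "b * d * x = d * a" using x by simp
  moreover have "b * d * c \<in> R" if "c \<in> C" for c
    using d x that mult_mem[of b "d * c"] by (simp add: mult.assoc)
  ultimately show ?case using x d
    by (intro bexI[of _ "b * d"]) (auto intro: mult_mem)
qed

lemma vclos_iff:
  "x \<in> vclos R F \<longleftrightarrow> x \<in> qfield R \<and> (\<forall>y\<in>qfield R. (\<forall>f\<in>F. y * f \<in> R) \<longrightarrow> x * y \<in> R)"
  by (auto simp: vclos_def colon_def)

lemma vclosD:
  "x \<in> vclos R F \<Longrightarrow> y \<in> qfield R \<Longrightarrow> (\<And>f. f \<in> F \<Longrightarrow> y * f \<in> R) \<Longrightarrow> x * y \<in> R"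
  by (auto simp: vclos_iff)

lemma fgen_inc: "finite F \<Longrightarrow> x \<in> F \<Longrightarrow> x \<in> fgen R F"
  unfolding fgen_def
  by (auto intro!: exI[of _ "\<lambda>y. if y = x then 1 else 0"] simp: if_distrib[of "\<lambda>c. c * _"] cong: if_cong)

lemma vclos_fgen: assumes "finite F" shows "vclos R (fgen R F) = vclos R F"
proof -
  have "y * z \<in> R" if "\<forall>f\<in>F. y * f \<in> R" "z \<in> fgen R F" for y z
  proof -
    obtain c where c: "\<forall>x\<in>F. c x \<in> R" "z = (\<Sum>x\<in>F. c x * x)"
      using \<open>z \<in> fgen R F\<close> by (auto simp: fgen_def)
    have "y * z = (\<Sum>x\<in>F. c x * (y * x))"
      by (simp add: c sum_distrib_left mult.left_commute)
    also have "\<dots> \<in> R" using c that mult_mem by (intro sum_mem) blast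
    finally show ?thesis .
  qed
  then have "colon R (fgen R F) = colon R F"
    using fgen_inc[OF assms] by (auto simp: colon_def)
  then show ?thesis by (simp add: vclos_def)
qed

lemma vclos_subset:
  assumes "F \<subseteq> vclos R G"
  shows "vclos R F \<subseteq> vclos R G"
proof
  fix x assume x: "x \<in> vclos R F"
  have "x * y \<in> R" if y: "y \<in> qfield R" "\<forall>g\<in>G. y * g \<in> R" for y
  proof (rule vclosD[OF x y(1)])
    fix f assume "f \<in> F"
    then have "f * y \<in> R" using assms y vclosD[of f G y] by blast
    then show "y * f \<in> R" by (simp add: mult.commute)
  qed
  then show "x \<in> vclos R G" using x by (auto simp: vclos_iff)
qed

lemma subset_vclos: "F \<subseteq> qfield R \<Longrightarrow> F \<subseteq> vclos R F"
  unfolding vclos_def colon_def by (auto simp: mult.commute)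

lemma vclos_mono: "F \<subseteq> G \<Longrightarrow> vclos R F \<subseteq> vclos R G"
  unfolding vclos_def colon_def by blast

lemma vclos_subset_ring: "F \<subseteq> R \<Longrightarrow> vclos R F \<subseteq> R"
  using subdom.one_mem[OF subdom_qfield] by (fastforce simp: vclos_iff)

lemma t_ideal_vclos:
  "t_ideal R I \<Longrightarrow> finite F \<Longrightarrow> F \<subseteq> I \<Longrightarrow> \<not> F \<subseteq> {0} \<Longrightarrow> vclos R F \<subseteq> I"
  unfolding t_ideal_def tclos_def using vclos_fgen by blast

lemma t_idealI:
  assumes I: "is_ideal R I"
    and "\<And>F. finite F \<Longrightarrow> F \<subseteq> I \<Longrightarrow> \<not> F \<subseteq> {0} \<Longrightarrow> vclos R F \<subseteq> I"
  shows "t_ideal R I"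
proof (cases "I = {0}")
  case True
  then show ?thesis using I by (simp add: t_ideal_def)
next
  case False
  have IR: "I \<subseteq> R" "0 \<in> I" using I by (auto simp: is_ideal_def)
  then obtain z where z: "z \<in> I" "z \<noteq> 0" using False by blast
  have "x \<in> tclos R I" if "x \<in> I" for x
  proof -
    \<comment> \<open>The nonzero \<open>z\<close> is adjoined because \<open>tclos\<close> ranges
      over sets with a nonzero element only, and \<open>x\<close> may be 0.\<close>
    have "{x, z} \<subseteq> vclos R {x, z}" using IR that z by (intro subset_vclos) (auto intro: mem_qfield)
    moreover have "vclos R (fgen R {x, z}) \<subseteq> tclos R I"
      using that z unfolding tclos_def by (intro Union_upper) auto
    ultimately show ?thesis using vclos_fgen[of "{x, z}"] by blast
  qed
  moreover have "tclos R I \<subseteq> I"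
    using assms(2) vclos_fgen by (auto simp: tclos_def)
  ultimately show ?thesis using I by (auto simp: t_ideal_def)
qed

text \<open>The generated t-ideal is proper. Sets inside \<open>{0}\<close> have to be left out:
  over a field the v-closure of \<open>{0}\<close> is the whole field.\<close>

definition t_proper :: "'k set \<Rightarrow> bool" where
  "t_proper S \<longleftrightarrow> (\<forall>F. finite F \<and> F \<subseteq> S \<and> \<not> F \<subseteq> {0} \<longrightarrow> 1 \<notin> vclos R F)"

lemma ideal_one: "is_ideal R I \<Longrightarrow> 1 \<in> I \<Longrightarrow> I = R"
  by (auto simp: is_ideal_def) (metis mult.right_neutral)

lemma t_ideal_t_proper: "t_ideal R I \<Longrightarrow> I \<noteq> R \<Longrightarrow> t_proper I"
  using t_ideal_vclos ideal_one unfolding t_proper_def t_ideal_def by blast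

text \<open>Adjoining to \<open>G\<close> an element of the v-closure of \<open>F\<close> does not
  lead out of the v-closure of \<open>G \<union> F\<close>. So a maximal t-proper set absorbs the
  v-closures of its finite subsets, and since sums and multiples lie in such closures it is
  automatically an ideal.\<close>

lemma t_proper_in_t_maximal:
  assumes "t_proper S" "S \<subseteq> R"
  obtains M where "t_maximal R M" "S \<subseteq> M"
proof -
  let ?good = "\<lambda>F. \<not> F \<subseteq> {0} \<longrightarrow> 1 \<notin> vclos R F"
  have gS: "?good F" if "finite F" "F \<subseteq> S" for F using assms(1) that by (simp add: t_proper_def)
  obtain M where M: "S \<subseteq> M \<and> M \<subseteq> R \<and> (\<forall>F. finite F \<longrightarrow> F \<subseteq> M \<longrightarrow> ?good F) \<and>
      (\<forall>x. x \<in> R \<longrightarrow> x \<notin> M \<longrightarrow> (\<exists>F. finite F \<and> F \<subseteq> M \<and> \<not> ?good (insert x F)))"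
    using finite_character_maximal[where good = ?good, OF assms(2) gS] by (rule exE)
  then have SM: "S \<subseteq> M" and MR: "M \<subseteq> R"
    and tp: "\<And>F. finite F \<Longrightarrow> F \<subseteq> M \<Longrightarrow> \<not> F \<subseteq> {0} \<longrightarrow> 1 \<notin> vclos R F" by auto
  have max: "\<exists>F. finite F \<and> F \<subseteq> M \<and> \<not> insert x F \<subseteq> {0} \<and> 1 \<in> vclos R (insert x F)"
    if "x \<in> R" "x \<notin> M" for x
    using M that by simp
  \<comment> \<open>The alternative \<open>g = 0\<close> serves to get \<open>0 \<in> M\<close> out
    of the empty set.\<close>
  have cl: "g \<in> M" if F: "finite F" "F \<subseteq> M" and g: "g \<in> vclos R F" "g = 0 \<or> \<not> F \<subseteq> {0}" for F g
  proof (rule ccontr)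
    assume "g \<notin> M"
    have "g \<in> R" using vclos_subset_ring[of F] F MR g by blast
    with max[OF _ \<open>g \<notin> M\<close>] obtain G where G: "finite G" "G \<subseteq> M" "\<not> insert g G \<subseteq> {0}"
      "1 \<in> vclos R (insert g G)" by blast
    have "g \<in> vclos R (G \<union> F)" "G \<subseteq> vclos R (G \<union> F)"
      using vclos_mono[of F "G \<union> F"] g(1) subset_vclos[of "G \<union> F"] G F MR mem_qfield by blast+
    then have "1 \<in> vclos R (G \<union> F)"
      using vclos_subset[of "insert g G" "G \<union> F"] G by blast
    moreover have "\<not> G \<union> F \<subseteq> {0}" using g(2) G(3) by blast
    ultimately show False using tp[of "G \<union> F"] F G by blast
  qed
  have z: "0 \<in> M" using cl[of "{}" 0] subdom.zero_mem[OF subdom_qfield] by (simp add: vclos_iff)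
  have "x + y \<in> M" if "x \<in> M" "y \<in> M" for x y
  proof (cases "x = 0 \<and> y = 0")
    case True then show ?thesis using z by simp
  next
    case False
    have "(x + y) * z \<in> R" if "z * x \<in> R" "z * y \<in> R" for z
      using add_mem[OF that] by (simp add: algebra_simps)
    then have "x + y \<in> vclos R {x, y}"
      using that MR by (auto simp: vclos_iff intro!: add_mem mem_qfield)
    then show ?thesis using cl[of "{x, y}" "x + y"] that False by blast
  qed
  moreover have "r * x \<in> M" if "x \<in> M" "r \<in> R" for r x
  proof (cases "x = 0")
    case True then show ?thesis using z by simp
  next
    case False
    have "(r * x) * y \<in> R" if "y * x \<in> R" for y
      using mult_mem[OF \<open>r \<in> R\<close> that] by (simp add: ac_simps)
    then have "r * x \<in> vclos R {x}"
      using that MR mult_mem[of r x] by (auto simp: vclos_iff intro!: mem_qfield)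
    then show ?thesis using cl[of "{x}" "r * x"] that False by blast
  qed
  ultimately have "is_ideal R M" using MR z by (auto simp: is_ideal_def)
  then have tM: "t_ideal R M" using cl by (intro t_idealI) auto
  have "1 \<notin> M" using tp[of "{1}"] subset_vclos[of "{1}"] mem_qfield by auto
  then have "M \<noteq> R" by auto
  moreover have "J = M" if J: "t_ideal R J" "J \<noteq> R" "M \<subseteq> J" for J
  proof -
    have "x \<in> M" if "x \<in> J" for x
    proof (rule ccontr)
      assume "x \<notin> M"
      have "x \<in> R" using J \<open>x \<in> J\<close> by (auto simp: t_ideal_def is_ideal_def)
      then obtain F where F: "finite F" "F \<subseteq> M" "\<not> insert x F \<subseteq> {0}" "1 \<in> vclos R (insert x F)"
        using max[OF _ \<open>x \<notin> M\<close>] by auto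
      then show False
        using t_ideal_t_proper[OF J(1,2)] \<open>x \<in> J\<close> J(3) unfolding t_proper_def
        by (metis finite_insert insert_subset order_trans)
    qed
    then show ?thesis using J(3) by (intro subset_antisym subsetI) auto
  qed
  ultimately have "t_maximal R M" using tM by (auto simp: t_maximal_def)
  then show thesis using that SM by blast
qed

lemma t_maximal_notin:
  assumes M: "t_maximal R M" and x: "x \<in> R" "x \<notin> M"
  obtains F where "finite F" "F \<subseteq> M" "1 \<in> vclos R (insert x F)"
proof -
  have MR: "M \<subseteq> R" "0 \<in> M" using M by (auto simp: t_maximal_def t_ideal_def is_ideal_def)
  have "\<not> t_proper (insert x M)"
  proof
    assume "t_proper (insert x M)"
    then obtain N where N: "t_maximal R N" "insert x M \<subseteq> N"
      using t_proper_in_t_maximal[of "insert x M"] x MR by blast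
    then have "N = M" using M by (auto simp: t_maximal_def)
    then show False using N x by blast
  qed
  then obtain F where F: "finite F" "F \<subseteq> insert x M" "1 \<in> vclos R F"
    by (auto simp: t_proper_def)
  have "1 \<in> vclos R (insert x (F - {x}))" using F(3) vclos_mono[of F "insert x (F - {x})"] by blast
  then show thesis using that[of "F - {x}"] F by blast
qed

lemma t_maximal_prime: assumes M: "t_maximal R M" shows "prime_ideal R M"
proof -
  have I: "is_ideal R M" and ne: "M \<noteq> R" using M by (auto simp: t_maximal_def t_ideal_def)
  then have MR: "M \<subseteq> R" by (auto simp: is_ideal_def)
  have "x \<in> M \<or> y \<in> M" if xy: "x \<in> R" "y \<in> R" "x * y \<in> M" for x y
  proof (rule ccontr)
    assume "\<not> (x \<in> M \<or> y \<in> M)"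
    then have n: "x \<notin> M" "y \<notin> M" by auto
    obtain F where F: "finite F" "F \<subseteq> M" "1 \<in> vclos R (insert x F)"
      using t_maximal_notin[OF M xy(1) n(1)] by metis
    obtain G where G: "finite G" "G \<subseteq> M" "1 \<in> vclos R (insert y G)"
      using t_maximal_notin[OF M xy(2) n(2)] by metis
    \<comment> \<open>All these products lie in \<open>M\<close>: either a factor comes from
      \<open>F\<close> or \<open>G\<close>, or the product is \<open>x * y\<close>. A multiplier
      \<open>z\<close> of them is handled one factor at a time: \<open>z * f\<close> multiplies
      \<open>insert y G\<close> into \<open>R\<close>, hence lies in \<open>R\<close>
      itself.\<close>
    let ?H = "(\<lambda>(a, b). a * b) ` (insert x F \<times> insert y G)"
    have "1 * z \<in> R" if z: "z \<in> qfield R" "\<forall>h\<in>?H. z * h \<in> R" for z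
    proof (rule vclosD[OF F(3) z(1)])
      fix f assume f: "f \<in> insert x F"
      then have fR: "f \<in> R" using F MR xy by blast
      have "1 * (z * f) \<in> R"
      proof (rule vclosD[OF G(3)])
        show "z * f \<in> qfield R" using z fR subdom.mult_mem[OF subdom_qfield] mem_qfield by blast
        fix g assume "g \<in> insert y G"
        then have "f * g \<in> ?H" using f by force
        then have "z * (f * g) \<in> R" using z(2) by blast
        then show "z * f * g \<in> R" by (simp only: mult.assoc)
      qed
      then show "z * f \<in> R" by simp
    qed
    then have one: "1 \<in> vclos R ?H"
      using subdom.one_mem[OF subdom_qfield] unfolding vclos_iff by blast
    have HM: "?H \<subseteq> M"
    proof
      fix h assume "h \<in> ?H"
      then obtain a b where ab: "h = a * b" "a \<in> insert x F" "b \<in> insert y G" by auto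
      then have "a \<in> R" "b \<in> R" using F G MR xy by blast+
      then show "h \<in> M" using ab F G xy I unfolding is_ideal_def by (metis insertE mult.commute subsetD)
    qed
    show False
    proof (cases "?H \<subseteq> {0}")
      case False
      have "t_proper M" using M t_ideal_t_proper by (simp add: t_maximal_def)
      moreover have "finite ?H" using F(1) G(1) by simp
      ultimately have "1 \<notin> vclos R ?H" using HM False unfolding t_proper_def by metis
      then show False using one by simp
    next
      case True
      have xz: "x * y = 0" using True by auto
      then have "x = 0 \<or> y = 0" by simp
      then show False using n I by (auto simp: is_ideal_def)
    qed
  qed
  then show ?thesis using I ne by (auto simp: prime_ideal_def)
qed

lemma t_maximal_t_spec: "t_maximal R M \<Longrightarrow> M \<in> t_spec R"
  using t_maximal_prime by (auto simp: t_spec_def t_maximal_def)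

text \<open>No power of an ideal is expanded: a t-maximal ideal that contains all
  \<open>x ^ n\<close> is prime, so it contains \<open>F\<close>.\<close>

lemma t_proper_powers:
  assumes "finite F" "F \<subseteq> R" "\<not> F \<subseteq> {0}" "1 \<in> vclos R F"
  shows "1 \<in> vclos R ((\<lambda>x. x ^ n) ` F)"
proof (rule ccontr)
  assume neg: "1 \<notin> vclos R ((\<lambda>x. x ^ n) ` F)"
  have "t_proper ((\<lambda>x. x ^ n) ` F)"
    unfolding t_proper_def using neg vclos_mono by blast
  moreover have "(\<lambda>x. x ^ n) ` F \<subseteq> R" using assms power_mem by auto
  ultimately obtain M where M: "t_maximal R M" "(\<lambda>x. x ^ n) ` F \<subseteq> M"
    using t_proper_in_t_maximal[of "(\<lambda>x. x ^ n) ` F"] by metis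
  have P: "prime_ideal R M" using t_maximal_prime M by blast
  then have "1 \<notin> M" using ideal_one by (auto simp: prime_ideal_def)
  have "x \<in> M" if "x \<in> R" "x ^ n \<in> M" for x n
    using that
  proof (induction n)
    case 0
    then show ?case using \<open>1 \<notin> M\<close> by simp
  next
    case (Suc n)
    then show ?case using P power_mem[of x n] unfolding prime_ideal_def power_Suc by blast
  qed
  then have "F \<subseteq> M" using assms(2) M(2) by blast
  moreover have "t_proper M" using M t_ideal_t_proper by (simp add: t_maximal_def)
  ultimately show False using assms unfolding t_proper_def by metis
qed

text \<open>The conductor of \<open>y\<close> into \<open>R\<close> contains the v-closures of its
  finite subsets. If it is proper it lies in a t-maximal ideal \<open>N\<close>, and then
  \<open>y\<close> has no denominator outside \<open>N\<close>.\<close>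

lemma mem_if_mem_all_loc:
  assumes y: "y \<in> qfield R" and all: "\<And>N. t_maximal R N \<Longrightarrow> y \<in> loc R N"
  shows "y \<in> R"
proof (rule ccontr)
  assume n: "y \<notin> R"
  let ?S = "{d \<in> R. d * y \<in> R}"
  have "t_proper ?S"
    unfolding t_proper_def
  proof (intro allI impI notI, elim conjE)
    fix F assume "F \<subseteq> ?S" "1 \<in> vclos R F"
    then have "1 * y \<in> R" using y by (intro vclosD[of 1 F y]) (auto simp: mult.commute)
    then show False using n by simp
  qed
  then obtain N where N: "t_maximal R N" "?S \<subseteq> N"
    using t_proper_in_t_maximal[of ?S] by blast
  obtain a s where "y = a / s" "a \<in> R" "s \<in> R" "s \<notin> N"
    using all[OF N(1)] by (auto simp: loc_def)
  moreover have "0 \<in> N" using N by (auto simp: t_maximal_def t_ideal_def is_ideal_def)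
  ultimately show False using N(2) by (cases "s = 0") auto
qed

end

section \<open>Localization at a prime ideal\<close>

locale prime_at = subdom R for R :: "'k::field set" +
  fixes P :: "'k set"
  assumes prime: "prime_ideal R P"
begin

lemma P_sub: "P \<subseteq> R" and P_0 [simp]: "0 \<in> P" and P_add: "x \<in> P \<Longrightarrow> y \<in> P \<Longrightarrow> x + y \<in> P"
  and P_mult: "r \<in> R \<Longrightarrow> x \<in> P \<Longrightarrow> r * x \<in> P"
  using prime by (auto simp: prime_ideal_def is_ideal_def)

lemma P_mult': "x \<in> P \<Longrightarrow> r \<in> R \<Longrightarrow> x * r \<in> P"
  using P_mult by (simp add: mult.commute)

lemma P_diff: "x \<in> P \<Longrightarrow> y \<in> P \<Longrightarrow> x - y \<in> P"
  using P_add[of x "- y"] P_mult[of "- 1" y] minus_mem by simp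

lemma P_sum: "(\<And>i. i \<in> I \<Longrightarrow> f i \<in> P) \<Longrightarrow> sum f I \<in> P"
  by (induction I rule: infinite_finite_induct) (auto intro: P_add)

lemma one_notin_P [simp]: "1 \<notin> P"
  using prime ideal_one by (auto simp: prime_ideal_def)

lemma P_prime: "x \<in> R \<Longrightarrow> y \<in> R \<Longrightarrow> x * y \<in> P \<Longrightarrow> x \<in> P \<or> y \<in> P"
  using prime by (auto simp: prime_ideal_def)

lemma notin_mult: "x \<in> R \<Longrightarrow> y \<in> R \<Longrightarrow> x \<notin> P \<Longrightarrow> y \<notin> P \<Longrightarrow> x * y \<notin> P"
  using P_prime by blast

lemma notin_power: "x \<in> R \<Longrightarrow> x \<notin> P \<Longrightarrow> x ^ n \<notin> P"
  by (induction n) (simp_all add: notin_mult power_mem)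

lemma notin_prod: "(\<And>i. i \<in> I \<Longrightarrow> f i \<in> R \<and> f i \<notin> P) \<Longrightarrow> prod f I \<notin> P"
  by (induction I rule: infinite_finite_induct) (simp_all add: notin_mult prod_mem)

text \<open>The maximal ideal of the local ring \<open>loc R P\<close>.\<close>

definition locm :: "'k set" where "locm = {a / s | a s. a \<in> P \<and> s \<in> R \<and> s \<notin> P}"

lemma locI: "a \<in> R \<Longrightarrow> s \<in> R \<Longrightarrow> s \<notin> P \<Longrightarrow> a / s \<in> loc R P"
  by (auto simp: loc_def)

lemma locE:
  assumes "x \<in> loc R P"
  obtains a s where "x = a / s" "a \<in> R" "s \<in> R" "s \<notin> P" "s \<noteq> 0"
  using assms P_0 unfolding loc_def by blast

lemma mem_loc: "x \<in> R \<Longrightarrow> x \<in> loc R P"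
  using locI[of x 1] by simp

lemma subdom_loc: "subdom (loc R P)"
proof -
  have "x + y \<in> loc R P \<and> x * y \<in> loc R P \<and> - x \<in> loc R P"
    if "x \<in> loc R P" "y \<in> loc R P" for x y
  proof -
    obtain a b where x: "x = a / b" "a \<in> R" "b \<in> R" "b \<notin> P" "b \<noteq> 0"
      using locE \<open>x \<in> loc R P\<close> by blast
    obtain c d where y: "y = c / d" "c \<in> R" "d \<in> R" "d \<notin> P" "d \<noteq> 0"
      using locE \<open>y \<in> loc R P\<close> by blast
    have e: "x + y = (a * d + c * b) / (b * d)" "x * y = (a * c) / (b * d)" "- x = (- a) / b"
      using x y by (auto simp: field_simps)
    show ?thesis unfolding e using x y
      by (intro conjI locI add_mem mult_mem minus_mem notin_mult) auto
  qed
  then show ?thesis by unfold_locales (auto simp: is_subdomain_def mem_loc)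
qed

lemma loc_qfield: "loc R P \<subseteq> qfield R"
  using qfieldI by (auto elim!: locE)

lemma qfield_loc: "qfield (loc R P) = qfield R"
  using qfield_eq_between subdom_loc mem_loc loc_qfield by blast

lemma loc_inverse: "x \<in> R \<Longrightarrow> x \<notin> P \<Longrightarrow> inverse x \<in> loc R P"
  using locI[of 1 x] by (simp add: divide_inverse)

lemma locm_subset: "locm \<subseteq> loc R P"
  using P_sub by (auto simp: locm_def loc_def)

lemma locm_iff: "x \<in> locm \<longleftrightarrow> x \<in> loc R P \<and> (x = 0 \<or> inverse x \<notin> loc R P)"
proof
  assume "x \<in> locm"
  then obtain a s where x: "x = a / s" "a \<in> P" "s \<in> R" "s \<notin> P" by (auto simp: locm_def)
  have "inverse x \<notin> loc R P" if "x \<noteq> 0"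
  proof
    assume "inverse x \<in> loc R P"
    then obtain b u where b: "inverse x = b / u" "b \<in> R" "u \<in> R" "u \<notin> P" "u \<noteq> 0" by (rule locE)
    have "s * u = a * b" using b x that by (auto simp: field_simps)
    then show False using notin_mult[of s u] P_mult'[of a b] b x by auto
  qed
  then show "x \<in> loc R P \<and> (x = 0 \<or> inverse x \<notin> loc R P)"
    using locm_subset \<open>x \<in> locm\<close> by blast
next
  assume r: "x \<in> loc R P \<and> (x = 0 \<or> inverse x \<notin> loc R P)"
  then obtain a s where x: "x = a / s" "a \<in> R" "s \<in> R" "s \<notin> P" "s \<noteq> 0" by (meson locE)
  have "a \<in> P"
  proof (rule ccontr)
    assume "a \<notin> P"
    then have "inverse x \<in> loc R P" using locI[of s a] x by simp
    moreover have "x \<noteq> 0" using x \<open>a \<notin> P\<close> P_0 by auto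
    ultimately show False using r by blast
  qed
  then show "x \<in> locm" using x by (auto simp: locm_def)
qed

lemma locm_ring_iff: "x \<in> R \<Longrightarrow> x \<in> locm \<longleftrightarrow> x \<in> P"
proof
  assume "x \<in> R" "x \<in> locm"
  then show "x \<in> P" using loc_inverse P_0 by (auto simp: locm_iff)
next
  assume "x \<in> P"
  then show "x \<in> locm" unfolding locm_def using one_notin_P one_mem
    by (metis (mono_tags, lifting) div_by_1 mem_Collect_eq)
qed

lemma locm_prime: "prime_ideal (loc R P) locm"
proof -
  interpret L: subdom "loc R P" by (rule subdom_loc)
  have "x + y \<in> locm" if "x \<in> locm" "y \<in> locm" for x y
  proof -
    obtain a b where x: "x = a / b" "a \<in> P" "b \<in> R" "b \<notin> P"
      using \<open>x \<in> locm\<close> by (auto simp: locm_def)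
    obtain c d where y: "y = c / d" "c \<in> P" "d \<in> R" "d \<notin> P"
      using \<open>y \<in> locm\<close> by (auto simp: locm_def)
    have nz: "b \<noteq> 0" "d \<noteq> 0" using x y P_0 by auto
    have "x + y = (a * d + c * b) / (b * d)" using nz x y by (auto simp: field_simps)
    moreover have "a * d + c * b \<in> P" "b * d \<in> R" "b * d \<notin> P"
      using x y notin_mult[of b d] by (auto intro!: P_add P_mult' mult_mem)
    ultimately show ?thesis unfolding locm_def by blast
  qed
  moreover have "r * x \<in> locm" if "r \<in> loc R P" "x \<in> locm" for r x
  proof -
    obtain a b where x: "x = a / b" "a \<in> P" "b \<in> R" "b \<notin> P"
      using \<open>x \<in> locm\<close> by (auto simp: locm_def)
    obtain c d where r: "r = c / d" "c \<in> R" "d \<in> R" "d \<notin> P"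
      using \<open>r \<in> loc R P\<close> by (rule locE)
    have "r * x = (c * a) / (d * b)" using x r by simp
    then show ?thesis unfolding locm_def using x r P_mult[of c a] mult_mem[of d b] notin_mult[of d b]
      by blast
  qed
  moreover have "x \<in> locm \<or> y \<in> locm" if "x \<in> loc R P" "y \<in> loc R P" "x * y \<in> locm" for x y
  proof (rule ccontr)
    assume "\<not> ?thesis"
    then have "x \<noteq> 0" "y \<noteq> 0" "inverse x \<in> loc R P" "inverse y \<in> loc R P"
      using that by (auto simp: locm_iff)
    then have "inverse (x * y) \<in> loc R P" "x * y \<noteq> 0"
      using L.mult_mem[of "inverse x" "inverse y"] by (auto simp: mult.commute)
    then show False using that by (auto simp: locm_iff)
  qed
  moreover have "1 \<notin> locm" "0 \<in> locm" "1 \<in> loc R P" by (auto simp: locm_iff)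
  ultimately show ?thesis using locm_subset unfolding prime_ideal_def is_ideal_def by metis
qed

lemma loc_common_denominator:
  assumes "finite C" "C \<subseteq> loc R P"
  shows "\<exists>d\<in>R. d \<notin> P \<and> (\<forall>c\<in>C. d * c \<in> R)"
  using assms
proof (induction C)
  case empty
  show ?case by (intro bexI[of _ 1]) auto
next
  case (insert x C)
  then obtain d where d: "d \<in> R" "d \<notin> P" "\<forall>c\<in>C. d * c \<in> R" by auto
  obtain a b where x: "x = a / b" "a \<in> R" "b \<in> R" "b \<notin> P" "b \<noteq> 0"
    using locE insert.prems by blast
  have "b * d * x = d * a" using x by simp
  moreover have "b * d * c \<in> R" if "c \<in> C" for c
    using d x that mult_mem[of b "d * c"] by (simp add: mult.assoc)
  ultimately show ?case using x d notin_mult[of b d]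
    by (intro bexI[of _ "b * d"]) (auto intro: mult_mem)
qed

lemma valuation_locI:
  assumes "\<And>a b. a \<in> R \<Longrightarrow> b \<in> R \<Longrightarrow> a \<noteq> 0 \<Longrightarrow> b \<noteq> 0 \<Longrightarrow> a / b \<in> loc R P \<or> b / a \<in> loc R P"
  shows "valuation_domain (loc R P)"
  unfolding valuation_domain_def qfield_loc
proof (intro conjI ballI impI)
  show "is_subdomain (loc R P)" using subdom_loc by (simp add: subdom_def)
  fix x assume "x \<in> qfield R" "x \<noteq> 0"
  then obtain a b where "x = a / b" "a \<in> R" "b \<in> R" "b \<noteq> 0" "a \<noteq> 0" by (auto elim!: qfieldE)
  then show "x \<in> loc R P \<or> inverse x \<in> loc R P" using assms[of a b] by simp
qed

lemma valuation_loc_cases: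
  assumes "valuation_domain (loc R P)" "x \<in> qfield R" "x \<noteq> 0"
  shows "x \<in> loc R P \<or> inverse x \<in> locm"
  using assms qfield_loc by (auto simp: valuation_domain_def locm_iff)

end

section \<open>Valuation overrings, PvMDs and Pruefer domains\<close>

lemma valuation_overring:
  assumes "valuation_domain V" "V \<subseteq> W" "subdom W" "qfield W = qfield V"
  shows "valuation_domain W"
  using assms by (auto simp: valuation_domain_def subdom_def)

context subdom
begin

lemma PvMD_t_prime:
  assumes "PvMD R" "prime_ideal R P" "t_ideal R P"
  shows "valuation_domain (loc R P)"
proof -
  interpret P: prime_at R P using assms by unfold_locales
  have "P \<noteq> R" "P \<subseteq> R" using P.P_sub P.one_notin_P one_mem by blast+
  then obtain M where M: "t_maximal R M" "P \<subseteq> M"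
    using t_proper_in_t_maximal[OF t_ideal_t_proper[OF assms(3)]] by metis
  interpret M: prime_at R M using t_maximal_prime[OF M(1)] by unfold_locales
  show ?thesis
  proof (rule valuation_overring)
    show "valuation_domain (loc R M)" using assms M by (auto simp: PvMD_def)
    show "loc R M \<subseteq> loc R P" using M(2) by (auto simp: loc_def)
  qed (auto simp: P.subdom_loc P.qfield_loc M.qfield_loc)
qed

text \<open>The argument for t-maximal ideals again, with \<open>fgen\<close> in the place of the
  v-closure.\<close>

lemma proper_in_maximal_ideal:
  assumes I: "is_ideal R I" "I \<noteq> R"
  obtains M where "maximal_ideal R M" "I \<subseteq> M"
proof -
  have one: "1 \<notin> I" using ideal_one I by blast
  have gen: "fgen R F \<subseteq> J" if "is_ideal R J" "F \<subseteq> J" for F J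
  proof -
    have s: "sum h A \<in> J" if "\<And>i. i \<in> A \<Longrightarrow> h i \<in> J" for h and A :: "'k set"
      using that \<open>is_ideal R J\<close>
      by (induction A rule: infinite_finite_induct) (auto simp: is_ideal_def)
    show ?thesis
    proof
      fix y assume "y \<in> fgen R F"
      then obtain c where c: "\<forall>x\<in>F. c x \<in> R" "y = (\<Sum>x\<in>F. c x * x)"
        unfolding fgen_def by blast
      have "c x * x \<in> J" if "x \<in> F" for x
        using \<open>is_ideal R J\<close> c(1) \<open>F \<subseteq> J\<close> that unfolding is_ideal_def by blast
      then show "y \<in> J" unfolding c(2) by (rule s)
    qed
  qed
  have IR: "I \<subseteq> R" using I by (auto simp: is_ideal_def)
  have gI: "1 \<notin> fgen R F" if "finite F" "F \<subseteq> I" for F using gen[OF I(1) that(2)] one by blast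
  let ?good = "\<lambda>F. 1 \<notin> fgen R F"
  obtain M where M: "I \<subseteq> M \<and> M \<subseteq> R \<and> (\<forall>F. finite F \<longrightarrow> F \<subseteq> M \<longrightarrow> ?good F) \<and>
      (\<forall>x. x \<in> R \<longrightarrow> x \<notin> M \<longrightarrow> (\<exists>F. finite F \<and> F \<subseteq> M \<and> \<not> ?good (insert x F)))"
    using finite_character_maximal[where good = ?good, OF IR gI] by (rule exE)
  then have IM: "I \<subseteq> M" and MR: "M \<subseteq> R"
    and pr: "\<And>F. finite F \<Longrightarrow> F \<subseteq> M \<Longrightarrow> 1 \<notin> fgen R F" by auto
  have max: "\<exists>F. finite F \<and> F \<subseteq> M \<and> 1 \<in> fgen R (insert x F)" if "x \<in> R" "x \<notin> M" for x
    using M that by simp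
  have fg: "is_ideal R (fgen R F)" if "finite F" "F \<subseteq> R" for F
  proof -
    have "fgen R F \<subseteq> R"
      using that(2) unfolding fgen_def by (auto intro!: sum_mem mult_mem)
    moreover have "0 \<in> fgen R F" unfolding fgen_def by (auto intro!: exI[of _ "\<lambda>_. 0"])
    moreover have "x + y \<in> fgen R F" if "x \<in> fgen R F" "y \<in> fgen R F" for x y
    proof -
      obtain c d where "\<forall>x\<in>F. c x \<in> R" "x = (\<Sum>x\<in>F. c x * x)" "\<forall>x\<in>F. d x \<in> R" "y = (\<Sum>x\<in>F. d x * x)"
        using \<open>x \<in> fgen R F\<close> \<open>y \<in> fgen R F\<close> unfolding fgen_def by blast
      then show ?thesis unfolding fgen_def
        by (auto intro!: exI[of _ "\<lambda>x. c x + d x"] add_mem simp: sum.distrib distrib_right)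
    qed
    moreover have "r * x \<in> fgen R F" if "r \<in> R" "x \<in> fgen R F" for r x
    proof -
      obtain c where "\<forall>x\<in>F. c x \<in> R" "x = (\<Sum>x\<in>F. c x * x)"
        using \<open>x \<in> fgen R F\<close> unfolding fgen_def by blast
      then show ?thesis unfolding fgen_def using \<open>r \<in> R\<close>
        by (auto intro!: exI[of _ "\<lambda>x. r * c x"] mult_mem simp: sum_distrib_left mult.assoc)
    qed
    ultimately show ?thesis by (auto simp: is_ideal_def)
  qed
  have cl: "g \<in> M" if F: "finite F" "F \<subseteq> M" and g: "g \<in> fgen R F" for F g
  proof (rule ccontr)
    assume "g \<notin> M"
    have "g \<in> R" using fg[OF F(1) order_trans[OF F(2) MR]] g unfolding is_ideal_def by blast
    with max[OF _ \<open>g \<notin> M\<close>] obtain G where G: "finite G" "G \<subseteq> M" "1 \<in> fgen R (insert g G)" by blast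
    have i: "is_ideal R (fgen R (F \<union> G))" using F G MR by (intro fg) auto
    moreover have FG: "F \<union> G \<subseteq> fgen R (F \<union> G)" using fgen_inc F G by blast
    moreover have "fgen R F \<subseteq> fgen R (F \<union> G)" using gen[OF i] FG by blast
    ultimately have "fgen R (insert g G) \<subseteq> fgen R (F \<union> G)" using g by (intro gen) auto
    then show False using pr[of "F \<union> G"] F G by blast
  qed
  have iM: "is_ideal R M"
  proof -
    have "x + y \<in> M" if "x \<in> M" "y \<in> M" for x y
    proof -
      have "is_ideal R (fgen R {x, y})" using that MR by (intro fg) auto
      moreover have "x \<in> fgen R {x, y}" "y \<in> fgen R {x, y}" by (auto intro: fgen_inc)
      ultimately have "x + y \<in> fgen R {x, y}" unfolding is_ideal_def by blast
      then show ?thesis using that by (intro cl[of "{x, y}"]) auto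
    qed
    moreover have "r * x \<in> M" if "x \<in> M" "r \<in> R" for r x
    proof -
      have "is_ideal R (fgen R {x})" using that MR by (intro fg) auto
      moreover have "x \<in> fgen R {x}" by (auto intro: fgen_inc)
      ultimately have "r * x \<in> fgen R {x}" using that(2) unfolding is_ideal_def by blast
      then show ?thesis using that by (intro cl[of "{x}"]) auto
    qed
    moreover have "0 \<in> M" using cl[of "{}" 0] by (simp add: fgen_def)
    ultimately show ?thesis using MR by (auto simp: is_ideal_def)
  qed
  have "1 \<notin> M" using pr[of "{1}"] fgen_inc[of "{1}" 1] by auto
  moreover have "J = M" if J: "is_ideal R J" "M \<subseteq> J" "J \<noteq> R" for J
  proof (rule ccontr)
    assume "J \<noteq> M"
    then obtain x where x: "x \<in> J" "x \<notin> M" using J by blast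
    then have "x \<in> R" using J by (auto simp: is_ideal_def)
    then obtain F where "finite F" "F \<subseteq> M" "1 \<in> fgen R (insert x F)" using max x by blast
    then show False using gen[OF J(1), of "insert x F"] x J ideal_one[OF J(1)] by blast
  qed
  moreover have "M \<noteq> R" using \<open>1 \<notin> M\<close> one_mem by auto
  ultimately have "maximal_ideal R M" using iM unfolding maximal_ideal_def by blast
  then show thesis using that[of M] IM by blast
qed

lemma maximal_ideal_prime: assumes M: "maximal_ideal R M" shows "prime_ideal R M"
proof -
  have I: "is_ideal R M" and ne: "M \<noteq> R"
    and max: "\<And>J. is_ideal R J \<Longrightarrow> M \<subseteq> J \<Longrightarrow> J \<noteq> R \<Longrightarrow> J = M"
    using M by (auto simp: maximal_ideal_def)
  have MR: "M \<subseteq> R" using I by (auto simp: is_ideal_def)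
  have "y \<in> M" if xy: "x \<in> R" "y \<in> R" "x * y \<in> M" and n: "x \<notin> M" for x y
  proof -
    let ?J = "{a + r * x | a r. a \<in> M \<and> r \<in> R}"
    have "is_ideal R ?J"
      unfolding is_ideal_def
    proof (intro conjI ballI)
      show "?J \<subseteq> R" using MR xy by (auto intro: add_mem mult_mem)
      show "0 \<in> ?J" using I by (auto simp: is_ideal_def intro!: exI[of _ 0])
      fix u v assume "u \<in> ?J" "v \<in> ?J"
      then obtain a r b s where "u = a + r * x" "v = b + s * x" "a \<in> M" "r \<in> R" "b \<in> M" "s \<in> R"
        by blast
      moreover have "a + r * x + (b + s * x) = (a + b) + (r + s) * x" by (simp add: algebra_simps)
      ultimately show "u + v \<in> ?J" using I add_mem[of r s] unfolding is_ideal_def by blast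
    next
      fix c u assume "c \<in> R" "u \<in> ?J"
      then obtain a r where "u = a + r * x" "a \<in> M" "r \<in> R" by blast
      moreover have "c * (a + r * x) = c * a + (c * r) * x" by (simp add: algebra_simps)
      ultimately show "c * u \<in> ?J"
        using I mult_mem[of c r] \<open>c \<in> R\<close> unfolding is_ideal_def by blast
    qed
    moreover have "a = a + 0 * x" for a by simp
    then have "M \<subseteq> ?J" using zero_mem by blast
    moreover have "x = 0 + 1 * x" "0 \<in> M" using I by (auto simp: is_ideal_def)
    then have "x \<in> ?J" using one_mem by blast
    ultimately have "?J = R" using max n by blast
    then obtain a r where "1 = a + r * x" "a \<in> M" "r \<in> R" using one_mem by blast
    then have "y = y * a + r * (x * y)" by (metis mult.right_neutral distrib_left mult.commute mult.left_commute)
    then show "y \<in> M" using I xy \<open>a \<in> M\<close> \<open>r \<in> R\<close> unfolding is_ideal_def by metis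
  qed
  then show ?thesis using I ne by (auto simp: prime_ideal_def)
qed

lemma Prufer_prime:
  assumes "Prufer R" "prime_ideal R P"
  shows "valuation_domain (loc R P)"
proof -
  interpret P: prime_at R P using assms by unfold_locales
  obtain M where M: "maximal_ideal R M" "P \<subseteq> M"
    using proper_in_maximal_ideal[of P] assms(2) unfolding prime_ideal_def by metis
  interpret M: prime_at R M using maximal_ideal_prime[OF M(1)] by unfold_locales
  show ?thesis
  proof (rule valuation_overring)
    show "valuation_domain (loc R M)" using assms M by (auto simp: Prufer_def)
    show "loc R M \<subseteq> loc R P" using M(2) by (auto simp: loc_def)
  qed (auto simp: P.subdom_loc P.qfield_loc M.qfield_loc)
qed

lemma valuation_common_divisor:
  assumes V: "valuation_domain R" and C: "finite C" "C \<subseteq> qfield R" "\<not> C \<subseteq> {0}"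
  shows "\<exists>c\<in>C. c \<noteq> 0 \<and> (\<forall>x\<in>C. x / c \<in> R)"
  using C
proof (induction C)
  case empty then show ?case by simp
next
  case (insert x C)
  show ?case
  proof (cases "C \<subseteq> {0}")
    case True
    then show ?thesis using insert.prems by (intro bexI[of _ x]) auto
  next
    case False
    then obtain c where c: "c \<in> C" "c \<noteq> 0" "\<forall>x\<in>C. x / c \<in> R" using insert by auto
    show ?thesis
    proof (cases "x / c \<in> R")
      case True
      then show ?thesis using c by auto
    next
      case False
      then have "x \<noteq> 0" by auto
      moreover have "x / c \<in> qfield R" using insert.prems c qfield_divide by blast
      ultimately have cx: "c / x \<in> R" using V False c(2)
        unfolding valuation_domain_def by (metis divide_eq_0_iff inverse_divide)
      have "y / x \<in> R" if "y \<in> C" for y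
        using mult_mem[of "y / c" "c / x"] c cx that by simp
      then show ?thesis using \<open>x \<noteq> 0\<close> by auto
    qed
  qed
qed

text \<open>Finitely generated fractional ideals of a PvMD are t-invertible, with finitely many
  elements \<open>E\<close> of the inverse as witnesses; the last clause says in dual form that the
  products \<open>e * c\<close> have v-closure \<open>R\<close>.\<close>

lemma PvMD_t_invertible:
  assumes "PvMD R" and C: "finite C" "C \<subseteq> qfield R" "\<not> C \<subseteq> {0}"
  obtains E where "finite E" "E \<subseteq> colon R C"
    "\<And>y. y \<in> qfield R \<Longrightarrow> (\<And>e c. e \<in> E \<Longrightarrow> c \<in> C \<Longrightarrow> y * (e * c) \<in> R) \<Longrightarrow> y \<in> R"
proof -
  let ?S = "(\<lambda>(e, c). e * c) ` (colon R C \<times> C)"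
  have "\<not> t_proper ?S"
  proof
    assume "t_proper ?S"
    moreover have "?S \<subseteq> R" by (auto simp: colon_def)
    ultimately obtain N where N: "t_maximal R N" "?S \<subseteq> N" using t_proper_in_t_maximal by blast
    interpret N: prime_at R N using t_maximal_prime[OF N(1)] by unfold_locales
    interpret L: subdom "loc R N" by (rule N.subdom_loc)
    have "valuation_domain (loc R N)" using assms N by (auto simp: PvMD_def)
    then obtain c where c: "c \<in> C" "c \<noteq> 0" "\<forall>x\<in>C. x / c \<in> loc R N"
      using L.valuation_common_divisor[of C] C N.qfield_loc by auto
    then obtain s where s: "s \<in> R" "s \<notin> N" "\<forall>x\<in>C. s * (x / c) \<in> R"
      using N.loc_common_denominator[of "(\<lambda>x. x / c) ` C"] C by auto
    \<comment> \<open>At \<open>N\<close> the ideal is generated by \<open>c\<close>, so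
      \<open>s / c\<close> belongs to the inverse of \<open>C\<close>, and its product with
      \<open>c\<close> is \<open>s\<close>, an element outside \<open>N\<close>.\<close>
    have "s / c \<in> qfield R" using c C qfield_divide[OF mem_qfield[OF s(1)]] by auto
    moreover have "\<forall>x\<in>C. s / c * x \<in> R" using s(3) by simp
    ultimately have "s / c \<in> colon R C" unfolding colon_def by blast
    moreover have "s / c * c = s" using c by simp
    ultimately have "s \<in> ?S" using c by force
    then show False using s N by blast
  qed
  then obtain F where F: "finite F" "F \<subseteq> ?S" "1 \<in> vclos R F" unfolding t_proper_def by blast
  obtain B where B: "B \<subseteq> colon R C \<times> C" "finite B" "F = (\<lambda>(e, c). e * c) ` B"
    using finite_subset_image[OF F(1,2)] by blast
  show thesis
  proof
    show "finite (fst ` B)" "fst ` B \<subseteq> colon R C" using B by auto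
    fix y assume y: "y \<in> qfield R" "\<And>e c. e \<in> fst ` B \<Longrightarrow> c \<in> C \<Longrightarrow> y * (e * c) \<in> R"
    have "1 * y \<in> R"
      using y B by (intro vclosD[OF F(3)]) force+
    then show "y \<in> R" by simp
  qed
qed

end

section \<open>Polynomials over a subring and Vandermonde denominators\<close>

text \<open>\<open>PvMD\<close> and \<open>Prufer\<close> speak of subrings of a field, so rings of
  polynomials enter as their images in the field of rational functions.\<close>

abbreviation (input) iota :: "'a::field poly \<Rightarrow> 'a poly fract" where "iota \<equiv> poly_to_fract"

lemma iota_0 [simp]: "iota 0 = 0" and iota_1 [simp]: "iota 1 = 1"
  and iota_add: "iota (p + q) = iota p + iota q"
  and iota_mult: "iota (p * q) = iota p * iota q"
  and iota_minus: "iota (- p) = - iota p"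
  and iota_diff: "iota (p - q) = iota p - iota q"
  and iota_inject [simp]: "iota p = iota q \<longleftrightarrow> p = q"
  by (simp_all add: poly_to_fract_def Zero_fract_def One_fract_def eq_fract)

lemma iota_eq_0_iff [simp]: "iota p = 0 \<longleftrightarrow> p = 0"
  using iota_inject[of p 0] unfolding iota_0 .

lemma iota_smult: "iota (smult c p) = iota [:c:] * iota p"
  by (simp flip: iota_mult)

lemma iota_power: "iota (p ^ n) = iota p ^ n"
  by (induction n) (simp_all add: iota_mult)

lemma iota_prod: "iota (prod f I) = (\<Prod>i\<in>I. iota (f i))"
  by (induction I rule: infinite_finite_induct) (simp_all add: iota_mult)

lemma iota_divide_eq:
  "b \<noteq> 0 \<Longrightarrow> g \<noteq> 0 \<Longrightarrow> iota a / iota b = iota f / iota g \<longleftrightarrow> a * g = f * b"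
  by (simp add: frac_eq_eq flip: iota_mult)

lemma poly_overI: "(\<And>i. coeff p i \<in> R) \<Longrightarrow> p \<in> poly_over R"
  and poly_overD: "p \<in> poly_over R \<Longrightarrow> coeff p i \<in> R"
  by (auto simp: poly_over_def)

lemma poly_over_mono: "R \<subseteq> S \<Longrightarrow> poly_over R \<subseteq> poly_over S"
  by (auto simp: poly_over_def)

context subdom
begin

lemma poly_over_0: "0 \<in> poly_over R"
  by (simp add: poly_over_def)

lemma poly_over_const: "c \<in> R \<Longrightarrow> [:c:] \<in> poly_over R"
  by (auto simp: poly_over_def coeff_pCons split: nat.splits)

lemma poly_over_pCons: "c \<in> R \<Longrightarrow> p \<in> poly_over R \<Longrightarrow> pCons c p \<in> poly_over R"
  by (auto simp: poly_over_def coeff_pCons split: nat.splits)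

lemma poly_over_pConsD: "pCons c p \<in> poly_over R \<Longrightarrow> p \<in> poly_over R"
  by (rule poly_overI) (metis poly_overD coeff_pCons_Suc)

lemma poly_over_1: "1 \<in> poly_over R"
  using poly_over_const[of 1] by (simp add: one_pCons)

lemma poly_over_add: "p \<in> poly_over R \<Longrightarrow> q \<in> poly_over R \<Longrightarrow> p + q \<in> poly_over R"
  by (auto simp: poly_over_def add_mem)

lemma poly_over_diff: "p \<in> poly_over R \<Longrightarrow> q \<in> poly_over R \<Longrightarrow> p - q \<in> poly_over R"
  by (auto simp: poly_over_def diff_mem)

lemma poly_over_mult: "p \<in> poly_over R \<Longrightarrow> q \<in> poly_over R \<Longrightarrow> p * q \<in> poly_over R"
  by (auto simp: poly_over_def coeff_mult intro!: sum_mem mult_mem)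

lemma poly_over_smult: "c \<in> R \<Longrightarrow> p \<in> poly_over R \<Longrightarrow> smult c p \<in> poly_over R"
  by (auto simp: poly_over_def mult_mem)

lemma poly_over_monom: "c \<in> R \<Longrightarrow> monom c n \<in> poly_over R"
  by (auto simp: poly_over_def)

lemma poly_over_power: "p \<in> poly_over R \<Longrightarrow> p ^ n \<in> poly_over R"
  by (induction n) (auto intro: poly_over_mult poly_over_1)

lemma poly_mem: "p \<in> poly_over R \<Longrightarrow> x \<in> R \<Longrightarrow> poly p x \<in> R"
  by (auto simp: poly_altdef poly_over_def intro!: sum_mem mult_mem power_mem)

lemma poly_over_pcompose:
  assumes "p \<in> poly_over R" "q \<in> poly_over R"
  shows "pcompose p q \<in> poly_over R"
  using assms(1)
proof (induction p)
  case 0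
  then show ?case by (simp add: poly_over_0)
next
  case (pCons a p)
  have "p \<in> poly_over R" using poly_over_pConsD pCons.prems by blast
  moreover have "a \<in> R" using poly_overD[OF pCons.prems, of 0] by simp
  ultimately show ?case using pCons.IH assms(2)
    by (auto simp: pcompose_pCons intro!: poly_over_add poly_over_mult poly_over_const)
qed

lemma poly_over_division:
  assumes inv: "\<And>x. x \<in> R \<Longrightarrow> inverse x \<in> R" and p: "p \<in> poly_over R" "p \<noteq> 0"
    and a: "a \<in> poly_over R"
  shows "\<exists>q\<in>poly_over R. \<exists>r\<in>poly_over R. a = p * q + r \<and> (r = 0 \<or> degree r < degree p)"
  using a
proof (induction "degree a" arbitrary: a rule: less_induct)
  case less
  show ?case
  proof (cases "degree a < degree p \<or> a = 0")
    case True
    then show ?thesis using less.prems poly_over_0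
      by (intro bexI[of _ 0] bexI[of _ a]) auto
  next
    case False
    define m where "m = monom (lead_coeff a / lead_coeff p) (degree a - degree p)"
    have m: "m \<in> poly_over R"
      unfolding m_def divide_inverse using less.prems p
      by (intro poly_over_monom mult_mem inv) (auto simp: poly_over_def)
    define b where "b = a - p * m"
    have b: "b \<in> poly_over R" unfolding b_def using m less.prems p
      by (intro poly_over_diff poly_over_mult)
    have "degree m \<le> degree a - degree p" unfolding m_def by (rule degree_monom_le)
    then have "degree (p * m) \<le> degree a"
      using degree_mult_le[of p m] False by linarith
    then have "degree b \<le> degree a" unfolding b_def by (intro degree_diff_le) auto
    moreover have "coeff b (degree a) = 0"
      unfolding b_def m_def using False p
      by (simp add: coeff_monom_mult mult.commute[of p])
    ultimately have "b = 0 \<or> degree b < degree a" by (rule eq_zero_or_degree_less)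
    then obtain q r where qr: "q \<in> poly_over R" "r \<in> poly_over R" "b = p * q + r"
      "r = 0 \<or> degree r < degree p"
    proof
      assume "b = 0"
      then show thesis using that[of 0 0] poly_over_0 by simp
    next
      assume "degree b < degree a"
      then show thesis using less.hyps[of b] b that by blast
    qed
    then have "a = p * (q + m) + r" unfolding b_def by (simp add: algebra_simps)
    then show ?thesis using qr m poly_over_add by blast
  qed
qed

lemma poly_over_qfield_denominator:
  assumes "p \<in> poly_over (qfield R)"
  obtains d where "d \<in> R" "d \<noteq> 0" "smult d p \<in> poly_over R"
proof -
  have "set (coeffs p) \<subseteq> qfield R" using assms by (auto simp: poly_over_def coeffs_def)
  then obtain d where d: "d \<in> R" "d \<noteq> 0" "\<forall>c\<in>set (coeffs p). d * c \<in> R"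
    using qfield_common_denominator[of "set (coeffs p)"] by auto
  have "d * coeff p i \<in> R" for i
    using d coeff_in_coeffs[of p i] by (cases "i \<le> degree p \<and> p \<noteq> 0") (auto simp: coeff_eq_0)
  then show thesis using d that[of d] by (simp add: poly_over_def)
qed

section \<open>Vandermonde denominators and integer-valued polynomials under localization\<close>

text \<open>Induction by splitting off the last point \<open>b\<close>: write
  \<open>f = (X - b) g + f(b)\<close>. The new factor \<open>c\<close> of the determinant contains
  each \<open>b - a i\<close>, and \<open>(b - a i) g(a i) = f(b) - f(a i)\<close>, so
  \<open>c g\<close> takes values in \<open>R\<close> at the remaining points.\<close>

lemma vandermonde_mult_coeff_mem:
  fixes a :: "nat \<Rightarrow> 'k"
  assumes "degree f \<le> n" "\<And>i. i \<le> n \<Longrightarrow> a i \<in> R" "\<And>i. i \<le> n \<Longrightarrow> poly f (a i) \<in> R"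
  shows "(\<Prod>j\<le>n. \<Prod>i<j. (a j - a i)) * coeff f k \<in> R"
  using assms
proof (induction n arbitrary: f k)
  case 0
  then obtain c where "f = [:c:]" using degree_eq_zeroE by blast
  then show ?case using 0(3)[of 0] by (auto simp: coeff_pCons split: nat.splits)
next
  case (Suc n)
  define b where "b = a (Suc n)"
  define c where "c = (\<Prod>i<Suc n. (b - a i))"
  define V where "V = (\<Prod>j\<le>n. \<Prod>i<j. (a j - a i))"
  have V': "(\<Prod>j\<le>Suc n. \<Prod>i<j. (a j - a i)) = V * c"
    by (simp add: V_def c_def b_def)
  show ?case
  proof (cases "c = 0")
    case True
    then show ?thesis unfolding V' by simp
  next
    case False
    define g where "g = synthetic_div f b"
    have f: "f = [:- b, 1:] * g + [:poly f b:]"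
      unfolding g_def by (rule synthetic_div_correct'[symmetric])
    have bR: "b \<in> R" using Suc.prems by (simp add: b_def)
    have VR: "V \<in> R" unfolding V_def using Suc.prems by (intro prod_mem diff_mem) auto
    have cR: "c \<in> R" unfolding c_def using Suc.prems bR by (intro prod_mem diff_mem) auto
    have G: "V * coeff (smult c g) k \<in> R" for k
      unfolding V_def
    proof (rule Suc.IH)
      show "degree (smult c g) \<le> n" using Suc.prems(1) by (auto simp: g_def degree_synthetic_div)
      fix i assume i: "i \<le> n"
      have "poly f (a i) = (a i - b) * poly g (a i) + poly f b"
        by (subst f) (simp add: algebra_simps)
      then have "(b - a i) * poly g (a i) = poly f b - poly f (a i)" by (simp add: algebra_simps)
      moreover have "c = (\<Prod>j\<in>{..<Suc n} - {i}. (b - a j)) * (b - a i)"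
        unfolding c_def using i by (subst prod.remove[of _ i]) (auto simp: mult.commute)
      ultimately have "poly (smult c g) (a i)
          = (\<Prod>j\<in>{..<Suc n} - {i}. (b - a j)) * (poly f b - poly f (a i))"
        by (simp add: mult.assoc)
      also have "\<dots> \<in> R" using Suc.prems bR i
        by (intro mult_mem prod_mem diff_mem) (auto simp: b_def)
      finally show "poly (smult c g) (a i) \<in> R" .
      show "a i \<in> R" using Suc.prems(2)[of i] i by simp
    qed
    have "coeff f k = (case k of 0 \<Rightarrow> 0 | Suc m \<Rightarrow> coeff g m) - b * coeff g k + coeff [:poly f b:] k"
      by (subst f) (simp add: coeff_pCons split: nat.splits)
    then have "V * c * coeff f k = V * c * ((case k of 0 \<Rightarrow> 0 | Suc m \<Rightarrow> coeff g m)
        - b * coeff g k + coeff [:poly f b:] k)"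
      by (simp only:)
    also have "\<dots> = (case k of 0 \<Rightarrow> 0 | Suc m \<Rightarrow> V * coeff (smult c g) m)
        - b * (V * coeff (smult c g) k) + V * (c * coeff [:poly f b:] k)"
      by (simp add: algebra_simps split: nat.splits)
    also have "\<dots> \<in> R"
    proof -
      have "(case k of 0 \<Rightarrow> 0 | Suc m \<Rightarrow> V * coeff (smult c g) m) \<in> R"
        using G by (auto split: nat.splits)
      moreover have "b * (V * coeff (smult c g) k) \<in> R" using mult_mem[OF bR G] .
      moreover have "coeff [:poly f b:] k \<in> R"
        using Suc.prems(3)[of "Suc n"] by (auto simp: coeff_pCons b_def split: nat.splits)
      ultimately show ?thesis using VR cR by (intro add_mem diff_mem) (auto intro: mult_mem)
    qed
    finally show ?thesis unfolding V' .
  qed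
qed

end

lemma vandermonde_powers:
  fixes t :: "'k::comm_ring_1"
  shows "(\<Prod>j\<le>n. \<Prod>i<j. (t ^ j - t ^ i))
    = t ^ (\<Sum>j\<le>n. \<Sum>i<j. i) * (\<Prod>j\<le>n. \<Prod>i<j. (t ^ (j - i) - 1))"
proof -
  have "t ^ j - t ^ i = t ^ i * (t ^ (j - i) - 1)" if "i < j" for i j
    using that by (simp add: algebra_simps flip: power_add)
  then have "(\<Prod>j\<le>n. \<Prod>i<j. (t ^ j - t ^ i)) = (\<Prod>j\<le>n. \<Prod>i<j. t ^ i * (t ^ (j - i) - 1))"
    by (intro prod.cong) auto
  then show ?thesis by (simp add: prod.distrib power_sum)
qed

text \<open>The Vandermonde determinant of \<open>1, t, \<dots>, t\<^sup>n\<close> is a power of \<open>t\<close> times factors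
  \<open>t\<^sup>k - 1\<close>, and the exponent depends only on \<open>n\<close>.\<close>

lemma IntD_coeff_power:
  assumes A: "subdom A" and f: "f \<in> IntD A"
  shows "\<exists>e. \<forall>B t k. subdom B \<longrightarrow> A \<subseteq> B \<longrightarrow> t \<in> A \<longrightarrow>
    (\<forall>j>0. t ^ j \<noteq> 1 \<and> inverse (t ^ j - 1) \<in> B) \<longrightarrow> t ^ e * coeff f k \<in> B"
proof (intro exI allI impI)
  \<comment> \<open>There are two rings because the values of \<open>f\<close> are taken in
    \<open>A\<close>, while the factors \<open>t ^ j - 1\<close> only have to be units in
    \<open>B\<close>, typically a localization of \<open>A\<close>.\<close>
  fix B t k assume B: "subdom B" "A \<subseteq> B" "t \<in> A" and u: "\<forall>j>0. t ^ j \<noteq> 1 \<and> inverse (t ^ j - 1) \<in> B"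
  interpret A: subdom A by (rule A)
  interpret B: subdom B by (rule B)
  let ?n = "degree f" and ?e = "\<Sum>j\<le>degree f. \<Sum>i<j. i"
  let ?u = "\<Prod>j\<le>?n. \<Prod>i<j. (t ^ (j - i) - 1)"
  have "(\<Prod>j\<le>?n. \<Prod>i<j. (t ^ j - t ^ i)) * coeff f k \<in> A"
    using f B by (intro A.vandermonde_mult_coeff_mem) (auto simp: IntD_def intro: A.power_mem)
  then have "t ^ ?e * ?u * coeff f k \<in> B"
    unfolding vandermonde_powers using B by blast
  moreover have "inverse ?u \<in> B"
    using u by (auto simp: prod_inversef[symmetric] intro!: B.prod_mem)
  ultimately have "inverse ?u * (t ^ ?e * ?u * coeff f k) \<in> B"
    by (intro B.mult_mem[of "inverse ?u"])
  moreover have "?u \<noteq> 0" using u by simp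
  ultimately show "t ^ ?e * coeff f k \<in> B" by (simp add: field_simps)
qed

lemma IntD_poly_over: "f \<in> IntD D \<Longrightarrow> f \<in> poly_over (qfield D)"
  by (auto simp: IntD_def poly_over_def)

lemma IntD_poly: "f \<in> IntD D \<Longrightarrow> d \<in> D \<Longrightarrow> poly f d \<in> D"
  by (auto simp: IntD_def)

lemma IntDI: "f \<in> poly_over (qfield D) \<Longrightarrow> (\<And>d. d \<in> D \<Longrightarrow> poly f d \<in> D) \<Longrightarrow> f \<in> IntD D"
  by (auto simp: IntD_def poly_over_def)

text \<open>For \<open>n\<close> the degree of \<open>f\<close>, the polynomial
  \<open>s ^ n f(X) - f(s X)\<close> is again in \<open>IntD A\<close> and has lost its leading
  term. At \<open>b = a / s\<close> it expresses \<open>s ^ n f(b)\<close> through a polynomial of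
  smaller degree and \<open>f(a)\<close>, and \<open>s\<close> is a unit of
  \<open>B\<close>.\<close>

lemma IntD_subset_fractions:
  assumes A: "subdom A" and B: "subdom B" and AB: "A \<subseteq> B" "B \<subseteq> qfield A"
    and frac: "\<And>b. b \<in> B \<Longrightarrow> \<exists>a\<in>A. \<exists>s\<in>A. s \<noteq> 0 \<and> inverse s \<in> B \<and> b = a / s"
  shows "IntD A \<subseteq> IntD B"
proof
  interpret A: subdom A by (rule A)
  interpret B: subdom B by (rule B)
  interpret K: subdom "qfield A" by (rule A.subdom_qfield)
  have "poly f b \<in> B" if "f \<in> IntD A" "b \<in> B" for f b
    using that(1)
  proof (induction "degree f" arbitrary: f rule: less_induct)
    case less
    note f = \<open>f \<in> IntD A\<close>
    obtain a s where s: "a \<in> A" "s \<in> A" "s \<noteq> 0" "inverse s \<in> B" "b = a / s"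
      using frac[OF \<open>b \<in> B\<close>] by blast
    show ?case
    proof (cases "degree f = 0")
      case True
      then obtain c where "f = [:c:]" using degree_eq_zeroE by blast
      then show ?thesis using IntD_poly[OF f A.zero_mem] AB by auto
    next
      case False
      let ?n = "degree f"
      define g where "g = smult (s ^ ?n) f - pcompose f [:0, s:]"
      have pg: "poly g x = s ^ ?n * poly f x - poly f (s * x)" for x
        by (simp add: g_def poly_pcompose mult.commute)
      have g: "g \<in> IntD A"
      proof (rule IntDI)
        show "g \<in> poly_over (qfield A)"
          unfolding g_def using s IntD_poly_over[OF f] A.mem_qfield
          by (intro K.poly_over_diff K.poly_over_smult K.poly_over_pcompose K.poly_over_pCons K.poly_over_const
              K.power_mem) (auto intro: K.poly_over_0)
        show "poly g x \<in> A" if "x \<in> A" for x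
          unfolding pg using that s by (intro A.diff_mem A.mult_mem A.power_mem IntD_poly[OF f]) auto
      qed
      have "degree g \<le> ?n"
        unfolding g_def using s by (intro degree_diff_le) (auto simp: degree_pcompose)
      moreover have "coeff (pcompose f [:0, s:]) ?n = s ^ ?n * lead_coeff f"
        using lead_coeff_comp[of "[:0, s:]" f] s by (simp add: mult.commute degree_pcompose)
      then have "coeff g ?n = 0" by (simp add: g_def)
      ultimately have "g = 0 \<or> degree g < ?n" by (rule eq_zero_or_degree_less)
      then have "poly g b \<in> B" using less.hyps[OF _ g] by auto
      moreover have "s * b = a" using s by simp
      then have "s ^ ?n * poly f b = poly g b + poly f a" using pg[of b] by simp
      moreover have "poly f a \<in> B" using IntD_poly[OF f s(1)] AB by blast
      ultimately have "s ^ ?n * poly f b \<in> B" using B.add_mem by simp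
      then have "inverse s ^ ?n * (s ^ ?n * poly f b) \<in> B" using s B.mult_mem B.power_mem by blast
      moreover have "inverse s ^ ?n * (s ^ ?n * poly f b) = poly f b"
        using s(3) by (simp flip: mult.assoc power_mult_distrib)
      ultimately show ?thesis by simp
    qed
  qed
  moreover have "qfield B = qfield A" using A.qfield_eq_between B AB by blast
  ultimately show "f \<in> IntD B" if "f \<in> IntD A" for f
    using that by (auto simp: IntD_def)
qed

context prime_at
begin

lemma poly_over_loc_denominator:
  assumes "p \<in> poly_over (loc R P)"
  obtains d where "d \<in> R" "d \<notin> P" "d \<noteq> 0" "smult d p \<in> poly_over R"
proof -
  have "set (coeffs p) \<subseteq> loc R P" using assms by (auto simp: poly_over_def coeffs_def)
  then obtain d where d: "d \<in> R" "d \<notin> P" "\<forall>c\<in>set (coeffs p). d * c \<in> R"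
    using loc_common_denominator[of "set (coeffs p)"] by auto
  have "d * coeff p i \<in> R" for i
    using d coeff_in_coeffs[of p i] by (cases "i \<le> degree p \<and> p \<noteq> 0") (auto simp: coeff_eq_0)
  moreover have "d \<noteq> 0" using d P_0 by auto
  ultimately show thesis using d that[of d] by (simp add: poly_over_def)
qed

lemma loc_units:
  assumes "t \<in> locm" "j > 0"
  shows "t ^ j \<noteq> 1 \<and> inverse (t ^ j - 1) \<in> loc R P"
proof -
  interpret L: prime_at "loc R P" locm using subdom_loc locm_prime by (simp add: prime_at_def prime_at_axioms_def)
  obtain m where m: "j = Suc m" using assms(2) gr0_conv_Suc by blast
  have tL: "t \<in> loc R P" using assms locm_subset by blast
  have "t ^ j \<in> locm" unfolding m power_Suc using assms L.P_mult'[of t "t ^ m"] L.power_mem tL by blast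
  then have n: "t ^ j - 1 \<notin> locm" using L.P_diff[of "t ^ j" "t ^ j - 1"] by auto
  moreover have "t ^ j - 1 \<in> loc R P" using tL by (intro L.diff_mem L.power_mem) auto
  ultimately show ?thesis using L.P_0 by (auto simp: locm_iff)
qed

end

section \<open>Rings between \<open>D[X]\<close> and \<open>K[X]\<close> and their prime
  ideals\<close>

text \<open>Common frame for \<open>Int(D)\<close> and \<open>Int(D\<^sub>0)\<close> over
  \<open>D\<close> and for \<open>Int(D\<^sub>P)\<close> over \<open>D\<^sub>P\<close>.\<close>

locale poly_ring = subdom D for D :: "'a::field set" +
  fixes E :: "'a poly set"
  assumes DE: "poly_over D \<subseteq> E" and EK: "E \<subseteq> poly_over (qfield D)"
    and E_add: "p \<in> E \<Longrightarrow> q \<in> E \<Longrightarrow> p + q \<in> E"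
    and E_mult: "p \<in> E \<Longrightarrow> q \<in> E \<Longrightarrow> p * q \<in> E"
begin

lemma const_E: "d \<in> D \<Longrightarrow> [:d:] \<in> E"
  using poly_over_const DE by blast

lemma E_smult: "d \<in> D \<Longrightarrow> p \<in> E \<Longrightarrow> smult d p \<in> E"
  using E_mult[of "[:d:]" p] const_E by simp

lemma E_minus: "p \<in> E \<Longrightarrow> - p \<in> E"
  using E_smult[of "- 1" p] minus_mem by simp

lemma E_diff: "p \<in> E \<Longrightarrow> q \<in> E \<Longrightarrow> p - q \<in> E"
  using E_add[of p "- q"] E_minus by simp

lemma zero_E: "0 \<in> E" and one_E: "1 \<in> E" and X_E: "[:0, 1:] \<in> E"
  using DE poly_over_0 poly_over_1 poly_over_pCons[of 0 "[:1:]"] poly_over_const[of 1] by auto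

lemma E_power: "p \<in> E \<Longrightarrow> p ^ n \<in> E"
  by (induction n) (auto intro: E_mult one_E)

lemma E_prod: "(\<And>i. i \<in> I \<Longrightarrow> f i \<in> E) \<Longrightarrow> prod f I \<in> E"
  by (induction I rule: infinite_finite_induct) (auto intro: E_mult one_E)

sublocale ER: subdom "iota ` E"
proof
  have "iota p + iota q \<in> iota ` E \<and> iota p * iota q \<in> iota ` E \<and> - iota p \<in> iota ` E"
    if "p \<in> E" "q \<in> E" for p q
    using that E_add E_mult E_minus by (simp flip: iota_add iota_mult iota_minus)
  moreover have "0 \<in> iota ` E" "1 \<in> iota ` E"
    using zero_E one_E by (metis image_eqI iota_0, metis image_eqI iota_1)
  ultimately show "is_subdomain (iota ` E)" by (auto simp: is_subdomain_def)
qed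

lemma iota_mem_iff [simp]: "iota p \<in> iota ` E \<longleftrightarrow> p \<in> E"
  by auto

lemma iota_qfield:
  assumes "p \<in> poly_over (qfield D)"
  shows "iota p \<in> qfield (iota ` E)"
proof -
  obtain d where d: "d \<in> D" "d \<noteq> 0" "smult d p \<in> poly_over D"
    using poly_over_qfield_denominator[OF assms] by blast
  then have "iota p = iota (smult d p) / iota [:d:]" by (simp add: iota_smult)
  then show ?thesis using d const_E DE by (auto intro!: ER.qfieldI)
qed

lemma qfield_iota_E:
  "qfield (iota ` E) = {iota f / iota g | f g. f \<in> poly_over (qfield D) \<and> g \<in> poly_over (qfield D) \<and> g \<noteq> 0}"
    (is "_ = ?F")
proof
  show "qfield (iota ` E) \<subseteq> ?F"
  proof
    fix x assume "x \<in> qfield (iota ` E)"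
    then obtain f g where "x = iota f / iota g" "f \<in> E" "g \<in> E" "iota g \<noteq> 0"
      by (rule ER.qfieldE) blast
    then show "x \<in> ?F" using EK by auto
  qed
  show "?F \<subseteq> qfield (iota ` E)" using iota_qfield ER.qfield_divide by auto
qed

text \<open>A multiplier of a set with a nonzero constant is a polynomial and can therefore be
  evaluated; this turns v-closures in \<open>Int(D)\<close> into statements about values.\<close>

lemma mem_iota_of_mult_const:
  assumes "y \<in> qfield (iota ` E)" "y * iota [:c:] \<in> iota ` E" "c \<in> qfield D" "c \<noteq> 0"
  obtains p where "p \<in> poly_over (qfield D)" "y = iota p"
proof -
  obtain f where f: "f \<in> E" "y * iota [:c:] = iota f" using assms by auto
  have "y = iota (smult (inverse c) f)"
  proof -
    have "iota (smult (inverse c) f) = iota [:inverse c:] * iota [:c:] * y"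
      using f by (simp add: iota_smult ac_simps)
    also have "iota [:inverse c:] * iota [:c:] = 1"
      using assms by (simp flip: iota_mult add: one_pCons[symmetric])
    finally show ?thesis by simp
  qed
  moreover have "smult (inverse c) f \<in> poly_over (qfield D)"
    using f EK assms qfield_inverse by (intro subdom.poly_over_smult[OF subdom_qfield]) auto
  ultimately show thesis using that by blast
qed

end

locale poly_prime = poly_ring +
  fixes Q :: "'a poly fract set"
  assumes Q_prime: "prime_ideal (poly_to_fract ` E) Q"
begin

sublocale Q: prime_at "iota ` E" Q
  by unfold_locales (rule Q_prime)

definition ctr :: "'a set" where "ctr = {d \<in> D. iota [:d:] \<in> Q}"

lemma const_mem_iff: "d \<in> D \<Longrightarrow> iota [:d:] \<in> Q \<longleftrightarrow> d \<in> ctr"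
  by (simp add: ctr_def)

lemma ctr_prime: "prime_ideal D ctr"
proof -
  have "x + y \<in> ctr" if "x \<in> ctr" "y \<in> ctr" for x y
  proof -
    have "iota [:x + y:] = iota [:x:] + iota [:y:]" by (simp flip: iota_add)
    then show ?thesis using that Q.P_add[of "iota [:x:]" "iota [:y:]"] by (auto simp: ctr_def add_mem)
  qed
  moreover have "r * x \<in> ctr" if "r \<in> D" "x \<in> ctr" for r x
  proof -
    have "iota [:r * x:] = iota [:r:] * iota [:x:]" by (simp flip: iota_mult)
    then show ?thesis using that Q.P_mult[of "iota [:r:]" "iota [:x:]"] const_E
      by (auto simp: ctr_def mult_mem)
  qed
  moreover have "x \<in> ctr \<or> y \<in> ctr" if "x \<in> D" "y \<in> D" "x * y \<in> ctr" for x y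
  proof -
    have "iota [:x * y:] = iota [:x:] * iota [:y:]" by (simp flip: iota_mult)
    then show ?thesis using that Q.P_prime[of "iota [:x:]" "iota [:y:]"] const_E
      by (auto simp: ctr_def)
  qed
  moreover have "1 \<notin> ctr" using Q.one_notin_P by (simp add: ctr_def flip: one_pCons)
  moreover have "0 \<in> ctr" by (simp add: ctr_def)
  ultimately show ?thesis unfolding prime_ideal_def is_ideal_def using one_mem
    by (auto simp: ctr_def)
qed

sublocale P: prime_at D ctr
  by unfold_locales (rule ctr_prime)

lemma Q_smult: "d \<in> D \<Longrightarrow> p \<in> E \<Longrightarrow> iota p \<in> Q \<Longrightarrow> iota (smult d p) \<in> Q"
  unfolding iota_smult using Q.P_mult const_E by auto

lemma Q_smult_ctr: "d \<in> ctr \<Longrightarrow> p \<in> E \<Longrightarrow> iota (smult d p) \<in> Q"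
  unfolding iota_smult using Q.P_mult' by (auto simp: ctr_def)

lemma Q_smult_cancel: "d \<in> D \<Longrightarrow> d \<notin> ctr \<Longrightarrow> p \<in> E \<Longrightarrow> iota (smult d p) \<in> Q \<Longrightarrow> iota p \<in> Q"
  unfolding iota_smult using Q.P_prime[of "iota [:d:]" "iota p"] const_E by (auto simp: const_mem_iff)

text \<open>Descent on the degree. If one of \<open>a\<close>, \<open>b\<close> is outside
  \<open>Q\<close>, a quotient is visible at once. Otherwise both are divisible over the quotient
  field by an element \<open>p\<close> of least degree in \<open>Q\<close>; cancelling
  \<open>p\<close> and clearing denominators by one common constant leaves the quotient
  unchanged.\<close>

lemma valuation_if_ctr_0:
  assumes "ctr = {0}"
  shows "valuation_domain (loc (iota ` E) Q)"
proof (rule Q.valuation_locI)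
  interpret K: subdom "qfield D" by (rule subdom_qfield)
  have main: "iota a / iota b \<in> loc (iota ` E) Q \<or> iota b / iota a \<in> loc (iota ` E) Q"
    if "a \<in> E" "b \<in> E" "a \<noteq> 0" "b \<noteq> 0" for a b
    using that
  proof (induction "degree a" arbitrary: a b rule: less_induct)
    case less
    show ?case
    proof (cases "iota a \<in> Q \<and> iota b \<in> Q")
      case False
      then show ?thesis using less.prems by (auto intro: Q.locI)
    next
      case True
      have "\<exists>p. (p \<in> E \<and> p \<noteq> 0 \<and> iota p \<in> Q) \<and>
          (\<forall>q. q \<in> E \<and> q \<noteq> 0 \<and> iota q \<in> Q \<longrightarrow> degree p \<le> degree q)"
        by (rule ex_has_least_nat[of _ a]) (use True less.prems in auto)
      then obtain p where p: "p \<in> E" "p \<noteq> 0" "iota p \<in> Q"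
        and min: "\<And>q. q \<in> E \<Longrightarrow> q \<noteq> 0 \<Longrightarrow> iota q \<in> Q \<Longrightarrow> degree p \<le> degree q" by blast
      \<comment> \<open>Here the zero trace enters: a constant in \<open>Q\<close> would give a
        nonzero element of \<open>ctr\<close>. So cancelling \<open>p\<close> really lowers the
        degree.\<close>
      have deg: "degree p \<noteq> 0"
      proof
        assume "degree p = 0"
        then obtain c where c: "p = [:c:]" using degree_eq_zeroE by blast
        obtain d where d: "d \<in> D" "d \<noteq> 0" "smult d p \<in> poly_over D"
          using poly_over_qfield_denominator p EK by blast
        then have "d * c \<in> D" using c poly_overD[OF d(3), of 0] by simp
        then have "d * c \<in> ctr" using Q_smult[OF d(1) p(1) p(3)] c by (simp add: ctr_def)
        then show False using assms d p c by auto
      qed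
      have div: "\<exists>q\<in>poly_over (qfield D). x = p * q" if x: "x \<in> E" "iota x \<in> Q" for x
      proof -
        have pp: "p \<in> poly_over (qfield D)" "x \<in> poly_over (qfield D)" using p EK x by auto
        obtain q r where qr: "q \<in> poly_over (qfield D)" "r \<in> poly_over (qfield D)"
          "x = p * q + r" "r = 0 \<or> degree r < degree p"
          using K.poly_over_division[OF qfield_inverse pp(1) p(2) pp(2)] by blast
        have "r = 0"
        proof (rule ccontr)
          assume r: "r \<noteq> 0"
          obtain d where d: "d \<in> D" "d \<noteq> 0" "smult d q \<in> poly_over D"
            using poly_over_qfield_denominator[OF qr(1)] by blast
          have e: "smult d r = smult d x - p * smult d q" using qr by (simp add: algebra_simps smult_add_right)
          have dq: "smult d q \<in> E" using d DE by auto
          have "smult d r \<in> E" unfolding e using E_diff[OF E_smult[OF d(1) x(1)] E_mult[OF p(1) dq]] .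
          moreover have "iota (smult d r) \<in> Q" unfolding e iota_diff iota_mult[of p]
            using Q.P_diff[OF Q_smult[OF d(1) x] Q.P_mult'[OF p(3)]] dq by simp
          ultimately show False using min[of "smult d r"] r d qr(4) by auto
        qed
        then show ?thesis using qr by auto
      qed
      obtain u v where uv: "u \<in> poly_over (qfield D)" "v \<in> poly_over (qfield D)" "a = p * u" "b = p * v"
        using div[of a] div[of b] True less.prems by blast
      obtain d where d: "d \<in> D" "d \<noteq> 0" "smult d u \<in> poly_over D"
        using poly_over_qfield_denominator[OF uv(1)] by blast
      obtain d' where d': "d' \<in> D" "d' \<noteq> 0" "smult d' v \<in> poly_over D"
        using poly_over_qfield_denominator[OF uv(2)] by blast
      let ?u = "smult (d' * d) u" and ?v = "smult (d * d') v"
      have ne: "u \<noteq> 0" "v \<noteq> 0" using uv less.prems by auto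
      have E: "?u \<in> E" "?v \<in> E"
        using poly_over_smult[OF d'(1) d(3)] poly_over_smult[OF d(1) d'(3)] DE by auto
      have "degree ?u < degree a" using uv(3) p ne d d' deg by (simp add: degree_mult_eq)
      moreover have "?u \<noteq> 0" "?v \<noteq> 0" using ne d d' by auto
      ultimately have "iota ?u / iota ?v \<in> loc (iota ` E) Q \<or> iota ?v / iota ?u \<in> loc (iota ` E) Q"
        using less.hyps[OF _ E] by blast
      moreover have "iota ?u / iota ?v = iota a / iota b" "iota ?v / iota ?u = iota b / iota a"
        using ne d d' less.prems by (auto simp: iota_divide_eq uv ac_simps)
      ultimately show ?thesis by simp
    qed
  qed
  fix a b assume "a \<in> iota ` E" "b \<in> iota ` E" "a \<noteq> 0" "b \<noteq> 0"
  then obtain p q where "a = iota p" "b = iota q" "p \<in> E" "q \<in> E" "p \<noteq> 0" "q \<noteq> 0" by auto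
  then show "a / b \<in> loc (iota ` E) Q \<or> b / a \<in> loc (iota ` E) Q" using main[of p q] by simp
qed

lemma Q_cancel_loc_mult:
  assumes "x \<in> E" "iota x \<in> Q" "h \<in> poly_over (loc D ctr)" "g \<in> E" "g = x * h"
  shows "iota g \<in> Q"
proof -
  obtain s where s: "s \<in> D" "s \<notin> ctr" "smult s h \<in> poly_over D"
    using P.poly_over_loc_denominator[OF assms(3)] by blast
  have "smult s g = x * smult s h" by (simp add: assms(5))
  then have "iota (smult s g) = iota x * iota (smult s h)" by (simp only: iota_mult)
  then have "iota (smult s g) \<in> Q" using assms(2) s(3) DE Q.P_mult' by auto
  then show ?thesis using Q_smult_cancel s assms by blast
qed

text \<open>From \<open>X g = c f\<close> one gets \<open>f = X h\<close> and
  \<open>g = c h\<close>; from \<open>c g = X f\<close> one gets \<open>g = X h\<close>. In both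
  cases \<open>h\<close> has coefficients in \<open>loc D ctr\<close>, so a denominator outside
  \<open>ctr\<close> shows that \<open>g\<close> lies in \<open>Q\<close>.\<close>

lemma not_valuation_if_X_mem:
  assumes EL: "E \<subseteq> poly_over (loc D ctr)" and X: "iota [:0, 1:] \<in> Q" and "ctr \<noteq> {0}"
  shows "\<not> valuation_domain (loc (iota ` E) Q)"
proof
  assume val: "valuation_domain (loc (iota ` E) Q)"
  interpret L: subdom "loc D ctr" by (rule P.subdom_loc)
  obtain c where c: "c \<in> ctr" "c \<noteq> 0" using assms(3) P.P_0 by auto
  have cD: "c \<in> D" using c by (simp add: ctr_def)
  have cE: "[:c:] \<in> E" "iota [:c:] \<in> Q" using c const_E by (auto simp: ctr_def)
  let ?x = "iota [:0, 1:] / iota [:c:]"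
  have "?x \<in> qfield (iota ` E)" using X_E cE c by (intro ER.qfieldI) auto
  moreover have "?x \<noteq> 0" using c by auto
  ultimately have "?x \<in> loc (iota ` E) Q \<or> inverse ?x \<in> loc (iota ` E) Q"
    using val Q.qfield_loc by (auto simp: valuation_domain_def)
  then show False
  proof
    assume "?x \<in> loc (iota ` E) Q"
    then obtain f g where fg: "?x = iota f / iota g" "f \<in> E" "g \<in> E" "iota g \<notin> Q"
      by (auto elim!: Q.locE)
    have "g \<noteq> 0" using fg by auto
    then have e: "[:0, 1:] * g = f * [:c:]" using fg(1) c by (subst (asm) iota_divide_eq) auto
    obtain a h where f: "f = pCons a h" by (cases f)
    then have "a = 0" "g = [:c:] * h" using e c by auto
    moreover have "h \<in> poly_over (loc D ctr)" using subsetD[OF EL fg(2)] L.poly_over_pConsD unfolding f by simp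
    ultimately show False using Q_cancel_loc_mult[OF cE] fg by blast
  next
    assume "inverse ?x \<in> loc (iota ` E) Q"
    then have "iota [:c:] / iota [:0, 1:] \<in> loc (iota ` E) Q" by simp
    then obtain f g where fg: "iota [:c:] / iota [:0, 1:] = iota f / iota g" "f \<in> E" "g \<in> E" "iota g \<notin> Q"
      by (auto elim!: Q.locE)
    have "g \<noteq> 0" using fg by auto
    then have e: "[:c:] * g = f * [:0, 1:]" using fg(1) by (subst (asm) iota_divide_eq) auto
    obtain a h where g: "g = pCons a h" by (cases g)
    then have "a = 0" using e c by auto
    then have "g = [:0, 1:] * h" using g by simp
    moreover have "h \<in> poly_over (loc D ctr)" using L.poly_over_pConsD[of a h] subsetD[OF EL fg(3)] g by simp
    ultimately show False using Q_cancel_loc_mult[OF X_E X] fg by blast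
  qed
qed

text \<open>Dividing by a coefficient of least value writes every nonzero element as
  \<open>k A\<close> with \<open>k\<close> in the quotient field and \<open>A\<close> in
  \<open>E\<close> outside \<open>Q\<close>. Comparing two elements is then comparing their factors
  \<open>k\<close> in \<open>loc D ctr\<close>.\<close>

lemma valuation_if_content:
  assumes EL: "E \<subseteq> poly_over (loc D ctr)" and val: "valuation_domain (loc D ctr)"
    and Q: "\<And>f. f \<in> E \<Longrightarrow> iota f \<in> Q \<Longrightarrow> f \<in> poly_over P.locm"
  shows "valuation_domain (loc (iota ` E) Q)"
proof (rule Q.valuation_locI)
  interpret L: subdom "loc D ctr" by (rule P.subdom_loc)
  have prim: "\<exists>k\<in>qfield D. \<exists>A\<in>E. k \<noteq> 0 \<and> iota A \<notin> Q \<and> a = smult k A" if a: "a \<in> E" "a \<noteq> 0" for a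
  proof -
    have aL: "a \<in> poly_over (loc D ctr)" using a EL by blast
    then have "set (coeffs a) \<subseteq> qfield (loc D ctr)" "\<not> set (coeffs a) \<subseteq> {0}"
      using a P.loc_qfield P.qfield_loc by (auto simp: poly_over_def coeffs_def intro: coeff_in_coeffs)
    then obtain c where c: "c \<in> set (coeffs a)" "c \<noteq> 0" "\<forall>x\<in>set (coeffs a). x / c \<in> loc D ctr"
      using L.valuation_common_divisor[OF val, of "set (coeffs a)"] by auto
    obtain i where i: "c = coeff a i" using c by (auto simp: coeffs_def split: if_splits)
    let ?a = "smult (inverse c) a"
    have "coeff a j / c \<in> loc D ctr" for j
      using c coeff_in_coeffs[OF a(2), of j] by (cases "j \<le> degree a") (auto simp: coeff_eq_0)
    then have "?a \<in> poly_over (loc D ctr)" by (simp add: poly_over_def divide_inverse mult.commute)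
    then obtain s where s: "s \<in> D" "s \<notin> ctr" "s \<noteq> 0" "smult s ?a \<in> poly_over D"
      using P.poly_over_loc_denominator by blast
    have "iota (smult s ?a) \<notin> Q"
    proof
      assume "iota (smult s ?a) \<in> Q"
      moreover have "smult s ?a \<in> E" using s(4) DE by blast
      ultimately have "coeff (smult s ?a) i \<in> P.locm" using poly_overD[OF Q] by blast
      moreover have "coeff (smult s ?a) i = s" using i c by (simp add: field_simps)
      ultimately have "s \<in> P.locm" by (simp only:)
      then show False using P.locm_ring_iff s by simp
    qed
    moreover have "a = smult (c / s) (smult s ?a)" using c s by simp
    moreover have "c / s \<in> qfield D"
      using poly_overD[OF aL, of i] s(1) P.loc_qfield i by (auto intro: qfield_divide mem_qfield)
    ultimately show ?thesis using s DE c by (intro bexI[of _ "c / s"] bexI[of _ "smult s ?a"]) auto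
  qed
  have half: "iota (smult k A) / iota (smult l B) \<in> loc (iota ` E) Q"
    if "k \<noteq> 0" "l \<noteq> 0" "A \<in> E" "B \<in> E" "iota B \<notin> Q" "k / l \<in> loc D ctr" for k l A B
  proof -
    obtain u v where uv: "k / l = u / v" "u \<in> D" "v \<in> D" "v \<notin> ctr" "v \<noteq> 0"
      using \<open>k / l \<in> loc D ctr\<close> by (rule P.locE)
    have "B \<noteq> 0" using that by auto
    then have "iota (smult k A) / iota (smult l B) = iota (smult u A) / iota (smult v B)"
      using that uv by (subst iota_divide_eq) (auto simp: field_simps)
    moreover have "iota (smult v B) \<notin> Q" using Q_smult_cancel uv that by blast
    ultimately show ?thesis using uv that by (auto intro!: Q.locI E_smult)
  qed
  fix a b assume "a \<in> iota ` E" "b \<in> iota ` E" "a \<noteq> 0" "b \<noteq> 0"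
  then obtain a' b' where ab: "a = iota a'" "b = iota b'" "a' \<in> E" "b' \<in> E" "a' \<noteq> 0" "b' \<noteq> 0" by auto
  obtain k A where A: "k \<in> qfield D" "A \<in> E" "k \<noteq> 0" "iota A \<notin> Q" "a' = smult k A"
    using prim ab by blast
  obtain l B where B: "l \<in> qfield D" "B \<in> E" "l \<noteq> 0" "iota B \<notin> Q" "b' = smult l B"
    using prim ab by blast
  have "k / l \<in> qfield D" "k / l \<noteq> 0" using A B qfield_divide by auto
  then have "k / l \<in> loc D ctr \<or> l / k \<in> loc D ctr"
    using val P.qfield_loc unfolding valuation_domain_def by (metis inverse_divide)
  then show "a / b \<in> loc (iota ` E) Q \<or> b / a \<in> loc (iota ` E) Q"
    using half[of k l A B] half[of l k B A] A B ab by auto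
qed

end

section \<open>Integer-valued polynomials and t-maximal ideals\<close>

context subdom
begin

lemma IntD_poly_ring_ext:
  assumes "subdom B" "R \<subseteq> B" "B \<subseteq> qfield R"
  shows "poly_ring R (IntD B)"
proof -
  interpret B: subdom B by fact
  interpret K: subdom "qfield B" by (rule B.subdom_qfield)
  have q: "qfield B = qfield R" using qfield_eq_between assms by blast
  show ?thesis
  proof
    have "poly_over R \<subseteq> poly_over B" using assms(2) by (rule poly_over_mono)
    then show "poly_over R \<subseteq> IntD B"
      using poly_over_mono[of R "qfield B"] assms(2) B.mem_qfield by (auto intro!: IntDI B.poly_mem)
    show "IntD B \<subseteq> poly_over (qfield R)" using IntD_poly_over[of _ B] q by auto
    show "p + q \<in> IntD B" "p * q \<in> IntD B" if "p \<in> IntD B" "q \<in> IntD B" for p q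
      using that IntD_poly_over[of _ B] IntD_poly[of _ B]
      by (auto intro!: IntDI K.poly_over_add K.poly_over_mult B.add_mem B.mult_mem)
  qed
qed

lemma IntD_poly_ring: "poly_ring R (IntD R)"
  using IntD_poly_ring_ext[of R] subdom_axioms mem_qfield by blast

end

context prime_at
begin

lemma IntD_subset_loc: "IntD R \<subseteq> IntD (loc R P)"
proof (rule IntD_subset_fractions)
  show "\<exists>a\<in>R. \<exists>s\<in>R. s \<noteq> 0 \<and> inverse s \<in> loc R P \<and> b = a / s" if "b \<in> loc R P" for b
    using that by (rule locE) (use loc_inverse in blast)
qed (use subdom_axioms subdom_loc mem_loc loc_qfield in auto)

lemma loc_cancel:
  assumes "s \<in> R" "s \<notin> P" "s * x \<in> loc R P"
  shows "x \<in> loc R P"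
proof -
  interpret L: subdom "loc R P" by (rule subdom_loc)
  have "inverse s * (s * x) \<in> loc R P" using assms loc_inverse by (intro L.mult_mem[of "inverse s"]) auto
  moreover have "s \<noteq> 0" using assms by auto
  ultimately show ?thesis by (simp flip: mult.assoc)
qed

lemma IntD_locI: "s \<in> R \<Longrightarrow> s \<notin> P \<Longrightarrow> smult s f \<in> IntD R \<Longrightarrow> f \<in> IntD_loc R P"
proof -
  assume s: "s \<in> R" "s \<notin> P" "smult s f \<in> IntD R"
  then have "s \<noteq> 0" using P_0 by auto
  then have "f = smult (inverse s) (smult s f)" by simp
  then show ?thesis unfolding IntD_loc_def using s by blast
qed

lemma IntD_locE:
  assumes "f \<in> IntD_loc R P"
  obtains s where "s \<in> R" "s \<notin> P" "s \<noteq> 0" "smult s f \<in> IntD R"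
proof -
  obtain g s where g: "f = smult (inverse s) g" "g \<in> IntD R" "s \<in> R" "s \<notin> P"
    using assms by (auto simp: IntD_loc_def)
  moreover have "s \<noteq> 0" using g P_0 by auto
  ultimately show thesis using that[of s] by simp
qed

lemma IntD_loc_common_denominator:
  assumes "finite F" "F \<subseteq> IntD_loc R P"
  shows "\<exists>s\<in>R. s \<notin> P \<and> (\<forall>f\<in>F. smult s f \<in> IntD R)"
  using assms
proof (induction F)
  case empty
  show ?case by (intro bexI[of _ 1]) auto
next
  case (insert f F)
  interpret E: poly_ring R "IntD R" by (rule IntD_poly_ring)
  obtain s where s: "s \<in> R" "s \<notin> P" "\<forall>f\<in>F. smult s f \<in> IntD R" using insert by auto
  obtain u where u: "u \<in> R" "u \<notin> P" "smult u f \<in> IntD R" using insert.prems IntD_locE by blast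
  have "smult (s * u) f \<in> IntD R" using E.E_smult[OF s(1) u(3)] by simp
  moreover have "smult (s * u) g \<in> IntD R" if "g \<in> F" for g
    using E.E_smult[OF u(1), of "smult s g"] s(3) that by (simp add: mult.commute)
  ultimately show ?case using mult_mem[OF s(1) u(1)] notin_mult[OF s(1) u(1) s(2) u(2)]
    by (intro bexI[of _ "s * u"]) auto
qed

lemma poly_over_loc_subset: "poly_over (loc R P) \<subseteq> IntD_loc R P"
proof
  fix f assume "f \<in> poly_over (loc R P)"
  then obtain s where s: "s \<in> R" "s \<notin> P" "smult s f \<in> poly_over R"
    by (rule poly_over_loc_denominator)
  interpret E: poly_ring R "IntD R" by (rule IntD_poly_ring)
  show "f \<in> IntD_loc R P" using s E.DE by (blast intro: IntD_locI)
qed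

lemma IntD_subset_IntD_loc: "IntD R \<subseteq> IntD_loc R P"
  using IntD_locI[of 1] by auto

lemma IntD_loc_eqI:
  assumes "IntD R \<subseteq> poly_over (loc R P)"
  shows "IntD_loc R P = poly_over (loc R P)"
proof
  interpret L: subdom "loc R P" by (rule subdom_loc)
  show "IntD_loc R P \<subseteq> poly_over (loc R P)"
    unfolding IntD_loc_def using assms loc_inverse by (auto intro!: L.poly_over_smult)
qed (rule poly_over_loc_subset)

text \<open>The residue of \<open>t\<close> is neither 0 nor a root of unity, so the Vandermonde
  determinants of its powers are units at \<open>P\<close>. Both choices of \<open>A\<close> occur:
  \<open>R\<close> to test membership in \<open>Lambda0\<close>, and \<open>loc R P\<close> to bound
  \<open>Int(D\<^sub>0)\<close>.\<close>

lemma IntD_subset_poly_over_loc: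
  assumes t: "t \<in> R" "t \<notin> P" "\<And>j. j > 0 \<Longrightarrow> t ^ j - 1 \<notin> P"
    and A: "A = R \<or> A = loc R P"
  shows "IntD A \<subseteq> poly_over (loc R P)"
proof
  interpret L: subdom "loc R P" by (rule subdom_loc)
  fix f assume f: "f \<in> IntD A"
  have sA: "subdom A" and AL: "A \<subseteq> loc R P" and tA: "t \<in> A"
    using A subdom_axioms subdom_loc mem_loc t by auto
  obtain e where e: "\<forall>B t k. subdom B \<longrightarrow> A \<subseteq> B \<longrightarrow> t \<in> A \<longrightarrow>
    (\<forall>j>0. t ^ j \<noteq> 1 \<and> inverse (t ^ j - 1) \<in> B) \<longrightarrow> t ^ e * coeff f k \<in> B"
    using IntD_coeff_power[OF sA f] by (rule exE)
  have u: "t ^ j \<noteq> 1 \<and> inverse (t ^ j - 1) \<in> loc R P" if "j > 0" for j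
    using t(3)[OF that] t(1) P_0 by (auto intro!: loc_inverse diff_mem power_mem)
  have "t ^ e * coeff f k \<in> loc R P" for k
    using e subdom_loc AL tA u by blast
  then show "f \<in> poly_over (loc R P)"
    using loc_cancel[OF power_mem notin_power] t by (blast intro: poly_overI)
qed

text \<open>Any \<open>t\<close> in \<open>M\<close> outside \<open>P\<close> will do:
  \<open>t ^ j - 1 \<in> P\<close> with \<open>j > 0\<close> would put 1 into
  \<open>M\<close>.\<close>

lemma IntD_subset_poly_over_loc_nonmaximal:
  assumes M: "prime_ideal R M" "P \<subset> M" and A: "A = R \<or> A = loc R P"
  shows "IntD A \<subseteq> poly_over (loc R P)"
proof -
  interpret M: prime_at R M using M by unfold_locales
  obtain t where t: "t \<in> M" "t \<notin> P" using M by blast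
  have "t ^ j - 1 \<notin> P" if "j > 0" for j
  proof
    assume "t ^ j - 1 \<in> P"
    moreover have "t ^ j \<in> M" using that t M.P_mult'[of t "t ^ (j - 1)"] M.P_sub power_mem
      by (cases j) auto
    ultimately have "t ^ j - (t ^ j - 1) \<in> M" using psubsetD[OF M(2)] M.P_diff by blast
    then show False using M.one_notin_P by simp
  qed
  then show ?thesis using IntD_subset_poly_over_loc[of t A] t M.P_sub A by blast
qed

end

lemma (in subdom) Lambda0_t_maximal:
  assumes P: "P \<in> Lambda0 R"
  shows "t_maximal R P"
proof -
  have Ps: "prime_ideal R P" "t_ideal R P" using P by (auto simp: Lambda0_def t_spec_def)
  interpret P: prime_at R P using Ps by unfold_locales
  have "P \<noteq> R" using P.one_notin_P one_mem by blast
  then obtain M where M: "t_maximal R M" "P \<subseteq> M"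
    using t_proper_in_t_maximal[OF t_ideal_t_proper[OF Ps(2)] P.P_sub] by blast
  have "P = M"
  proof (rule ccontr)
    assume "P \<noteq> M"
    then have "IntD R \<subseteq> poly_over (loc R P)"
      using P.IntD_subset_poly_over_loc_nonmaximal[OF t_maximal_prime[OF M(1)]] M(2) by blast
    then show False using P P.IntD_loc_eqI by (auto simp: Lambda0_def)
  qed
  then show ?thesis using M(1) by (simp only:)
qed

section \<open>Traces of t-ideals and t-maximal ideals above a given one\<close>

context poly_ring
begin

lemma iota_vclosD:
  assumes "iota g \<in> vclos (iota ` E) (iota ` F)" "y \<in> poly_over (qfield D)" "\<And>f. f \<in> F \<Longrightarrow> y * f \<in> E"
  shows "y * g \<in> E"
proof -
  have "iota g * iota y \<in> iota ` E"
    using assms(3) by (intro ER.vclosD[OF assms(1) iota_qfield[OF assms(2)]]) (auto simp flip: iota_mult)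
  then show ?thesis by (simp add: mult.commute flip: iota_mult)
qed

text \<open>If a polynomial \<open>p\<close> multiplies the constants \<open>C\<close> into
  \<open>Int(D)\<close>, then each value \<open>p(d)\<close> multiplies \<open>C\<close> into
  \<open>D\<close>, hence also \<open>x\<close> into \<open>D\<close>.\<close>

lemma const_vclos:
  assumes E: "E = IntD D" and C: "C \<subseteq> D" "\<not> C \<subseteq> {0}" and x: "x \<in> vclos D C"
  shows "iota [:x:] \<in> vclos (iota ` E) ((\<lambda>c. iota [:c:]) ` C)"
proof -
  have xD: "x \<in> D" using x vclos_subset_ring[OF C(1)] by blast
  interpret K: subdom "qfield D" by (rule subdom_qfield)
  obtain c where c: "c \<in> C" "c \<noteq> 0" using C by auto
  have "iota [:x:] * y \<in> iota ` E"
    if y: "y \<in> qfield (iota ` E)" "\<forall>f\<in>(\<lambda>c. iota [:c:]) ` C. y * f \<in> iota ` E" for y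
  proof -
    obtain p where p: "p \<in> poly_over (qfield D)" "y = iota p"
      using mem_iota_of_mult_const[OF y(1), of c] y(2) c C mem_qfield by blast
    have "poly p d * b \<in> D" if "b \<in> C" "d \<in> D" for b d
    proof -
      have "p * [:b:] \<in> IntD D" using y(2) that p E by (auto simp flip: iota_mult)
      then show ?thesis using IntD_poly[of "p * [:b:]" D d] that by (simp add: mult.commute)
    qed
    then have "x * poly p d \<in> D" if "d \<in> D" for d
      using that by (intro vclosD[OF x] K.poly_mem[OF p(1)] mem_qfield) auto
    then have "smult x p \<in> IntD D"
      using p xD by (intro IntDI K.poly_over_smult) (auto intro: mem_qfield)
    then show ?thesis using p E by (simp flip: iota_mult)
  qed
  then show ?thesis using iota_qfield[of "[:x:]"] xD
    unfolding ER.vclos_iff by (auto intro!: K.poly_over_const mem_qfield)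
qed

end

lemma (in poly_prime) t_ideal_ctr:
  assumes E: "E = IntD D" and t: "t_ideal (iota ` E) Q"
  shows "t_ideal D ctr"
proof (rule t_idealI)
  show "is_ideal D ctr" using ctr_prime by (simp add: prime_ideal_def)
  fix C assume C: "finite C" "C \<subseteq> ctr" "\<not> C \<subseteq> {0}"
  have CD: "C \<subseteq> D" using C P.P_sub by blast
  have n: "\<not> (\<lambda>c. iota [:c:]) ` C \<subseteq> {0}" using C(3) by (auto simp: image_subset_iff)
  show "vclos D C \<subseteq> ctr"
  proof
    fix x assume x: "x \<in> vclos D C"
    have "(\<lambda>c. iota [:c:]) ` C \<subseteq> Q" using C by (auto simp: ctr_def)
    then have "iota [:x:] \<in> Q"
      using ER.t_ideal_vclos[OF t _ _ n] C const_vclos[OF E CD C(3) x] by blast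
    then show "x \<in> ctr" using x vclos_subset_ring[OF CD] by (auto simp: ctr_def)
  qed
qed

locale int_localizes = subdom D for D :: "'a::field set" +
  assumes int_loc: "t_maximal D P \<Longrightarrow> IntD_loc D P = IntD (loc D P)"
begin

sublocale E: poly_ring D "IntD D"
  by (rule IntD_poly_ring)

lemma t_proper_consts:
  assumes "t_ideal D M" "M \<noteq> D" "M \<subseteq> D"
  shows "E.ER.t_proper ((\<lambda>c. iota [:c:]) ` M)"
  unfolding E.ER.t_proper_def
proof (intro allI impI notI, elim conjE)
  fix F assume F: "finite F" "F \<subseteq> (\<lambda>c. iota [:c:]) ` M" "\<not> F \<subseteq> {0}"
    and one: "1 \<in> vclos (iota ` IntD D) F"
  obtain C where C: "C \<subseteq> M" "finite C" "F = (\<lambda>c. iota [:c:]) ` C"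
    using finite_subset_image[OF F(1,2)] by blast
  interpret K: subdom "qfield D" by (rule subdom_qfield)
  have "1 * y \<in> D" if y: "y \<in> qfield D" "\<forall>c\<in>C. y * c \<in> D" for y
  proof -
    have "[:y:] * 1 \<in> IntD D"
    proof (rule E.iota_vclosD)
      show "iota 1 \<in> vclos (iota ` IntD D) (iota ` (\<lambda>c. [:c:]) ` C)"
        using one C by (simp add: image_image)
      show "[:y:] \<in> poly_over (qfield D)" using y K.poly_over_const by blast
      show "[:y:] * f \<in> IntD D" if "f \<in> (\<lambda>c. [:c:]) ` C" for f
        using y that E.const_E by auto
    qed
    then show ?thesis using IntD_poly[of "[:y:]" D 0] by simp
  qed
  then have "1 \<in> vclos D C" by (auto simp: vclos_iff)
  moreover have "\<not> C \<subseteq> {0}" using F C by auto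
  ultimately show False using t_ideal_t_proper[OF assms(1,2)] C by (auto simp: t_proper_def)
qed

text \<open>A coefficient \<open>x\<close> outside \<open>D\<^sub>M\<close> has an exponent
  \<open>e\<close>, the same for all \<open>t\<close> in the maximal ideal, with
  \<open>t ^ e x\<close> in \<open>D\<^sub>M\<close>. So \<open>x h ^ e\<close> is in
  \<open>Int(D\<^sub>M)\<close> for all \<open>h\<close> of the set. If finitely many
  \<open>h\<close> had v-closure the whole ring, so would their powers, and \<open>s x\<close> would
  lie in \<open>D\<close> for some \<open>s\<close> outside \<open>M\<close>.\<close>

lemma t_proper_Int_ideal:
  assumes M: "t_maximal D M" and f: "f \<in> IntD (loc D M)" "coeff f k \<notin> loc D M"
  shows "E.ER.t_proper (iota ` {h \<in> IntD D. \<forall>d\<in>loc D M. poly h d \<in> prime_at.locm D M})"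
  unfolding E.ER.t_proper_def
proof (intro allI impI notI, elim conjE)
  fix F assume F: "finite F" "F \<subseteq> iota ` {h \<in> IntD D. \<forall>d\<in>loc D M. poly h d \<in> prime_at.locm D M}" "\<not> F \<subseteq> {0}"
    and one: "1 \<in> vclos (iota ` IntD D) F"
  interpret M: prime_at D M using t_maximal_prime[OF M] by unfold_locales
  interpret L: subdom "loc D M" by (rule M.subdom_loc)
  interpret K: subdom "qfield D" by (rule subdom_qfield)
  define x where "x = coeff f k"
  have xK: "x \<in> qfield D" using IntD_poly_over[OF f(1)] M.qfield_loc by (auto simp: poly_over_def x_def)
  obtain e where "\<forall>B t k. subdom B \<longrightarrow> loc D M \<subseteq> B \<longrightarrow> t \<in> loc D M \<longrightarrow>
    (\<forall>j>0. t ^ j \<noteq> 1 \<and> inverse (t ^ j - 1) \<in> B) \<longrightarrow> t ^ e * coeff f k \<in> B"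
    using IntD_coeff_power[OF M.subdom_loc f(1)] by (rule exE)
  then have e: "t ^ e * x \<in> loc D M" if "t \<in> M.locm" for t
    using that M.loc_units M.locm_subset M.subdom_loc unfolding x_def by blast
  obtain G where G: "G \<subseteq> {h \<in> IntD D. \<forall>d\<in>loc D M. poly h d \<in> prime_at.locm D M}" "finite G" "F = iota ` G"
    using finite_subset_image[OF F(1,2)] by blast
  have "smult x (h ^ e) \<in> IntD_loc D M" if "h \<in> G" for h
  proof -
    have hI: "h \<in> IntD D" using G that by blast
    have hL: "poly h d \<in> M.locm" if "d \<in> loc D M" for d
      using G that \<open>h \<in> G\<close> by blast
    have "smult x (h ^ e) \<in> IntD (loc D M)"
      using hI IntD_poly_over[OF hI] xK e hL
      by (intro IntDI) (auto simp: M.qfield_loc poly_power mult.commute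
          intro!: K.poly_over_smult K.poly_over_power)
    then show ?thesis using int_loc[OF M] by simp
  qed
  then obtain s where s: "s \<in> D" "s \<notin> M" "\<forall>h\<in>G. smult s (smult x (h ^ e)) \<in> IntD D"
    using M.IntD_loc_common_denominator[of "(\<lambda>h. smult x (h ^ e)) ` G"] G(2) by auto
  have "1 \<in> vclos (iota ` IntD D) ((\<lambda>x. x ^ e) ` F)"
    using E.ER.t_proper_powers[OF F(1) _ F(3) one] F(2) by blast
  then have "iota 1 \<in> vclos (iota ` IntD D) (iota ` (\<lambda>h. h ^ e) ` G)"
    by (simp add: G image_image iota_power)
  then have "[:s * x:] * 1 \<in> IntD D"
    by (rule E.iota_vclosD) (use s xK mem_qfield in \<open>auto intro!: K.poly_over_const K.mult_mem\<close>)
  then have "s * x \<in> D" using IntD_poly[of "[:s * x:]" D 0] by simp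
  then show False using M.loc_cancel[OF s(1,2) M.mem_loc] f(2) by (simp add: x_def)
qed

text \<open>\<open>Q\<close> is chosen so that every \<open>g\<close> outside it has a coefficient
  (if \<open>Int(D\<^sub>M) = D\<^sub>M[X]\<close>) or a value on \<open>D\<^sub>M\<close>
  (otherwise) that is a unit of \<open>D\<^sub>M\<close>. If \<open>y = f / g\<close>, then
  \<open>y\<close> is the quotient of the corresponding coefficients or values.\<close>

lemma t_maximal_above:
  assumes M: "t_maximal D M"
  obtains Q where "t_maximal (iota ` IntD D) Q"
    "\<And>y. y \<in> qfield D \<Longrightarrow> iota [:y:] \<in> loc (iota ` IntD D) Q \<Longrightarrow> y \<in> loc D M"
proof (cases "IntD (loc D M) \<subseteq> poly_over (loc D M)")
  interpret M: prime_at D M using t_maximal_prime[OF M] by unfold_locales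
  interpret L: prime_at "loc D M" M.locm
    using M.subdom_loc M.locm_prime by (simp add: prime_at_def prime_at_axioms_def)
  case True
  have tM: "t_ideal D M" "M \<noteq> D" using M by (auto simp: t_maximal_def)
  have "(\<lambda>c. iota [:c:]) ` M \<subseteq> iota ` IntD D" using E.const_E M.P_sub by auto
  then obtain Q where Q: "t_maximal (iota ` IntD D) Q" "(\<lambda>c. iota [:c:]) ` M \<subseteq> Q"
    using E.ER.t_proper_in_t_maximal[OF t_proper_consts[OF tM M.P_sub]] by blast
  interpret Q: poly_prime D "IntD D" Q
    using E.ER.t_maximal_prime[OF Q(1)] by unfold_locales
  have "t_ideal D Q.ctr" using Q.t_ideal_ctr Q(1) by (auto simp: t_maximal_def)
  moreover have "Q.ctr \<noteq> D" using Q.P.one_notin_P one_mem by blast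
  moreover have "M \<subseteq> Q.ctr" using Q(2) M.P_sub by (auto simp: Q.ctr_def)
  ultimately have ctr: "Q.ctr = M" using M by (auto simp: t_maximal_def)
  have sub: "IntD D \<subseteq> poly_over (loc D M)" using True M.IntD_subset_loc by blast
  show thesis
  proof (rule that[OF Q(1)])
    fix y assume y: "y \<in> qfield D" "iota [:y:] \<in> loc (iota ` IntD D) Q"
    then obtain f g where fg: "iota [:y:] = iota f / iota g" "f \<in> IntD D" "g \<in> IntD D" "iota g \<notin> Q"
      by (auto elim!: Q.Q.locE)
    have "g \<noteq> 0" using fg by auto
    then have "iota [:y:] * iota g = iota f" using fg(1) by simp
    then have "f = smult y g" by (simp flip: iota_mult)
    then have c: "coeff f i = y * coeff g i" for i by simp
    \<comment> \<open>Otherwise a multiple \<open>s g\<close> with \<open>s\<close> outside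
      \<open>M\<close> has all coefficients in \<open>M\<close>, and these constants lie in
      \<open>Q\<close>.\<close>
    have "\<exists>i. coeff g i \<notin> M.locm"
    proof (rule ccontr)
      assume "\<not> ?thesis"
      then have gm: "\<And>i. coeff g i \<in> M.locm" by auto
      obtain s where s: "s \<in> D" "s \<notin> M" "smult s g \<in> poly_over D"
        using M.poly_over_loc_denominator sub fg(3) by blast
      have "coeff (smult s g) i \<in> M" for i
        using gm[of i] s(1,3) L.P_mult[of s "coeff g i"] M.mem_loc M.locm_ring_iff
        by (auto simp: poly_over_def)
      moreover have "iota p \<in> Q" if "\<And>i. coeff p i \<in> M" for p
        using that
      proof (induction p)
        case (pCons a p)
        have "coeff p i \<in> M" for i using pCons.prems[of "Suc i"] by simp
        then have "iota p \<in> Q" using pCons.IH by blast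
        then have "iota [:0, 1:] * iota p \<in> Q" using Q.Q.P_mult E.X_E by auto
        moreover have "iota [:a:] \<in> Q" using Q.const_mem_iff[of a] pCons.prems[of 0] ctr M.P_sub by auto
        ultimately have "iota [:a:] + iota [:0, 1:] * iota p \<in> Q" by (rule Q.Q.P_add[rotated])
        then show ?case by (simp flip: iota_mult iota_add)
      qed simp
      ultimately have "iota (smult s g) \<in> Q" by blast
      then show False using Q.Q_smult_cancel fg(3,4) s ctr by blast
    qed
    then obtain i where i: "coeff g i \<notin> M.locm" by auto
    have cL: "coeff g i \<in> loc D M" "coeff f i \<in> loc D M" using sub fg by (auto simp: poly_over_def)
    then have "inverse (coeff g i) \<in> loc D M" "coeff g i \<noteq> 0" using i by (auto simp: M.locm_iff)
    then have "coeff f i * inverse (coeff g i) \<in> loc D M" using cL by (intro L.mult_mem)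
    then show "y \<in> loc D M" using c[of i] \<open>coeff g i \<noteq> 0\<close> by (simp add: mult.assoc)
  qed
next
  interpret M: prime_at D M using t_maximal_prime[OF M] by unfold_locales
  interpret L: subdom "loc D M" by (rule M.subdom_loc)
  case False
  then obtain f k where "f \<in> IntD (loc D M)" "coeff f k \<notin> loc D M" by (auto simp: poly_over_def)
  then obtain Q where Q: "t_maximal (iota ` IntD D) Q"
    "iota ` {h \<in> IntD D. \<forall>d\<in>loc D M. poly h d \<in> M.locm} \<subseteq> Q"
    using E.ER.t_proper_in_t_maximal[OF t_proper_Int_ideal[OF M]] by blast
  interpret Q: poly_prime D "IntD D" Q
    using E.ER.t_maximal_prime[OF Q(1)] by unfold_locales
  show thesis
  proof (rule that[OF Q(1)])
    fix y assume y: "y \<in> qfield D" "iota [:y:] \<in> loc (iota ` IntD D) Q"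
    then obtain f g where fg: "iota [:y:] = iota f / iota g" "f \<in> IntD D" "g \<in> IntD D" "iota g \<notin> Q"
      by (auto elim!: Q.Q.locE)
    have "g \<noteq> 0" using fg by auto
    then have "iota [:y:] * iota g = iota f" using fg(1) by simp
    then have "f = smult y g" by (simp flip: iota_mult)
    then have c: "poly f d = y * poly g d" for d by simp
    \<comment> \<open>\<open>Q\<close> contains every element of \<open>Int(D)\<close> whose values
      on \<open>D\<^sub>M\<close> are all nonunits, and \<open>g\<close> is not in
      \<open>Q\<close>.\<close>
    obtain d where d: "d \<in> loc D M" "poly g d \<notin> M.locm" using fg Q(2) by blast
    have cL: "poly g d \<in> loc D M" "poly f d \<in> loc D M"
      using fg M.IntD_subset_loc d IntD_poly[of _ "loc D M" d] by blast+
    then have "inverse (poly g d) \<in> loc D M" "poly g d \<noteq> 0" using d by (auto simp: M.locm_iff)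
    then have "poly f d * inverse (poly g d) \<in> loc D M" using cL by (intro L.mult_mem)
    then show "y \<in> loc D M" using c[of d] \<open>poly g d \<noteq> 0\<close> by (simp add: mult.assoc)
  qed
qed

lemma PvMD_base:
  assumes "PvMD (iota ` IntD D)"
  shows "PvMD D"
  unfolding PvMD_def
proof (intro conjI allI impI)
  show "is_subdomain D" by (rule sub)
  fix M assume M: "t_maximal D M"
  interpret M: prime_at D M using t_maximal_prime[OF M] by unfold_locales
  obtain Q where Q: "t_maximal (iota ` IntD D) Q"
    "\<And>y. y \<in> qfield D \<Longrightarrow> iota [:y:] \<in> loc (iota ` IntD D) Q \<Longrightarrow> y \<in> loc D M"
    using t_maximal_above[OF M] by blast
  interpret Q: poly_prime D "IntD D" Q
    using E.ER.t_maximal_prime[OF Q(1)] by unfold_locales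
  interpret K: subdom "qfield D" by (rule subdom_qfield)
  have val: "valuation_domain (loc (iota ` IntD D) Q)" using assms Q by (auto simp: PvMD_def)
  have "x \<in> loc D M \<or> inverse x \<in> loc D M" if x: "x \<in> qfield D" "x \<noteq> 0" for x
  proof -
    have "iota [:x:] \<in> qfield (iota ` IntD D)" using x by (intro E.iota_qfield K.poly_over_const)
    then have "iota [:x:] \<in> loc (iota ` IntD D) Q \<or> inverse (iota [:x:]) \<in> loc (iota ` IntD D) Q"
      using val x Q.Q.qfield_loc by (auto simp: valuation_domain_def)
    moreover have "inverse (iota [:x:]) = iota [:inverse x:]"
      using x by (intro inverse_unique) (simp flip: iota_mult one_pCons)
    ultimately show ?thesis using Q(2)[of x] Q(2)[of "inverse x"] x qfield_inverse by auto
  qed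
  then show "valuation_domain (loc D M)"
    using M.subdom_loc by (auto simp: valuation_domain_def M.qfield_loc subdom_def)
qed

end

section \<open>Localizations with finite residue field\<close>

lemma (in subdom) poly_diff_factor:
  assumes "p \<in> poly_over R" "x \<in> R" "y \<in> R"
  shows "\<exists>w\<in>R. poly p x - poly p y = (x - y) * w"
  using assms(1)
proof (induction p)
  case 0
  then show ?case by (intro bexI[of _ 0]) auto
next
  case (pCons a p)
  have p: "p \<in> poly_over R" using poly_over_pConsD pCons.prems by blast
  then obtain w where w: "w \<in> R" "poly p x - poly p y = (x - y) * w" using pCons.IH by blast
  have "poly (pCons a p) x - poly (pCons a p) y = x * (poly p x - poly p y) + (x - y) * poly p y"
    by (simp add: algebra_simps)
  also have "\<dots> = (x - y) * (x * w + poly p y)" by (simp add: w algebra_simps)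
  finally show ?case using w assms poly_mem[OF p] by (blast intro: add_mem mult_mem)
qed

context prime_at
begin

lemma loc_prime_at: "prime_at (loc R P) locm"
  using subdom_loc locm_prime by (simp add: prime_at_def prime_at_axioms_def)

text \<open>Choose the least \<open>e\<close> such that all \<open>t\<^sup>e\<close> with \<open>t\<close> in the maximal ideal are multiples of
  \<open>1 / x\<close>, where \<open>x\<close> is a coefficient outside the valuation ring; minimality of \<open>e\<close> makes
  \<open>1 / (t\<^sup>e\<^sup>-\<^sup>1 x)\<close> a generator for a suitable \<open>t\<close>.\<close>

lemma uniformizer_exists:
  assumes val: "valuation_domain (loc R P)" and f: "f \<in> IntD (loc R P)" "coeff f k \<notin> loc R P"
  shows "\<exists>p\<in>P. p \<noteq> 0 \<and> (\<forall>t\<in>locm. t / p \<in> loc R P)"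
proof -
  interpret L: prime_at "loc R P" locm by (rule loc_prime_at)
  interpret K: subdom "qfield R" by (rule subdom_qfield)
  let ?V = "loc R P"
  define x where "x = coeff f k"
  have xV: "x \<notin> ?V" using f by (simp add: x_def)
  have xK: "x \<in> qfield R" using IntD_poly_over[OF f(1)] qfield_loc by (auto simp: poly_over_def x_def)
  obtain e where "\<forall>B t k. subdom B \<longrightarrow> ?V \<subseteq> B \<longrightarrow> t \<in> ?V \<longrightarrow>
    (\<forall>j>0. t ^ j \<noteq> 1 \<and> inverse (t ^ j - 1) \<in> B) \<longrightarrow> t ^ e * coeff f k \<in> B"
    using IntD_coeff_power[OF subdom_loc f(1)] by (rule exE)
  then have ex: "\<forall>t\<in>locm. t ^ e * x \<in> ?V"
    using loc_units locm_subset subdom_loc unfolding x_def by blast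
  define m where "m = (LEAST e. \<forall>t\<in>locm. t ^ e * x \<in> ?V)"
  have m: "t ^ m * x \<in> ?V" if "t \<in> locm" for t
    using LeastI[of "\<lambda>e. \<forall>t\<in>locm. t ^ e * x \<in> ?V", OF ex] that unfolding m_def by blast
  have "m \<noteq> 0"
  proof
    assume "m = 0"
    then show False using m[OF L.P_0] xV by simp
  qed
  then obtain n where n: "m = Suc n" using not0_implies_Suc by blast
  have "\<not> (\<forall>t\<in>locm. t ^ n * x \<in> ?V)"
    using not_less_Least[of n "\<lambda>e. \<forall>t\<in>locm. t ^ e * x \<in> ?V"] n unfolding m_def by simp
  then obtain u where u: "u \<in> locm" "u ^ n * x \<notin> ?V" by blast
  have locmK: "t \<in> qfield R" if "t \<in> locm" for t using that locm_subset loc_qfield by blast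
  have big: "y \<noteq> 0 \<and> inverse y \<in> locm" if "y \<in> qfield R" "y \<notin> ?V" for y
    using valuation_loc_cases[OF val that(1)] that L.zero_mem by (cases "y = 0") auto
  define p where "p = inverse (u ^ n * x)"
  have uK: "u ^ n * x \<in> qfield R" using locmK[OF u(1)] xK by (intro K.mult_mem K.power_mem)
  have ux: "u ^ n * x \<noteq> 0" and p: "p \<in> locm" "p \<noteq> 0"
    using big[OF uK u(2)] unfolding p_def by simp_all
  have div: "t / p \<in> ?V" if t: "t \<in> locm" for t
  proof (rule ccontr)
    assume "t / p \<notin> ?V"
    then have n': "t * (u ^ n * x) \<notin> ?V" by (simp add: p_def divide_inverse)
    define w where "w = inverse (t * (u ^ n * x))"
    have w: "w \<in> locm" "t * (u ^ n * x) \<noteq> 0"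
      using big[OF _ n'] K.mult_mem[OF locmK[OF t] uK] unfolding w_def by auto
    have "finite {u, t, w}" "{u, t, w} \<subseteq> qfield ?V" "\<not> {u, t, w} \<subseteq> {0}"
      using locmK u t w qfield_loc by auto
    then have "\<exists>c\<in>{u, t, w}. c \<noteq> 0 \<and> (\<forall>x\<in>{u, t, w}. x / c \<in> ?V)"
      by (rule L.valuation_common_divisor[OF val])
    then obtain c where c': "c \<in> {u, t, w}" "c \<noteq> 0 \<and> (\<forall>x\<in>{u, t, w}. x / c \<in> ?V)" by (rule bexE)
    then have c: "c \<in> {u, t, w}" "c \<noteq> 0" "u / c \<in> ?V" "t / c \<in> ?V" "w / c \<in> ?V" by simp_all
    have cm: "c \<in> locm" using c(1) u t w by auto
    \<comment> \<open>As \<open>m = n + 1\<close>, the powers of \<open>c\<close> cancel. With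
      \<open>c\<close> of least value among \<open>u\<close>, \<open>t\<close>, \<open>w\<close>,
      every factor on the left lies in the valuation ring and the last one in its maximal ideal,
      whereas the right side is 1.\<close>
    have "w / c * (t / c) * (u / c) ^ n * (c ^ m * x) * c = w * (t * (u ^ n * x))"
      using c(2) by (simp add: n power_divide field_simps)
    also have "\<dots> = 1" unfolding w_def by (rule left_inverse[OF w(2)])
    finally have "1 = w / c * (t / c) * (u / c) ^ n * (c ^ m * x) * c" by simp
    moreover have "w / c * (t / c) * (u / c) ^ n * (c ^ m * x) * c \<in> locm"
      using L.P_mult[OF L.mult_mem[OF L.mult_mem[OF L.mult_mem[OF c(5,4)] L.power_mem[OF c(3)]] m[OF cm]] cm] .
    ultimately show False using L.one_notin_P by simp
  qed
  obtain a s where a: "p = a / s" "a \<in> P" "s \<in> R" "s \<notin> P" using p(1) unfolding locm_def by blast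
  have "t / a \<in> ?V" if "t \<in> locm" for t
  proof -
    have "t / p * inverse s \<in> ?V" using div[OF that] loc_inverse a by (intro L.mult_mem)
    moreover have "t / p * inverse s = t / a" using a p by (auto simp: field_simps)
    ultimately show ?thesis by simp
  qed
  then show ?thesis using a p by (intro bexI[of _ a]) auto
qed

text \<open>Any \<open>n + 1\<close> elements contain two congruent ones, \<open>n\<close> being the degree of \<open>f\<close>; applied to
  \<open>1, a, \<dots>, a\<^sup>n\<close> this bounds the multiplicative order of \<open>a\<close> modulo the maximal ideal.\<close>

lemma residue_exponent_exists:
  assumes f: "f \<in> IntD (loc R P)" "coeff f k \<notin> loc R P"
  shows "\<exists>r>0. \<forall>a\<in>loc R P. a \<notin> locm \<longrightarrow> a ^ r - 1 \<in> locm"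
proof -
  interpret L: prime_at "loc R P" locm by (rule loc_prime_at)
  let ?n = "degree f"
  \<comment> \<open>The order of \<open>a\<close> is at most the degree, so the factorial of the
    degree is an exponent common to all \<open>a\<close>.\<close>
  have "a ^ fact ?n - 1 \<in> locm" if a: "a \<in> loc R P" "a \<notin> locm" for a
  proof -
    have "\<exists>j. 0 < j \<and> j \<le> ?n \<and> a ^ j - 1 \<in> locm"
    proof (rule ccontr)
      assume neg: "\<not> ?thesis"
      have d: "a ^ j - a ^ i \<in> loc R P \<and> a ^ j - a ^ i \<notin> locm" if "i < j" "j \<le> ?n" for i j
      proof -
        have "a ^ j - a ^ i = a ^ i * (a ^ (j - i) - 1)"
          using that by (simp add: algebra_simps flip: power_add)
        moreover have "0 < j - i" "j - i \<le> ?n" using that by auto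
        then have "a ^ (j - i) - 1 \<notin> locm" using neg by blast
        moreover have "a ^ i \<in> loc R P" "a ^ i \<notin> locm" "a ^ (j - i) - 1 \<in> loc R P"
          using a L.notin_power by (auto intro: L.power_mem L.diff_mem)
        ultimately show ?thesis using L.notin_mult L.mult_mem by metis
      qed
      define v where "v = (\<Prod>j\<le>?n. \<Prod>i<j. (a ^ j - a ^ i))"
      have v: "v \<in> loc R P" "v \<notin> locm"
        unfolding v_def using d by (auto intro!: L.prod_mem L.notin_prod)
      have "v * coeff f k \<in> loc R P"
        unfolding v_def using a f IntD_poly[OF f(1)] by (intro L.vandermonde_mult_coeff_mem) (auto intro: L.power_mem)
      moreover have "v \<noteq> 0" "inverse v \<in> loc R P" using v by (auto simp: locm_iff)
      ultimately have "inverse v * (v * coeff f k) \<in> loc R P" by (intro L.mult_mem[of "inverse v"])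
      then show False using f(2) \<open>v \<noteq> 0\<close> by (simp flip: mult.assoc)
    qed
    then obtain j where j: "0 < j" "j \<le> ?n" "a ^ j - 1 \<in> locm" by blast
    have "(a ^ j) ^ q - 1 \<in> locm" for q
    proof (induction q)
      case (Suc q)
      have "(a ^ j) ^ Suc q - 1 = a ^ j * ((a ^ j) ^ q - 1) + (a ^ j - 1)" by (simp add: algebra_simps)
      then show ?case using L.P_add[OF L.P_mult[OF L.power_mem[OF a(1)] Suc] j(3)] by (simp only:)
    qed simp
    moreover have "j dvd fact ?n" using j by (intro dvd_fact) auto
    then obtain q where "fact ?n = j * q" by (elim dvdE)
    ultimately show ?thesis by (simp add: power_mult)
  qed
  then show ?thesis by (intro exI[of _ "fact ?n"]) auto
qed

end

section \<open>Members of \<open>\<Lambda>\<^sub>0\<close>: separating functions, t-primes above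
  \<open>P\<close>, absence of infinitely divisible elements\<close>

text \<open>\<open>p\<close> generates the maximal ideal of \<open>D\<^sub>P\<close>, and
  \<open>r\<close> is an exponent for the units of the residue field. Nonzero elements divisible by
  all powers of \<open>p\<close> are still possible here; excluding them takes the PvMD property of
  \<open>Int(D)\<close>, see \<open>p_power_div\<close>.\<close>

locale finite_residue = int_localizes D + prime_at D P for D :: "'a::field set" and P +
  fixes p :: 'a and r :: nat
  assumes p_P: "p \<in> P" and p_nz: "p \<noteq> 0" and locm_div_p: "t \<in> locm \<Longrightarrow> t / p \<in> loc D P"
    and r_pos: "r > 0" and r_exp: "a \<in> loc D P \<Longrightarrow> a \<notin> locm \<Longrightarrow> a ^ r - 1 \<in> locm"
    and val: "valuation_domain (loc D P)"
    and loc_eq: "IntD_loc D P = IntD (loc D P)"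
begin

sublocale L: prime_at "loc D P" locm
  by (rule loc_prime_at)

sublocale K: subdom "qfield D"
  by (rule subdom_qfield)

sublocale V: poly_ring "loc D P" "IntD (loc D P)"
  by (rule L.IntD_poly_ring)

lemma p_locm: "p \<in> locm"
  using p_P P_sub locm_ring_iff by blast

lemma locm_iff_div_p: "t \<in> locm \<longleftrightarrow> t / p \<in> loc D P"
  using locm_div_p L.P_mult'[OF p_locm, of "t / p"] p_nz by auto

lemma one_minus_power: "a \<in> loc D P \<Longrightarrow> a \<notin> locm \<Longrightarrow> 1 - a ^ r \<in> locm"
  using L.P_mult[OF L.minus_mem[OF L.one_mem] r_exp] by simp

lemma one_minus_power_unit:
  assumes "a \<in> locm"
  shows "1 - a ^ r \<noteq> 0" "inverse (1 - a ^ r) \<in> loc D P"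
proof -
  have "inverse (1 - a ^ r) = - inverse (a ^ r - 1)" by (metis inverse_minus_eq minus_diff_eq)
  then show "1 - a ^ r \<noteq> 0" "inverse (1 - a ^ r) \<in> loc D P"
    using loc_units[OF assms r_pos] L.minus_mem by auto
qed

text \<open>On the maximal ideal \<open>\<theta>\<close> lowers the valuation by exactly one, so iterating it detects
  divisibility by powers of \<open>p\<close>.\<close>

definition theta :: "'a poly" where
  "theta = smult (inverse p) ([:0, 1:] - monom 1 (Suc r))"

definition theta_iter :: "nat \<Rightarrow> 'a poly" where
  "theta_iter i = ((\<lambda>q. pcompose q theta) ^^ i) [:0, 1:]"

text \<open>An integer-valued substitute for the indicator function of the multiples of
  \<open>p ^ k\<close>: its value is a nonunit off this set, and is 1 at 0.\<close>

definition psi :: "nat \<Rightarrow> 'a poly" where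
  "psi k = (\<Prod>i<k. (1 - theta_iter i ^ r))"

lemma poly_theta: "poly theta a = a / p * (1 - a ^ r)"
  by (simp add: theta_def poly_monom field_simps)

lemma theta_iter_Suc: "theta_iter (Suc i) = pcompose (theta_iter i) theta"
  and theta_iter_0: "theta_iter 0 = [:0, 1:]"
  by (simp_all add: theta_iter_def)

lemma poly_theta_mem:
  assumes "a \<in> loc D P"
  shows "poly theta a \<in> loc D P"
proof (cases "a \<in> locm")
  case True
  then show ?thesis unfolding poly_theta
    using assms locm_div_p by (intro L.mult_mem L.diff_mem L.power_mem) auto
next
  case False
  have "a * ((1 - a ^ r) / p) \<in> loc D P"
    using assms False one_minus_power locm_div_p by (intro L.mult_mem) auto
  then show ?thesis by (simp add: poly_theta)
qed

lemma theta_poly_over: "theta \<in> poly_over (qfield D)"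
  unfolding theta_def
  using p_P P_sub mem_qfield qfield_inverse
  by (intro K.poly_over_smult K.poly_over_diff K.poly_over_monom K.poly_over_pCons K.poly_over_const) auto

lemma theta_iter_IntD: "theta_iter i \<in> IntD (loc D P)"
proof (induction i)
  case 0
  then show ?case using V.X_E by (simp add: theta_iter_0)
next
  case (Suc i)
  show ?case unfolding theta_iter_Suc
    using theta_poly_over IntD_poly_over[OF Suc] qfield_loc poly_theta_mem IntD_poly[OF Suc]
    by (intro IntDI) (auto simp: poly_pcompose intro!: K.poly_over_pcompose)
qed

lemma psi_IntD: "psi k \<in> IntD (loc D P)"
  unfolding psi_def by (intro V.E_prod V.E_diff V.one_E V.E_power theta_iter_IntD)

text \<open>For \<open>a\<close> in the maximal ideal, \<open>a\<close> is \<open>p\<close> times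
  \<open>theta(a)\<close> times a unit, so each further iterate in the maximal ideal contributes one
  factor \<open>p\<close>.\<close>

lemma div_p_power_if_theta_iter:
  assumes "a \<in> loc D P" "\<And>i. i < k \<Longrightarrow> poly (theta_iter i) a \<in> locm"
  shows "a / p ^ k \<in> loc D P"
  using assms
proof (induction k arbitrary: a)
  case (Suc k)
  let ?b = "poly theta a"
  have a: "a \<in> locm" using Suc.prems(2)[of 0] by (simp add: theta_iter_0)
  have "?b / p ^ k \<in> loc D P"
  proof (rule Suc.IH)
    show "?b \<in> loc D P" using poly_theta_mem Suc.prems by blast
    show "poly (theta_iter i) ?b \<in> locm" if "i < k" for i
      using Suc.prems(2)[of "Suc i"] that by (simp add: theta_iter_Suc poly_pcompose)
  qed
  then have "?b / p ^ k * inverse (1 - a ^ r) \<in> loc D P"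
    using one_minus_power_unit[OF a] by (intro L.mult_mem)
  moreover have "?b / p ^ k * inverse (1 - a ^ r) = a / p ^ Suc k"
    using one_minus_power_unit(1)[OF a] p_nz by (simp add: poly_theta field_simps)
  ultimately show ?case by simp
qed simp

lemma div_p_power_if_psi:
  assumes a: "a \<in> loc D P" and n: "poly (psi k) a \<notin> locm"
  shows "a / p ^ k \<in> loc D P"
proof (rule div_p_power_if_theta_iter[OF a], rule ccontr)
  fix i assume i: "i < k" "poly (theta_iter i) a \<notin> locm"
  have t: "poly (theta_iter j) a \<in> loc D P" for j using IntD_poly[OF theta_iter_IntD a] .
  have "poly (psi k) a = (\<Prod>j<k. (1 - poly (theta_iter j) a ^ r))"
    by (simp add: psi_def poly_prod poly_power)
  also have "\<dots> = (1 - poly (theta_iter i) a ^ r) * (\<Prod>j\<in>{..<k} - {i}. (1 - poly (theta_iter j) a ^ r))"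
    using i by (intro prod.remove) auto
  also have "\<dots> \<in> locm"
    using one_minus_power[OF t i(2)] t
    by (intro L.P_mult' L.prod_mem L.diff_mem L.power_mem) auto
  finally show False using n by blast
qed

lemma poly_psi_0: "poly (psi k) 0 = 1"
proof -
  have "poly (theta_iter i) 0 = 0" for i
    by (induction i) (simp_all add: theta_iter_0 theta_iter_Suc poly_pcompose poly_theta)
  then show ?thesis using r_pos by (simp add: psi_def poly_prod poly_power zero_power)
qed

lemma IntD_p_power:
  assumes "f \<in> IntD (loc D P)"
  shows "\<exists>e. smult (p ^ e) f \<in> poly_over (loc D P)"
proof -
  obtain e where e: "\<forall>B t k. subdom B \<longrightarrow> loc D P \<subseteq> B \<longrightarrow> t \<in> loc D P \<longrightarrow>
    (\<forall>j>0. t ^ j \<noteq> 1 \<and> inverse (t ^ j - 1) \<in> B) \<longrightarrow> t ^ e * coeff f k \<in> B"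
    using IntD_coeff_power[OF subdom_loc assms] by (rule exE)
  have "p ^ e * coeff f k \<in> loc D P" for k
    using e subdom_loc loc_units[OF p_locm] locm_subset p_locm by blast
  then show ?thesis by (auto simp: poly_over_def)
qed

text \<open>Continuity in the \<open>p\<close>-adic sense: as \<open>p ^ e f\<close> has
  coefficients in \<open>D\<^sub>P\<close>, a step \<open>z\<close> divisible by
  \<open>p ^ (e + 1)\<close> changes \<open>f(d)\<close> by a multiple of \<open>p\<close>.\<close>

lemma IntD_locally_in_locm:
  assumes f: "f \<in> IntD (loc D P)" and d: "d \<in> loc D P" "poly f d \<in> locm"
  shows "\<exists>k. \<forall>z. z / p ^ k \<in> loc D P \<longrightarrow> poly f (d + z) \<in> locm"
proof -
  obtain e where e: "smult (p ^ e) f \<in> poly_over (loc D P)" using IntD_p_power[OF f] by blast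
  have "poly f (d + z) \<in> locm" if z: "z / p ^ Suc e \<in> loc D P" for z
  proof -
    define y where "y = z / p ^ Suc e"
    have zy: "z = p ^ Suc e * y" using p_nz by (simp add: y_def)
    have pL: "p \<in> loc D P" using p_locm locm_subset by blast
    have zL: "z \<in> loc D P" unfolding zy using z pL y_def by (intro L.mult_mem L.power_mem) auto
    obtain w where w: "w \<in> loc D P" "poly (smult (p ^ e) f) (d + z) - poly (smult (p ^ e) f) d = (d + z - d) * w"
      using L.poly_diff_factor[OF e L.add_mem[OF d(1) zL] d(1)] by blast
    have "p ^ e * (poly f (d + z) - poly f d) = p ^ e * (p * (y * w))"
      using w(2) by (simp add: zy algebra_simps)
    then have "poly f (d + z) - poly f d = p * (y * w)" using p_nz by simp
    then have "poly f (d + z) = poly f d + p * (y * w)" by (simp add: algebra_simps)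
    moreover have "p * (y * w) \<in> locm"
      using p_locm z w unfolding y_def[symmetric] by (intro L.P_mult' L.mult_mem)
    ultimately show ?thesis using L.P_add[OF d(2)] by (simp only:)
  qed
  then show ?thesis by blast
qed

text \<open>The ideal of all \<open>g\<close> with \<open>g(d)\<close> in the maximal ideal is a t-ideal: \<open>\<psi>\<^sub>k(X - d) / p\<close>
  multiplies any finite subset of it into \<open>Int(D)\<close> locally, and has value \<open>1 / p\<close> at \<open>d\<close>.\<close>

lemma poly_vclos_mem_locm:
  assumes F: "finite F" "F \<subseteq> IntD D" "\<And>f. f \<in> F \<Longrightarrow> poly f d \<in> locm"
    and d: "d \<in> loc D P" and g: "g \<in> IntD D" "iota g \<in> vclos (iota ` IntD D) (iota ` F)"
  shows "poly g d \<in> locm"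
proof -
  have FV: "f \<in> IntD (loc D P)" if "f \<in> F" for f using that F IntD_subset_loc by blast
  have "\<exists>k. \<forall>z. z / p ^ k \<in> loc D P \<longrightarrow> poly f (d + z) \<in> locm" if "f \<in> F" for f
    using IntD_locally_in_locm[OF FV[OF that] d F(3)[OF that]] .
  then obtain K where K: "\<And>f z. f \<in> F \<Longrightarrow> z / p ^ K f \<in> loc D P \<Longrightarrow> poly f (d + z) \<in> locm" by metis
  define k where "k = sum K F"
  have pL: "p \<in> loc D P" using p_locm locm_subset by blast
  have kK: "poly f (d + z) \<in> locm" if "f \<in> F" "z / p ^ k \<in> loc D P" for f z
  proof -
    have "K f \<le> k" unfolding k_def using F that by (intro member_le_sum) auto
    then have "z / p ^ K f = z / p ^ k * p ^ (k - K f)"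
      using p_nz by (simp add: power_diff)
    then have "z / p ^ K f \<in> loc D P" using that(2) pL L.mult_mem L.power_mem by metis
    then show ?thesis using K that by blast
  qed
  define h where "h = smult (inverse p) (pcompose (psi k) [:- d, 1:])"
  have ph: "poly h a = poly (psi k) (a - d) / p" for a by (simp add: h_def poly_pcompose field_simps)
  have dK: "d \<in> qfield D" using d loc_qfield by blast
  have psiK: "psi k \<in> poly_over (qfield D)" using IntD_poly_over[OF psi_IntD] qfield_loc by simp
  have hK: "h \<in> poly_over (qfield D)"
    unfolding h_def using dK psiK p_P P_sub mem_qfield qfield_inverse
    by (intro K.poly_over_smult K.poly_over_pcompose K.poly_over_pCons K.poly_over_const K.minus_mem) auto
  have "h * f \<in> IntD_loc D P" if f: "f \<in> F" for f
    unfolding loc_eq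
  proof (rule IntDI)
    show "h * f \<in> poly_over (qfield (loc D P))"
      using hK IntD_poly_over[of f D] f F qfield_loc by (auto intro: K.poly_over_mult)
    fix a assume a: "a \<in> loc D P"
    have ad: "a - d \<in> loc D P" using a d by (rule L.diff_mem)
    \<comment> \<open>Either the value of \<open>psi k\<close> absorbs the division by
      \<open>p\<close>, or \<open>a - d\<close> is divisible by \<open>p ^ k\<close> and then
      \<open>f(a)\<close> absorbs it.\<close>
    show "poly (h * f) a \<in> loc D P"
    proof (cases "poly (psi k) (a - d) \<in> locm")
      case True
      then have "poly (psi k) (a - d) / p * poly f a \<in> loc D P"
        using locm_div_p IntD_poly[OF FV[OF f] a] by (intro L.mult_mem)
      then show ?thesis by (simp add: ph)
    next
      case False
      then have "poly f (d + (a - d)) \<in> locm" using kK[OF f] div_p_power_if_psi[OF ad] by blast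
      then have "poly (psi k) (a - d) * (poly f a / p) \<in> loc D P"
        using IntD_poly[OF psi_IntD ad] locm_div_p by (intro L.mult_mem) auto
      then show ?thesis by (simp add: ph)
    qed
  qed
  then obtain s where s: "s \<in> D" "s \<notin> P" "\<forall>f\<in>F. smult s (h * f) \<in> IntD D"
    using IntD_loc_common_denominator[of "(\<lambda>f. h * f) ` F"] F(1) by auto
  have "smult s h * g \<in> IntD D"
  proof (rule E.iota_vclosD[OF g(2)])
    show "smult s h \<in> poly_over (qfield D)" using s hK mem_qfield by (intro K.poly_over_smult)
    show "smult s h * f \<in> IntD D" if "f \<in> F" for f using s(3) that by simp
  qed
  then have "poly (smult s h * g) d \<in> loc D P" using IntD_subset_loc IntD_poly[OF _ d] by blast
  then have "s * poly g d / p \<in> loc D P" by (simp add: ph poly_psi_0)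
  then have "s * poly g d \<in> locm" by (simp add: locm_iff_div_p)
  moreover have "s \<notin> locm" "s \<in> loc D P" using s locm_ring_iff mem_loc by auto
  moreover have "poly g d \<in> loc D P" using g(1) IntD_subset_loc IntD_poly[OF _ d] by blast
  ultimately show ?thesis using L.P_prime by blast
qed

text \<open>An element \<open>a\<close> of \<open>N\<close> outside \<open>P\<close> satisfies
  \<open>a ^ r - 1 \<in> P\<close>, which would put 1 into \<open>N\<close>.\<close>

lemma prime_maximal:
  assumes N: "prime_ideal D N" "P \<subseteq> N"
  shows "N = P"
proof (rule ccontr)
  assume "N \<noteq> P"
  then obtain a where a: "a \<in> N" "a \<notin> P" using N by blast
  interpret N: prime_at D N using N by unfold_locales
  have aD: "a \<in> D" using a N.P_sub by blast
  then have "a ^ r - 1 \<in> locm" using r_exp mem_loc locm_ring_iff a by blast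
  then have "a ^ r - 1 \<in> P" using locm_ring_iff aD by (simp add: diff_mem power_mem)
  then have "a ^ r - 1 \<in> N" using N by blast
  moreover have "a ^ r \<in> N" using r_pos a N.P_mult'[OF a(1) power_mem[OF aD, of "r - 1"]] by (cases r) auto
  ultimately have "a ^ r - (a ^ r - 1) \<in> N" using N.P_diff by blast
  then show False using N.one_notin_P by simp
qed

lemma evaluation_at_0:
  defines "Q \<equiv> iota ` {f \<in> IntD D. poly f 0 \<in> P}"
  shows "prime_ideal (iota ` IntD D) Q" "t_ideal (iota ` IntD D) Q"
proof -
  have e: "poly f 0 \<in> D" if "f \<in> IntD D" for f using IntD_poly[OF that, of 0] by simp
  have mem: "iota f \<in> Q \<longleftrightarrow> f \<in> IntD D \<and> poly f 0 \<in> P" for f by (auto simp: Q_def)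
  have QR: "Q \<subseteq> iota ` IntD D" by (auto simp: Q_def)
  have i: "is_ideal (iota ` IntD D) Q"
    unfolding is_ideal_def
  proof (intro conjI ballI)
    show "0 \<in> Q" using mem[of 0] E.zero_E by simp
    fix x y assume "x \<in> Q" "y \<in> Q"
    then obtain f g where "x = iota f" "y = iota g" "f \<in> IntD D" "g \<in> IntD D" "poly f 0 \<in> P" "poly g 0 \<in> P"
      by (auto simp: Q_def)
    then show "x + y \<in> Q" using mem[of "f + g"] by (simp add: iota_add E.E_add P_add)
  next
    fix x y assume "x \<in> iota ` IntD D" "y \<in> Q"
    then obtain f g where "x = iota f" "y = iota g" "f \<in> IntD D" "g \<in> IntD D" "poly g 0 \<in> P"
      by (auto simp: Q_def)
    then show "x * y \<in> Q" using mem[of "f * g"] e by (simp add: iota_mult E.E_mult P_mult)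
  qed (rule QR)
  have "x \<in> Q \<or> y \<in> Q" if xy: "x \<in> iota ` IntD D" "y \<in> iota ` IntD D" "x * y \<in> Q" for x y
  proof -
    obtain f g where fg: "x = iota f" "y = iota g" "f \<in> IntD D" "g \<in> IntD D" using xy by auto
    then have "poly f 0 * poly g 0 \<in> P" using xy(3) mem[of "f * g"] by (simp add: iota_mult)
    then show ?thesis using P_prime[OF e e] fg mem by blast
  qed
  moreover have "1 \<notin> Q" using mem[of 1] by simp
  then have "Q \<noteq> iota ` IntD D" using E.ER.one_mem by auto
  ultimately show "prime_ideal (iota ` IntD D) Q" using i by (simp add: prime_ideal_def)
  show "t_ideal (iota ` IntD D) Q"
  proof (rule E.ER.t_idealI[OF i])
    fix F assume F: "finite F" "F \<subseteq> Q"
    obtain G where G: "G \<subseteq> {f \<in> IntD D. poly f 0 \<in> P}" "finite G" "F = iota ` G"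
      using finite_subset_image[OF F(1) F(2)[unfolded Q_def]] by blast
    show "vclos (iota ` IntD D) F \<subseteq> Q"
    proof
      fix x assume x: "x \<in> vclos (iota ` IntD D) F"
      then obtain g where g: "x = iota g" "g \<in> IntD D"
        using E.ER.vclos_subset_ring[of F] F QR by blast
      have "poly g 0 \<in> locm"
      proof (rule poly_vclos_mem_locm[OF G(2) _ _ _ g(2)])
        show "G \<subseteq> IntD D" using G(1) by blast
        show "poly f 0 \<in> locm" if "f \<in> G" for f
          using G(1) that locm_ring_iff[of "poly f 0"] P_sub by blast
        show "iota g \<in> vclos (iota ` IntD D) (iota ` G)" using x g(1) G(3) by simp
      qed simp
      then show "x \<in> Q" using g mem e locm_ring_iff by blast
    qed
  qed
qed

text \<open>Suppose \<open>c\<close> is divisible by all powers of \<open>p\<close> and compare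
  \<open>X\<close> with \<open>c\<close> at the t-prime of all \<open>f\<close> with
  \<open>f(0)\<close> in \<open>P\<close>. From \<open>X g = c f\<close> follows that
  \<open>g(0)\<close> is \<open>c\<close> times a coefficient of \<open>f\<close>; a power of
  \<open>p\<close> clears the denominator of that coefficient, so \<open>g(0)\<close> is in the
  maximal ideal. From \<open>c g = X f\<close> follows \<open>g(0) = 0\<close>.\<close>

lemma p_power_div:
  assumes PV: "PvMD (iota ` IntD D)" and c: "c \<in> P" "c \<noteq> 0"
  shows "\<exists>k. p ^ k / c \<in> loc D P"
proof (rule ccontr)
  assume neg: "\<not> ?thesis"
  have cD: "c \<in> D" using c P_sub by blast
  have cp: "c / p ^ k \<in> loc D P" for k
  proof -
    have "p ^ k / c \<in> qfield D" using c cD p_P P_sub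
      by (intro qfield_divide mem_qfield power_mem) auto
    then show ?thesis using neg valuation_loc_cases[OF val, of "p ^ k / c"] c p_nz locm_subset by auto
  qed
  define Q where "Q = iota ` {f \<in> IntD D. poly f 0 \<in> P}"
  interpret Q: poly_prime D "IntD D" Q
    using evaluation_at_0(1) unfolding Q_def by unfold_locales
  have mem: "iota f \<in> Q \<longleftrightarrow> f \<in> IntD D \<and> poly f 0 \<in> P" for f by (auto simp: Q_def)
  have "valuation_domain (loc (iota ` IntD D) Q)"
    using E.ER.PvMD_t_prime[OF PV] evaluation_at_0 unfolding Q_def by blast
  moreover have "iota [:0, 1:] / iota [:c:] \<in> qfield (iota ` IntD D)"
    using E.X_E E.const_E[OF cD] c by (intro E.ER.qfieldI) auto
  moreover have "iota [:0, 1:] / iota [:c:] \<noteq> 0" using c by auto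
  ultimately have "iota [:0, 1:] / iota [:c:] \<in> loc (iota ` IntD D) Q \<or>
      iota [:c:] / iota [:0, 1:] \<in> loc (iota ` IntD D) Q"
    using Q.Q.qfield_loc unfolding valuation_domain_def by (metis inverse_divide)
  then show False
  proof
    assume "iota [:0, 1:] / iota [:c:] \<in> loc (iota ` IntD D) Q"
    then obtain f g where fg: "iota [:0, 1:] / iota [:c:] = iota f / iota g" "f \<in> IntD D" "g \<in> IntD D" "iota g \<notin> Q"
      by (auto elim!: Q.Q.locE)
    have "g \<noteq> 0" using fg by auto
    then have e: "[:0, 1:] * g = f * [:c:]" using fg(1) c by (subst (asm) iota_divide_eq) auto
    have "coeff ([:0, 1:] * g) 1 = coeff (f * [:c:]) 1" by (simp only: e)
    then have g0: "poly g 0 = c * coeff f 1" by (simp add: poly_0_coeff_0)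
    obtain n where n: "smult (p ^ n) f \<in> poly_over (loc D P)"
      using IntD_p_power fg(2) IntD_subset_loc by blast
    have "p * (c / p ^ Suc n * (p ^ n * coeff f 1)) \<in> locm"
      using L.P_mult'[OF p_locm L.mult_mem[OF cp[of "Suc n"] poly_overD[OF n, of 1]]] by simp
    moreover have "p * (c / p ^ Suc n * (p ^ n * coeff f 1)) = poly g 0"
      using p_nz by (simp add: g0 field_simps)
    ultimately have "poly g 0 \<in> locm" by simp
    then show False using fg mem locm_ring_iff IntD_poly[OF fg(3), of 0] by simp
  next
    assume "iota [:c:] / iota [:0, 1:] \<in> loc (iota ` IntD D) Q"
    then obtain f g where fg: "iota [:c:] / iota [:0, 1:] = iota f / iota g" "f \<in> IntD D" "g \<in> IntD D" "iota g \<notin> Q"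
      by (auto elim!: Q.Q.locE)
    have "g \<noteq> 0" using fg by auto
    then have e: "[:c:] * g = f * [:0, 1:]" using fg(1) by (subst (asm) iota_divide_eq) auto
    have "poly ([:c:] * g) 0 = poly (f * [:0, 1:]) 0" by (simp only: e)
    then have "poly g 0 = 0" using c by simp
    then show False using fg mem by simp
  qed
qed

lemma p_power_div_obtain:
  assumes PV: "PvMD (iota ` IntD D)" and c: "c \<in> P" "c \<noteq> 0" and a: "a \<in> P"
  shows "\<exists>k s. s \<in> D \<and> s \<notin> P \<and> s * a ^ k / c \<in> D"
proof -
  obtain k where k: "p ^ k / c \<in> loc D P" using p_power_div[OF PV c] by blast
  have "a \<in> locm" using a P_sub locm_ring_iff by blast
  then have "(a / p) ^ k * (p ^ k / c) \<in> loc D P" using k locm_div_p by (intro L.mult_mem L.power_mem) auto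
  moreover have "(a / p) ^ k * (p ^ k / c) = a ^ k / c" using p_nz by (simp add: power_divide)
  ultimately have "a ^ k / c \<in> loc D P" by (simp only:)
  then obtain s where "s \<in> D" "s \<notin> P" "s * (a ^ k / c) \<in> D"
    using loc_common_denominator[of "{a ^ k / c}"] by auto
  then show ?thesis by auto
qed

text \<open>\<open>phi\<close> is the product of the \<open>1 - f ^ r\<close>, which are outside
  \<open>Q\<close>. At each \<open>d\<close>, either all \<open>f(d)\<close> are nonunits and so is
  \<open>g(d)\<close>, or some \<open>f(d)\<close> is a unit and \<open>phi(d)\<close> is a nonunit.
  Hence \<open>g phi / p\<close> is in \<open>Int(D\<^sub>P)\<close>, and a multiple of
  \<open>g phi\<close> by an element outside \<open>P\<close> lies in
  \<open>p Int(D) \<subseteq> Q\<close>.\<close>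

lemma prime_above_t_ideal:
  assumes Q: "poly_prime D (IntD D) Q" and ctr: "poly_prime.ctr D Q = P"
  shows "t_ideal (iota ` IntD D) Q"
proof -
  interpret Q: poly_prime D "IntD D" Q by (rule Q)
  have i: "is_ideal (iota ` IntD D) Q" using Q.Q_prime by (simp add: prime_ideal_def)
  show ?thesis
  proof (rule E.ER.t_idealI[OF i])
    fix F assume F: "finite F" "F \<subseteq> Q"
    then have FE: "F \<subseteq> iota ` IntD D" using Q.Q.P_sub by blast
    obtain G where G: "G \<subseteq> IntD D" "finite G" "F = iota ` G"
      using finite_subset_image[OF F(1) FE] by blast
    show "vclos (iota ` IntD D) F \<subseteq> Q"
    proof
      fix x assume x: "x \<in> vclos (iota ` IntD D) F"
      then obtain g where g: "x = iota g" "g \<in> IntD D"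
        using E.ER.vclos_subset_ring[OF FE] by blast
      define phi where "phi = (\<Prod>f\<in>G. (1 - f ^ r))"
      have phiE: "phi \<in> IntD D" unfolding phi_def
        using G by (intro E.E_prod E.E_diff E.one_E E.E_power) auto
      have phiQ: "iota phi \<notin> Q"
        unfolding phi_def iota_prod
      proof (rule Q.Q.notin_prod)
        fix f assume f: "f \<in> G"
        then have fE: "f \<in> IntD D" "iota f \<in> Q" using G F by auto
        have "iota f ^ r \<in> Q" using fE r_pos Q.Q.P_mult'[OF fE(2) E.ER.power_mem[of "iota f" "r - 1"]]
          by (cases r) auto
        moreover have "iota (1 - f ^ r) = 1 - iota f ^ r" by (simp add: iota_diff iota_power)
        moreover have "1 - f ^ r \<in> IntD D" using fE by (intro E.E_diff E.one_E E.E_power)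
        moreover have "1 - iota f ^ r \<notin> Q"
        proof
          assume "1 - iota f ^ r \<in> Q"
          with \<open>iota f ^ r \<in> Q\<close> have "1 - iota f ^ r + iota f ^ r \<in> Q" by (intro Q.Q.P_add)
          then show False using Q.Q.one_notin_P by simp
        qed
        ultimately show "iota (1 - f ^ r) \<in> iota ` IntD D \<and> iota (1 - f ^ r) \<notin> Q"
          by (metis imageI)
      qed
      have small: "poly (g * phi) d \<in> locm" if d: "d \<in> loc D P" for d
      proof (cases "\<forall>f\<in>G. poly f d \<in> locm")
        case True
        then have "poly g d \<in> locm"
          using poly_vclos_mem_locm[OF G(2,1) _ d g(2)] x g(1) G(3) by simp
        moreover have "poly phi d \<in> loc D P" using phiE IntD_subset_loc IntD_poly d by blast
        ultimately show ?thesis by (auto intro: L.P_mult')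
      next
        case False
        then obtain f where f: "f \<in> G" "poly f d \<notin> locm" by blast
        have v: "poly h d \<in> loc D P" if "h \<in> IntD D" for h
          using that IntD_subset_loc IntD_poly d by blast
        have "poly phi d = (1 - poly f d ^ r) * (\<Prod>h\<in>G - {f}. (1 - poly h d ^ r))"
          unfolding phi_def poly_prod using G f by (subst prod.remove[of G f]) (auto simp: poly_power)
        also have "\<dots> \<in> locm"
          using one_minus_power[OF v f(2)] f(1) G v
          by (intro L.P_mult' L.prod_mem L.diff_mem L.power_mem) auto
        finally show ?thesis using v[OF g(2)] by (auto intro: L.P_mult)
      qed
      have pK: "inverse p \<in> qfield D" using p_P P_sub mem_qfield qfield_inverse by blast
      have "smult (inverse p) (g * phi) \<in> IntD_loc D P"
        unfolding loc_eq
      proof (rule IntDI)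
        show "smult (inverse p) (g * phi) \<in> poly_over (qfield (loc D P))"
          unfolding qfield_loc using pK IntD_poly_over[OF g(2)] IntD_poly_over[OF phiE]
          by (intro K.poly_over_smult K.poly_over_mult)
        show "poly (smult (inverse p) (g * phi)) d \<in> loc D P" if "d \<in> loc D P" for d
          using locm_div_p[OF small[OF that]] by (simp add: field_simps)
      qed
      then obtain s where s: "s \<in> D" "s \<notin> P" "smult s (smult (inverse p) (g * phi)) \<in> IntD D"
        by (rule IntD_locE)
      have "iota (smult p (smult s (smult (inverse p) (g * phi)))) \<in> Q"
        using p_P s ctr Q.Q_smult_ctr by blast
      moreover have "smult p (smult s (smult (inverse p) (g * phi))) = smult s (g * phi)"
        using p_nz by (simp add: field_simps)
      ultimately have "iota (smult s (g * phi)) \<in> Q" by (simp only:)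
      then have "iota (g * phi) \<in> Q" using Q.Q_smult_cancel s ctr E.E_mult[OF g(2) phiE] by blast
      then show "x \<in> Q" using Q.Q.P_prime[of "iota g" "iota phi"] g phiE phiQ by (auto simp: iota_mult)
    qed
  qed
qed

end

lemma (in int_localizes) Lambda0_finite_residue:
  assumes PV: "PvMD D" and P: "P \<in> Lambda0 D"
  shows "\<exists>p r. finite_residue D P p r"
proof -
  have tm: "t_maximal D P" using Lambda0_t_maximal[OF P] .
  interpret P: prime_at D P using t_maximal_prime[OF tm] by unfold_locales
  have loc_eq: "IntD_loc D P = IntD (loc D P)" using int_loc[OF tm] .
  have val: "valuation_domain (loc D P)" using PV tm by (simp add: PvMD_def)
  have "\<not> IntD (loc D P) \<subseteq> poly_over (loc D P)"
    using P loc_eq P.poly_over_loc_subset by (auto simp: Lambda0_def)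
  then obtain f k where f: "f \<in> IntD (loc D P)" "coeff f k \<notin> loc D P" by (auto simp: poly_over_def)
  obtain p where p: "p \<in> P" "p \<noteq> 0" "\<forall>t\<in>P.locm. t / p \<in> loc D P"
    using P.uniformizer_exists[OF val f] by blast
  obtain r where r: "r > 0" "\<forall>a\<in>loc D P. a \<notin> P.locm \<longrightarrow> a ^ r - 1 \<in> P.locm"
    using P.residue_exponent_exists[OF f] by blast
  have "finite_residue D P p r"
    using p r val loc_eq by unfold_locales auto
  then show ?thesis by blast
qed

section \<open>The overring D_0\<close>

context int_localizes
begin

lemma D0_subset_loc: "P \<in> Lambda0 D \<Longrightarrow> D0 D \<subseteq> loc D P"
  by (auto simp: D0_def)

lemma Lambda0_prime: "P \<in> Lambda0 D \<Longrightarrow> prime_at D P"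
  using subdom_axioms by (simp add: prime_at_def prime_at_axioms_def Lambda0_def t_spec_def)

lemma mem_D0: "x \<in> qfield D \<Longrightarrow> (\<And>P. P \<in> Lambda0 D \<Longrightarrow> x \<in> loc D P) \<Longrightarrow> x \<in> D0 D"
  by (auto simp: D0_def)

lemma D0_subset_qfield: "D0 D \<subseteq> qfield D"
proof (cases "Lambda0 D = {}")
  case False
  then obtain P where "P \<in> Lambda0 D" by blast
  then show ?thesis using D0_subset_loc prime_at.loc_qfield[OF Lambda0_prime] by blast
qed (simp add: D0_def)

lemma subset_D0: "D \<subseteq> D0 D"
  using prime_at.mem_loc[OF Lambda0_prime] mem_qfield by (auto intro: mem_D0)

lemma subdom_D0: "subdom (D0 D)"
proof -
  interpret K: subdom "qfield D" by (rule subdom_qfield)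
  have "x + y \<in> D0 D \<and> x * y \<in> D0 D \<and> - x \<in> D0 D" if "x \<in> D0 D" "y \<in> D0 D" for x y
  proof -
    have K: "x \<in> qfield D" "y \<in> qfield D" using that D0_subset_qfield by auto
    have "x + y \<in> loc D P \<and> x * y \<in> loc D P \<and> - x \<in> loc D P" if P: "P \<in> Lambda0 D" for P
    proof -
      interpret L: subdom "loc D P" using prime_at.subdom_loc[OF Lambda0_prime[OF P]] .
      show ?thesis using D0_subset_loc[OF P] \<open>x \<in> D0 D\<close> \<open>y \<in> D0 D\<close>
        by (auto intro: L.add_mem L.mult_mem L.minus_mem)
    qed
    then show ?thesis using K by (auto intro!: mem_D0 K.add_mem K.mult_mem K.minus_mem)
  qed
  moreover have "0 \<in> D0 D" "1 \<in> D0 D" using subset_D0 by auto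
  ultimately show ?thesis by unfold_locales (auto simp: is_subdomain_def)
qed

lemma D0_poly_ring: "poly_ring D (IntD (D0 D))"
  using IntD_poly_ring_ext subdom_D0 subset_D0 D0_subset_qfield by blast

lemma qfield_D0: "qfield (D0 D) = qfield D"
  using qfield_eq_between subdom_D0 subset_D0 D0_subset_qfield by blast

lemma IntD_subset_IntD_D0: "IntD D \<subseteq> IntD (D0 D)"
proof
  interpret K: subdom "qfield D" by (rule subdom_qfield)
  fix f assume f: "f \<in> IntD D"
  show "f \<in> IntD (D0 D)"
  proof (rule IntDI)
    show "f \<in> poly_over (qfield (D0 D))" using IntD_poly_over[OF f] by (simp add: qfield_D0)
    fix x assume x: "x \<in> D0 D"
    show "poly f x \<in> D0 D"
    proof (rule mem_D0)
      show "poly f x \<in> qfield D"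
        using K.poly_mem[OF IntD_poly_over[OF f]] x D0_subset_qfield by blast
      fix P assume P: "P \<in> Lambda0 D"
      interpret P: prime_at D P by (rule Lambda0_prime[OF P])
      show "poly f x \<in> loc D P"
        using f P.IntD_subset_loc IntD_poly[of f "loc D P" x] x D0_subset_loc[OF P] by blast
    qed
  qed
qed

lemma IntD_D0_subset_loc:
  assumes P: "prime_ideal D P" and D0P: "D0 D \<subseteq> loc D P"
  shows "IntD (D0 D) \<subseteq> IntD (loc D P)"
proof (rule IntD_subset_fractions[OF subdom_D0])
  interpret P: prime_at D P using P by unfold_locales
  show "subdom (loc D P)" "D0 D \<subseteq> loc D P" "loc D P \<subseteq> qfield (D0 D)"
    using P.subdom_loc D0P P.loc_qfield by (auto simp: qfield_D0)
  show "\<exists>a\<in>D0 D. \<exists>s\<in>D0 D. s \<noteq> 0 \<and> inverse s \<in> loc D P \<and> b = a / s" if "b \<in> loc D P" for b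
    using that by (rule P.locE) (use P.loc_inverse subset_D0 in blast)
qed

lemma Lambda0_vclos_poly_0:
  assumes "PvMD D" and M: "M \<in> Lambda0 D" and G: "finite G" "G \<subseteq> IntD D" "\<And>f. f \<in> G \<Longrightarrow> poly f 0 \<in> M"
    and g: "g \<in> IntD D" "iota g \<in> vclos (iota ` IntD D) (iota ` G)"
  shows "poly g 0 \<in> M"
proof -
  obtain p r where "finite_residue D M p r" using Lambda0_finite_residue[OF assms(1) M] by blast
  then interpret M: finite_residue D M p r .
  have "poly g 0 \<in> M.locm"
  proof (rule M.poly_vclos_mem_locm[OF G(1,2) _ _ g])
    show "poly f 0 \<in> M.locm" if "f \<in> G" for f using G(3)[OF that] M.P_sub M.locm_ring_iff by blast
  qed simp
  then show ?thesis using M.locm_ring_iff IntD_poly[OF g(1), of 0] by simp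
qed

section \<open>Compactness of \<open>\<Lambda>\<^sub>0\<close> and the nonzero primes of
  \<open>D\<^sub>0\<close>\<close>

text \<open>Applied with \<open>B\<close> the set of multiples of \<open>c\<close> in
  \<open>D\<^sub>0\<close>, where the complement of \<open>T\<close> plays the part of a prime
  minimal over \<open>c\<close>; the last conjunct expresses this minimality.\<close>

lemma maximal_multiplicative_set:
  assumes T0: "T0 \<subseteq> D" "1 \<in> T0" "\<And>x y. x \<in> T0 \<Longrightarrow> y \<in> T0 \<Longrightarrow> x * y \<in> T0"
    and disj: "\<And>x. x \<in> T0 \<Longrightarrow> x \<notin> B"
  shows "\<exists>T. T0 \<subseteq> T \<and> T \<subseteq> D \<and> (\<forall>x\<in>T. \<forall>y\<in>T. x * y \<in> T) \<and> (\<forall>x\<in>T. x \<notin> B) \<and>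
    (\<forall>a\<in>D. a \<notin> T \<longrightarrow> (\<exists>u\<in>T. \<exists>k. u * a ^ k \<in> B))"
proof -
  define A where "A = {T. T0 \<subseteq> T \<and> T \<subseteq> D \<and> (\<forall>x\<in>T. \<forall>y\<in>T. x * y \<in> T) \<and> (\<forall>x\<in>T. x \<notin> B)}"
  have "\<exists>M\<in>A. \<forall>X\<in>A. M \<subseteq> X \<longrightarrow> X = M"
  proof (rule subset_Zorn_nonempty)
    have "T0 \<in> A" unfolding A_def using T0 disj by simp
    then show "A \<noteq> {}" by blast
    fix C assume ne: "C \<noteq> {}" and ch: "subset.chain A C"
    have CA: "\<And>X. X \<in> C \<Longrightarrow> X \<in> A" using ch by (auto simp: subset.chain_def)
    have "x * y \<in> \<Union>C" if xy: "x \<in> X" "X \<in> C" "y \<in> Y" "Y \<in> C" for x y X Y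
    proof -
      have "X \<subseteq> Y \<or> Y \<subseteq> X" using ch xy by (auto simp: subset.chain_def)
      then obtain Z where "Z \<in> C" "x \<in> Z" "y \<in> Z" using xy by blast
      moreover have "x * y \<in> Z" using CA[OF \<open>Z \<in> C\<close>] calculation by (simp add: A_def)
      ultimately show ?thesis by blast
    qed
    then have "\<forall>x\<in>\<Union>C. \<forall>y\<in>\<Union>C. x * y \<in> \<Union>C" by blast
    moreover obtain X where "X \<in> C" using ne by auto
    then have "T0 \<subseteq> \<Union>C" using CA[of X] by (auto simp: A_def)
    moreover have "\<Union>C \<subseteq> D" "\<forall>x\<in>\<Union>C. x \<notin> B"
      using CA[unfolded A_def mem_Collect_eq] by (meson Union_least UnionE)+
    ultimately show "\<Union>C \<in> A" unfolding A_def by simp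
  qed
  then obtain T where T: "T \<in> A" and max: "\<forall>X\<in>A. T \<subseteq> X \<longrightarrow> X = T" by (rule bexE)
  have one: "1 \<in> T" and TD: "T \<subseteq> D" and cl: "\<And>x y. x \<in> T \<Longrightarrow> y \<in> T \<Longrightarrow> x * y \<in> T"
    using T T0(2) by (auto simp: A_def)
  have "\<exists>u\<in>T. \<exists>k. u * a ^ k \<in> B" if a: "a \<in> D" "a \<notin> T" for a
  proof (rule ccontr)
    assume neg: "\<not> ?thesis"
    define T' where "T' = {u * a ^ k | u k. u \<in> T}"
    have "u * a ^ 0 \<in> T'" if "u \<in> T" for u unfolding T'_def using that by blast
    then have TT': "T \<subseteq> T'" by auto
    have "1 * a ^ 1 \<in> T'" unfolding T'_def using one by blast
    then have "a \<in> T'" by simp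
    have "x * y \<in> T'" if xy: "x \<in> T'" "y \<in> T'" for x y
    proof -
      obtain u k v l where "x = u * a ^ k" "y = v * a ^ l" "u \<in> T" "v \<in> T" using xy by (auto simp: T'_def)
      moreover have "u * a ^ k * (v * a ^ l) = (u * v) * a ^ (k + l)" by (simp add: power_add)
      ultimately show ?thesis unfolding T'_def using cl by blast
    qed
    moreover have "T' \<subseteq> D" using TD a by (auto simp: T'_def intro!: mult_mem power_mem)
    moreover have "\<forall>x\<in>T'. x \<notin> B" using neg by (auto simp: T'_def)
    moreover have "T0 \<subseteq> T'" using T TT' by (auto simp: A_def)
    ultimately have "T' \<in> A" by (simp add: A_def)
    then show False using max TT' \<open>a \<in> T'\<close> a by blast
  qed
  then show ?thesis using T by (intro exI[of _ T]) (simp add: A_def)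
qed

text \<open>A limit of the evaluation ideals \<open>{f. f(0) \<in> M}\<close>, \<open>M \<in> \<Lambda>\<^sub>0\<close>, is a prime t-ideal
  containing \<open>X\<close>, so it contracts to a member of \<open>\<Lambda>\<^sub>0\<close>: the localization at it could not be a
  valuation domain otherwise. Ultrafilters are replaced by maximal families with the finite
  intersection property.\<close>

lemma limit_of_Lambda0:
  assumes PV: "PvMD D" "PvMD (iota ` IntD D)" and C: "C \<subseteq> D" "\<not> C \<subseteq> {0}"
    and fip: "\<And>A. finite A \<Longrightarrow> A \<subseteq> insert 0 C \<Longrightarrow> \<exists>M\<in>Lambda0 D. A \<subseteq> M"
  shows "\<exists>P\<in>Lambda0 D. C \<subseteq> P"
proof -
  define good where "good A \<longleftrightarrow> (\<exists>M\<in>Lambda0 D. \<forall>f\<in>A. poly f 0 \<in> M)" for A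
  \<comment> \<open>\<open>X\<close> is put in for the comparison with constants at the end; its
    value at 0 is 0, which explains \<open>insert 0 C\<close> in \<open>fip\<close>.\<close>
  let ?S0 = "insert [:0, 1:] ((\<lambda>a. [:a:]) ` C)"
  have S0: "?S0 \<subseteq> IntD D" using E.X_E E.const_E C by auto
  have "good F" if F: "finite F" "F \<subseteq> ?S0" for F
  proof -
    have "(\<lambda>f. poly f 0) ` F \<subseteq> insert 0 C" using F(2) by auto
    then show ?thesis using fip[of "(\<lambda>f. poly f 0) ` F"] F(1) by (auto simp: good_def)
  qed
  then obtain S where "?S0 \<subseteq> S \<and> S \<subseteq> IntD D \<and> (\<forall>F. finite F \<longrightarrow> F \<subseteq> S \<longrightarrow> good F) \<and>
    (\<forall>x. x \<in> IntD D \<longrightarrow> x \<notin> S \<longrightarrow> (\<exists>F. finite F \<and> F \<subseteq> S \<and> \<not> good (insert x F)))"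
    using finite_character_maximal[where good = good, OF S0] by metis
  then have S: "?S0 \<subseteq> S" "S \<subseteq> IntD D" and gd: "\<And>F. finite F \<Longrightarrow> F \<subseteq> S \<Longrightarrow> good F"
    and max: "\<And>x. x \<in> IntD D \<Longrightarrow> x \<notin> S \<Longrightarrow> \<exists>F. finite F \<and> F \<subseteq> S \<and> \<not> good (insert x F)"
    by simp_all
  \<comment> \<open>Maximality as a closure rule: what lies in every evaluation ideal containing a
    finite \<open>G \<subseteq> S\<close> lies in \<open>S\<close>. Sums, multiples and v-closures
    are all instances.\<close>
  have cl: "g \<in> S" if g: "g \<in> IntD D" and G: "finite G" "G \<subseteq> S"
    and imp: "\<And>M. M \<in> Lambda0 D \<Longrightarrow> (\<And>f. f \<in> G \<Longrightarrow> poly f 0 \<in> M) \<Longrightarrow> poly g 0 \<in> M" for g G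
  proof (rule ccontr)
    assume "g \<notin> S"
    then obtain F where F: "finite F" "F \<subseteq> S" "\<not> good (insert g F)" using max[OF g] by blast
    then obtain M where "M \<in> Lambda0 D" "\<forall>f\<in>F \<union> G. poly f 0 \<in> M"
      using gd[of "F \<union> G"] G by (auto simp: good_def)
    then show False using imp[of M] F(3) by (auto simp: good_def)
  qed
  define Q where "Q = iota ` S"
  have mem: "iota f \<in> Q \<longleftrightarrow> f \<in> S" for f by (auto simp: Q_def)
  have QR: "Q \<subseteq> iota ` IntD D" using S by (auto simp: Q_def)
  have i: "is_ideal (iota ` IntD D) Q"
    unfolding is_ideal_def
  proof (intro conjI ballI)
    have "0 \<in> S" using cl[of 0 "{}"] E.zero_E prime_at.P_0[OF Lambda0_prime] by simp
    then show "0 \<in> Q" using mem[of 0] by simp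
    fix x y assume "x \<in> Q" "y \<in> Q"
    then obtain f g where fg: "x = iota f" "y = iota g" "f \<in> S" "g \<in> S" by (auto simp: Q_def)
    have "f + g \<in> S"
      using fg S prime_at.P_add[OF Lambda0_prime] by (intro cl[of _ "{f, g}"] E.E_add) auto
    then show "x + y \<in> Q" using mem[of "f + g"] fg by (simp add: iota_add)
  next
    fix x y assume "x \<in> iota ` IntD D" "y \<in> Q"
    then obtain f g where fg: "x = iota f" "y = iota g" "f \<in> IntD D" "g \<in> S" by (auto simp: Q_def)
    have "f * g \<in> S"
      using fg S IntD_poly[OF fg(3), of 0] prime_at.P_mult[OF Lambda0_prime]
      by (intro cl[of _ "{g}"] E.E_mult) auto
    then show "x * y \<in> Q" using mem[of "f * g"] fg by (simp add: iota_mult)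
  qed (rule QR)
  have "x \<in> Q \<or> y \<in> Q" if xy: "x \<in> iota ` IntD D" "y \<in> iota ` IntD D" "x * y \<in> Q" for x y
  proof (rule ccontr)
    assume n: "\<not> ?thesis"
    obtain f g where fg: "x = iota f" "y = iota g" "f \<in> IntD D" "g \<in> IntD D" using xy by auto
    have fgS: "f * g \<in> S" "f \<notin> S" "g \<notin> S" using xy(3) n fg mem by (auto simp flip: iota_mult)
    obtain F where F: "finite F" "F \<subseteq> S" "\<not> good (insert f F)" using max[OF fg(3) fgS(2)] by blast
    obtain G where G: "finite G" "G \<subseteq> S" "\<not> good (insert g G)" using max[OF fg(4) fgS(3)] by blast
    obtain M where M: "M \<in> Lambda0 D" "\<forall>h\<in>insert (f * g) (F \<union> G). poly h 0 \<in> M"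
      using gd[of "insert (f * g) (F \<union> G)"] F G fgS(1) by (auto simp: good_def)
    have "poly f 0 \<in> M \<or> poly g 0 \<in> M"
      using M prime_at.P_prime[OF Lambda0_prime[OF M(1)]] IntD_poly[OF fg(3), of 0] IntD_poly[OF fg(4), of 0]
      by simp
    then show False using F(3) G(3) M by (auto simp: good_def)
  qed
  moreover have "1 \<notin> S"
    using gd[of "{1}"] prime_at.one_notin_P[OF Lambda0_prime] by (auto simp: good_def)
  then have "Q \<noteq> iota ` IntD D" using mem[of 1] E.ER.one_mem by auto
  ultimately have "prime_ideal (iota ` IntD D) Q" using i by (simp add: prime_ideal_def)
  then interpret Q: poly_prime D "IntD D" Q by unfold_locales
  have t: "t_ideal (iota ` IntD D) Q"
  proof (rule E.ER.t_idealI[OF i])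
    fix F assume F: "finite F" "F \<subseteq> Q"
    obtain G where G: "G \<subseteq> S" "finite G" "F = iota ` G"
      using finite_subset_image[OF F(1) F(2)[unfolded Q_def]] by blast
    show "vclos (iota ` IntD D) F \<subseteq> Q"
    proof
      fix x assume x: "x \<in> vclos (iota ` IntD D) F"
      then obtain g where g: "x = iota g" "g \<in> IntD D"
        using E.ER.vclos_subset_ring[of F] F QR by blast
      have "g \<in> S"
      proof (rule cl[OF g(2) G(2,1)])
        fix M assume "M \<in> Lambda0 D" "\<And>f. f \<in> G \<Longrightarrow> poly f 0 \<in> M"
        then show "poly g 0 \<in> M"
          using Lambda0_vclos_poly_0[OF PV(1), of M G g] G S(2) g x by simp
      qed
      then show "x \<in> Q" using g mem by simp
    qed
  qed
  have X: "iota [:0, 1:] \<in> Q" using S(1) mem by simp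
  have CP: "C \<subseteq> Q.ctr" using S(1) C(1) mem by (auto simp: Q.ctr_def)
  have val: "valuation_domain (loc (iota ` IntD D) Q)"
    using E.ER.PvMD_t_prime[OF PV(2) Q.Q_prime t] .
  have "IntD_loc D Q.ctr \<noteq> poly_over (loc D Q.ctr)"
  proof
    assume "IntD_loc D Q.ctr = poly_over (loc D Q.ctr)"
    then have "IntD D \<subseteq> poly_over (loc D Q.ctr)" using Q.P.IntD_subset_IntD_loc by simp
    then show False using Q.not_valuation_if_X_mem[OF _ X] val CP C(2) by blast
  qed
  then have "Q.ctr \<in> Lambda0 D"
    using Q.t_ideal_ctr[OF refl t] Q.ctr_prime by (simp add: Lambda0_def t_spec_def)
  then show ?thesis using CP by blast
qed

text \<open>The complement of a maximal multiplicative set \<open>T\<close> that avoids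
  \<open>c D\<^sub>0\<close> and contains everything outside \<open>N\<close> is a limit of
  \<open>\<Lambda>\<^sub>0\<close>, so it lies in some \<open>P \<in> \<Lambda>\<^sub>0\<close>.
  Maximality of \<open>P\<close> among primes leaves only \<open>P \<subseteq> N\<close> to be
  shown.\<close>

lemma mem_Lambda0_if_D0_prime:
  assumes PV: "PvMD D" "PvMD (iota ` IntD D)" and N: "prime_ideal D N"
    and c: "c \<in> N" "c \<noteq> 0" and disj: "\<And>u. u \<in> D \<Longrightarrow> u \<notin> N \<Longrightarrow> u / c \<notin> D0 D"
  shows "N \<in> Lambda0 D"
proof -
  interpret N: prime_at D N using N by unfold_locales
  interpret D0: subdom "D0 D" by (rule subdom_D0)
  have cD: "c \<in> D" using c N.P_sub by blast
  obtain T where T': "D - N \<subseteq> T \<and> T \<subseteq> D \<and> (\<forall>x\<in>T. \<forall>y\<in>T. x * y \<in> T) \<and> (\<forall>x\<in>T. x \<notin> {u. u / c \<in> D0 D}) \<and>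
    (\<forall>a\<in>D. a \<notin> T \<longrightarrow> (\<exists>u\<in>T. \<exists>k. u * a ^ k \<in> {u. u / c \<in> D0 D}))"
    using maximal_multiplicative_set[of "D - N" "{u. u / c \<in> D0 D}"] disj N.notin_mult mult_mem by auto
  then have T: "D - N \<subseteq> T" "T \<subseteq> D" and Tcl: "\<And>x y. x \<in> T \<Longrightarrow> y \<in> T \<Longrightarrow> x * y \<in> T"
    and Tc: "\<And>u. u \<in> T \<Longrightarrow> u / c \<notin> D0 D"
    and Tmax: "\<And>a. a \<in> D \<Longrightarrow> a \<notin> T \<Longrightarrow> \<exists>u\<in>T. \<exists>k. u * a ^ k / c \<in> D0 D" by simp_all
  have T1: "1 \<in> T" using T by auto
  have Tprod: "prod u A \<in> T" if "\<And>a. a \<in> A \<Longrightarrow> u a \<in> T" for u and A :: "'a set"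
    using that by (induction A rule: infinite_finite_induct) (auto intro: Tcl T1)
  have Tpow: "a ^ k \<in> T" if "a \<in> T" for a k
    using that by (induction k) (auto intro: Tcl T1)
  have fip: "\<exists>M\<in>Lambda0 D. A \<subseteq> M" if A: "finite A" "A \<subseteq> D - T" for A
  proof -
    have "\<exists>u k. u \<in> T \<and> u * a ^ k / c \<in> D0 D" if "a \<in> A" for a using Tmax[of a] that A by blast
    then obtain u k where u: "\<And>a. a \<in> A \<Longrightarrow> u a \<in> T" "\<And>a. a \<in> A \<Longrightarrow> u a * a ^ k a / c \<in> D0 D" by metis
    \<comment> \<open>\<open>U\<close> is in \<open>T\<close>, so \<open>U / c\<close> fails to lie
      in \<open>D\<^sub>M\<close> for some \<open>M\<close>. That \<open>M\<close> contains every
      \<open>a \<in> A\<close>: if \<open>a\<close> were a unit at \<open>M\<close>, then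
      \<open>U a ^ k / c \<in> D\<^sub>M\<close> would give
      \<open>U / c \<in> D\<^sub>M\<close>.\<close>
    define U where "U = prod u A"
    have UT: "U \<in> T" unfolding U_def using u by (intro Tprod)
    have "U / c \<in> qfield D" using UT T cD c by (intro qfieldI) auto
    then obtain M where M: "M \<in> Lambda0 D" "U / c \<notin> loc D M" using Tc[OF UT] mem_D0 by blast
    interpret M: prime_at D M by (rule Lambda0_prime[OF M(1)])
    interpret L: subdom "loc D M" by (rule M.subdom_loc)
    have "a \<in> M" if a: "a \<in> A" for a
    proof (rule ccontr)
      assume n: "a \<notin> M"
      have aD: "a \<in> D" using a A by blast
      have "U * a ^ k a / c = prod u (A - {a}) * (u a * a ^ k a / c)"
        unfolding U_def using prod.remove[OF A(1) a, of u] by simp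
      moreover have "prod u (A - {a}) \<in> loc D M" using Tprod[of "A - {a}" u] u T M.mem_loc by blast
      moreover have "u a * a ^ k a / c \<in> loc D M" using u(2)[OF a] D0_subset_loc[OF M(1)] by blast
      ultimately have "U * a ^ k a / c \<in> loc D M" using L.mult_mem by metis
      then have "a ^ k a * (U / c) \<in> loc D M" by (simp add: mult.commute)
      then show False using M.loc_cancel[OF power_mem[OF aD] M.notin_power[OF aD n]] M(2) by blast
    qed
    then show ?thesis using M(1) by blast
  qed
  have z: "0 \<in> D - T" using Tc[of 0] D0.zero_mem by auto
  have cT: "c \<in> D - T" using Tc[of c] cD c D0.one_mem by auto
  have "\<exists>P\<in>Lambda0 D. D - T \<subseteq> P"
    using limit_of_Lambda0[OF PV, of "D - T"] fip z cT c by (auto simp: insert_absorb)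
  then obtain P where P: "P \<in> Lambda0 D" "D - T \<subseteq> P" by blast
  obtain p r where "finite_residue D P p r" using Lambda0_finite_residue[OF PV(1) P(1)] by blast
  then interpret P: finite_residue D P p r .
  have cP: "c \<in> P" using P cT by blast
  have "P \<subseteq> N"
  proof (rule subsetI, rule ccontr)
    \<comment> \<open>Such an \<open>a\<close> is in \<open>T\<close>. Since
      \<open>D\<^sub>P\<close> has no infinitely divisible elements, \<open>c\<close> divides some
      \<open>s a ^ k\<close> in \<open>D\<close> with \<open>s\<close> outside \<open>P\<close>,
      hence \<open>s \<in> T\<close>: an element of \<open>T\<close> in
      \<open>c D\<^sub>0\<close>.\<close>
    fix a assume a: "a \<in> P" "a \<notin> N"
    then have aT: "a \<in> T" using T P.P_sub by blast
    obtain k s where s: "s \<in> D" "s \<notin> P" "s * a ^ k / c \<in> D"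
      using P.p_power_div_obtain[OF PV(2) cP c(2) a(1)] by blast
    have "s \<in> T" using s P(2) by blast
    then have "s * a ^ k \<in> T" using Tcl Tpow[OF aT] by blast
    then show False using Tc s(3) subset_D0 by blast
  qed
  then show ?thesis using P.prime_maximal[OF N] P(1) by simp
qed

lemma Prufer_IntD_D0:
  assumes PV: "PvMD D" "PvMD (iota ` IntD D)"
  shows "Prufer (iota ` IntD (D0 D))"
  unfolding Prufer_def
proof (intro conjI allI impI)
  interpret B: poly_ring D "IntD (D0 D)" by (rule D0_poly_ring)
  interpret D0: subdom "D0 D" by (rule subdom_D0)
  interpret D0E: poly_ring "D0 D" "IntD (D0 D)" by (rule D0.IntD_poly_ring)
  show "is_subdomain (iota ` IntD (D0 D))" by (rule B.ER.sub)
  fix M assume "maximal_ideal (iota ` IntD (D0 D)) M"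
  then interpret M: poly_prime D "IntD (D0 D)" M
    using B.ER.maximal_ideal_prime by unfold_locales
  show "valuation_domain (loc (iota ` IntD (D0 D)) M)"
  proof (cases "M.ctr = {0}")
    case True
    then show ?thesis by (rule M.valuation_if_ctr_0)
  next
    case False
    then obtain c where c: "c \<in> M.ctr" "c \<noteq> 0" using M.P.P_0 by blast
    \<comment> \<open>Otherwise \<open>u\<close> would be \<open>c\<close> times an element of
      \<open>Int(D\<^sub>0)\<close>, and \<open>c\<close> is in \<open>M\<close>.\<close>
    have "u / c \<notin> D0 D" if u: "u \<in> D" "u \<notin> M.ctr" for u
    proof
      assume "u / c \<in> D0 D"
      then have "[:u / c:] \<in> IntD (D0 D)" using D0E.const_E by blast
      then have "iota (smult c [:u / c:]) \<in> M" using M.Q_smult_ctr[OF c(1)] by blast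
      then show False using u c M.const_mem_iff by simp
    qed
    then have N: "M.ctr \<in> Lambda0 D" using mem_Lambda0_if_D0_prime[OF PV M.ctr_prime c] by blast
    obtain p r where "finite_residue D M.ctr p r" using Lambda0_finite_residue[OF PV(1) N] by blast
    then interpret P: finite_residue D M.ctr p r .
    define Q where "Q = M \<inter> iota ` IntD D"
    have sub: "iota ` IntD D \<subseteq> iota ` IntD (D0 D)" using IntD_subset_IntD_D0 by blast
    have "is_ideal (iota ` IntD D) Q"
      unfolding is_ideal_def Q_def
      using E.ER.add_mem E.ER.mult_mem M.Q.P_add M.Q.P_mult sub by auto
    moreover have "1 \<notin> Q" using M.Q.one_notin_P by (simp add: Q_def)
    then have "Q \<noteq> iota ` IntD D" using E.ER.one_mem by auto
    moreover have "x \<in> Q \<or> y \<in> Q" if "x \<in> iota ` IntD D" "y \<in> iota ` IntD D" "x * y \<in> Q" for x y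
      using that M.Q.P_prime[of x y] sub unfolding Q_def by blast
    ultimately have pr: "prime_ideal (iota ` IntD D) Q" by (simp add: prime_ideal_def)
    then interpret Q: poly_prime D "IntD D" Q by unfold_locales
    have "Q.ctr = M.ctr" unfolding Q.ctr_def M.ctr_def using E.const_E by (auto simp: Q_def)
    then have "t_ideal (iota ` IntD D) Q" using P.prime_above_t_ideal Q.poly_prime_axioms by blast
    then have val: "valuation_domain (loc (iota ` IntD D) Q)" using E.ER.PvMD_t_prime[OF PV(2) pr] by blast
    have "loc (iota ` IntD D) Q \<subseteq> loc (iota ` IntD (D0 D)) M"
    proof
      fix x assume "x \<in> loc (iota ` IntD D) Q"
      then obtain a s where "x = a / s" "a \<in> iota ` IntD D" "s \<in> iota ` IntD D" "s \<notin> Q" by (rule Q.Q.locE)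
      then show "x \<in> loc (iota ` IntD (D0 D)) M" using sub by (auto simp: Q_def intro!: M.Q.locI)
    qed
    then show ?thesis
      using valuation_overring[OF val _ M.Q.subdom_loc] M.Q.qfield_loc Q.Q.qfield_loc
        B.qfield_iota_E E.qfield_iota_E by simp
  qed
qed

end

section \<open>From D and Int(D_0) to Int(D)\<close>

text \<open>The maximal ideal of \<open>loc R P\<close> meets \<open>A\<close> in a prime, and the
  localization of \<open>A\<close> there is a valuation domain inside \<open>loc R P\<close> with
  the same quotient field.\<close>

lemma valuation_if_contains_Prufer:
  assumes P: "prime_at R P" and A: "subdom A" "Prufer A" and sub: "A \<subseteq> loc R P" and q: "qfield A = qfield R"
  shows "valuation_domain (loc R P)"
proof -
  interpret P: prime_at R P by (rule P)
  interpret L: prime_at "loc R P" P.locm by (rule P.loc_prime_at)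
  interpret A: subdom A by (rule A)
  let ?p = "A \<inter> P.locm"
  have "is_ideal A ?p"
    unfolding is_ideal_def using A.add_mem A.mult_mem L.P_add L.P_mult sub by auto
  moreover have "?p \<noteq> A" using L.one_notin_P A.one_mem by blast
  moreover have "x \<in> ?p \<or> y \<in> ?p" if "x \<in> A" "y \<in> A" "x * y \<in> ?p" for x y
    using that L.P_prime[of x y] sub by blast
  ultimately have pr: "prime_ideal A ?p" by (simp add: prime_ideal_def)
  then interpret p: prime_at A ?p by unfold_locales
  have "loc A ?p \<subseteq> loc R P"
  proof
    fix x assume "x \<in> loc A ?p"
    then obtain a s where "x = a / s" "a \<in> A" "s \<in> A" "s \<notin> ?p" by (rule p.locE)
    moreover from this have "inverse s \<in> loc R P" using sub by (auto simp: P.locm_iff)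
    ultimately show "x \<in> loc R P" using L.mult_mem[of a "inverse s"] sub by (auto simp: divide_inverse)
  qed
  then show ?thesis
    using valuation_overring[OF A.Prufer_prime[OF A(2) pr]] P.subdom_loc P.qfield_loc p.qfield_loc q
    by simp
qed

section \<open>Gauss's lemma, limits of \<open>\<Lambda>\<^sub>0\<close> and contents of elements of
  \<open>Q\<close>\<close>

lemma (in prime_at) poly_mult_notin:
  assumes "f \<in> poly_over R" "g \<in> poly_over R" "coeff f i \<notin> P" "coeff g j \<notin> P"
  shows "\<exists>k. coeff (f * g) k \<notin> P"
proof -
  define a where "a = (LEAST i. coeff f i \<notin> P)"
  define b where "b = (LEAST j. coeff g j \<notin> P)"
  have a: "coeff f a \<notin> P" "\<And>i. i < a \<Longrightarrow> coeff f i \<in> P"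
    unfolding a_def using LeastI[of "\<lambda>i. coeff f i \<notin> P", OF assms(3)] not_less_Least by blast+
  have b: "coeff g b \<notin> P" "\<And>j. j < b \<Longrightarrow> coeff g j \<in> P"
    unfolding b_def using LeastI[of "\<lambda>j. coeff g j \<notin> P", OF assms(4)] not_less_Least by blast+
  have "coeff (f * g) (a + b) = coeff f a * coeff g b + (\<Sum>i\<in>{..a + b} - {a}. coeff f i * coeff g (a + b - i))"
    unfolding coeff_mult by (subst sum.remove[of _ a]) auto
  moreover have "(\<Sum>i\<in>{..a + b} - {a}. coeff f i * coeff g (a + b - i)) \<in> P"
  proof (rule P_sum)
    fix i assume i: "i \<in> {..a + b} - {a}"
    show "coeff f i * coeff g (a + b - i) \<in> P"
    proof (cases "i < a")
      case True
      then show ?thesis using a poly_overD[OF assms(2)] by (intro P_mult') auto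
    next
      case False
      then have "a + b - i < b" using i by auto
      then show ?thesis using b poly_overD[OF assms(1)] by (intro P_mult) auto
    qed
  qed
  moreover have "coeff f a * coeff g b \<notin> P"
    using a b poly_overD assms(1,2) by (intro notin_mult) auto
  ultimately have "coeff (f * g) (a + b) \<notin> P"
    using P_diff[of "coeff (f * g) (a + b)" "\<Sum>i\<in>{..a + b} - {a}. coeff f i * coeff g (a + b - i)"] by auto
  then show ?thesis by blast
qed

text \<open>Divide \<open>q\<close> by a coefficient \<open>c\<close> of least value. The product of
  the result with \<open>g\<close> still has a unit coefficient, and \<open>c\<close> times it is a
  coefficient of \<open>q g\<close>; therefore \<open>c\<close> is in
  \<open>loc R P\<close>.\<close>

lemma (in prime_at) gauss_valuation:
  assumes val: "valuation_domain (loc R P)" and q: "q \<in> poly_over (qfield R)"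
    and g: "g \<in> poly_over R" "coeff g j \<notin> P" and qg: "q * g \<in> poly_over (loc R P)"
  shows "q \<in> poly_over (loc R P)"
proof (cases "q = 0")
  case True
  then show ?thesis using subdom.poly_over_0[OF subdom_loc] by simp
next
  case False
  interpret L: prime_at "loc R P" locm by (rule loc_prime_at)
  have "set (coeffs q) \<subseteq> qfield (loc R P)" using q qfield_loc by (auto simp: poly_over_def coeffs_def)
  moreover have "lead_coeff q \<in> set (coeffs q)" "lead_coeff q \<noteq> 0"
    using False coeff_in_coeffs[of q "degree q"] by auto
  then have "\<not> set (coeffs q) \<subseteq> {0}" by blast
  ultimately have "\<exists>c\<in>set (coeffs q). c \<noteq> 0 \<and> (\<forall>x\<in>set (coeffs q). x / c \<in> loc R P)"
    by (intro L.valuation_common_divisor[OF val]) simp_all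
  then obtain c where c: "c \<in> set (coeffs q)" "c \<noteq> 0" "\<And>x. x \<in> set (coeffs q) \<Longrightarrow> x / c \<in> loc R P" by blast
  obtain i where i: "c = coeff q i" using c by (auto simp: coeffs_def split: if_splits)
  let ?q = "smult (inverse c) q"
  have "coeff q j / c \<in> loc R P" for j
    using c coeff_in_coeffs[OF False, of j] by (cases "j \<le> degree q") (auto simp: coeff_eq_0)
  then have qL: "?q \<in> poly_over (loc R P)" by (simp add: poly_over_def divide_inverse mult.commute)
  have "coeff ?q i \<notin> locm" using i c(2) L.one_notin_P by simp
  moreover have gL: "g \<in> poly_over (loc R P)" using poly_over_mono[of R "loc R P"] mem_loc g(1) by blast
  moreover have "coeff g j \<notin> locm" using g poly_overD[OF g(1)] locm_ring_iff by blast
  ultimately obtain k where k: "coeff (?q * g) k \<notin> locm" using L.poly_mult_notin[OF qL] by blast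
  have "coeff (?q * g) k \<in> loc R P" using L.poly_over_mult[OF qL gL] poly_overD by blast
  then have inv: "inverse (coeff (?q * g) k) \<in> loc R P" "coeff (?q * g) k \<noteq> 0"
    using k by (auto simp: locm_iff)
  have "coeff (q * g) k * inverse (coeff (?q * g) k) \<in> loc R P"
    using poly_overD[OF qg] inv by (intro L.mult_mem)
  moreover have "coeff (q * g) k = c * coeff (?q * g) k" using c(2) by simp
  ultimately have "c \<in> loc R P" by (simp only: mult.assoc right_inverse[OF inv(2)] mult_1_right)
  then have "smult c ?q \<in> poly_over (loc R P)" using qL by (rule L.poly_over_smult)
  then show ?thesis using c(2) by simp
qed

context int_localizes
begin

text \<open>If \<open>P\<close> is a limit of members of \<open>\<Lambda>\<^sub>0\<close>, then \<open>D\<^sub>0 \<subseteq> D\<^sub>P\<close>, since the denominator ideals of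
  a PvMD are of the form \<open>E\<^sup>v\<close> with \<open>E\<close> finite.\<close>

lemma D0_subset_loc_limit:
  assumes PV: "PvMD D" and P: "prime_ideal D P"
    and lim: "\<And>B. finite B \<Longrightarrow> B \<subseteq> P \<Longrightarrow> \<exists>N\<in>Lambda0 D. B \<subseteq> N"
  shows "D0 D \<subseteq> loc D P"
proof
  interpret P: prime_at D P using P by unfold_locales
  interpret K: subdom "qfield D" by (rule subdom_qfield)
  fix x assume x: "x \<in> D0 D"
  then have xK: "x \<in> qfield D" using D0_subset_qfield by blast
  show "x \<in> loc D P"
  proof (rule ccontr)
    assume n: "x \<notin> loc D P"
    \<comment> \<open>The inverse of the fractional ideal generated by 1 and \<open>x\<close> is the
      denominator ideal of \<open>x\<close>.\<close>
    have "finite {1, x}" "{1, x} \<subseteq> qfield D" "\<not> {1, x} \<subseteq> {0}" using xK by auto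
    then obtain E where E: "finite E" "E \<subseteq> colon D {1, x}"
      "\<And>y. y \<in> qfield D \<Longrightarrow> (\<And>e c. e \<in> E \<Longrightarrow> c \<in> {1, x} \<Longrightarrow> y * (e * c) \<in> D) \<Longrightarrow> y \<in> D"
      using PvMD_t_invertible[OF PV] by metis
    have ED: "e \<in> D" "e * x \<in> D" if "e \<in> E" for e using E(2) that by (auto simp: colon_def)
    have "e \<in> P" if "e \<in> E" for e
    proof (rule ccontr)
      assume "e \<notin> P"
      then show False using P.loc_cancel[of e x] ED[OF that] P.mem_loc n by blast
    qed
    then obtain N where N: "N \<in> Lambda0 D" "E \<subseteq> N" using lim[OF E(1)] by blast
    interpret N: prime_at D N by (rule Lambda0_prime[OF N(1)])
    have "x \<in> loc D N" using x D0_subset_loc N by blast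
    then obtain s where s: "s \<in> D" "s \<notin> N" "s * x \<in> D"
      using N.loc_common_denominator[of "{x}"] by auto
    have "s \<in> vclos D E"
      unfolding vclos_iff
    proof (intro conjI ballI impI)
      show "s \<in> qfield D" using s mem_qfield by blast
      fix y assume y: "y \<in> qfield D" "\<forall>e\<in>E. y * e \<in> D"
      show "s * y \<in> D"
      proof (rule E(3))
        show "s * y \<in> qfield D" using s y mem_qfield by (intro K.mult_mem) auto
        fix e c assume e: "e \<in> E" "c \<in> {1, x}"
        have "(y * e) * s \<in> D" "(y * e) * (s * x) \<in> D" using y(2) e s by (auto intro: mult_mem)
        then show "s * y * (e * c) \<in> D" using e(2) by (auto simp: ac_simps)
      qed
    qed
    \<comment> \<open>If \<open>E\<close> were zero, its defining property would put all of the
      quotient field, and so \<open>x\<close>, into \<open>D\<close>.\<close>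
    moreover have "\<not> E \<subseteq> {0}"
    proof
      assume E0: "E \<subseteq> {0}"
      have "x \<in> D"
      proof (rule E(3)[OF xK])
        show "x * (e * c) \<in> D" if "e \<in> E" for e c using E0 that by auto
      qed
      then show False using n P.mem_loc by blast
    qed
    ultimately have "s \<in> N"
      using t_ideal_vclos[of N E] N E(1) by (auto simp: Lambda0_def t_spec_def)
    then show False using s by blast
  qed
qed

text \<open>For a limit \<open>P\<close> one would have
  \<open>Int(D\<^sub>0) \<subseteq> D\<^sub>P[X]\<close>. The polynomials with constant coefficient
  in the maximal ideal of \<open>D\<^sub>P\<close> form a prime of \<open>Int(D\<^sub>0)\<close>
  with trace \<open>P\<close> that contains \<open>X\<close>, and its localization is not a
  valuation domain.\<close>

lemma not_limit_of_Lambda0: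
  assumes PV: "PvMD D" and Pr: "Prufer (iota ` IntD (D0 D))"
    and P: "P \<in> t_spec D" "P \<notin> Lambda0 D" "P \<noteq> {0}"
  shows "\<exists>B. finite B \<and> B \<subseteq> P \<and> \<not> (\<exists>N\<in>Lambda0 D. B \<subseteq> N)"
proof (rule ccontr)
  assume "\<not> ?thesis"
  then have lim: "\<exists>N\<in>Lambda0 D. B \<subseteq> N" if "finite B" "B \<subseteq> P" for B using that by blast
  have Pp: "prime_ideal D P" and Pt: "t_ideal D P" using P(1) by (auto simp: t_spec_def)
  interpret P: prime_at D P using Pp by unfold_locales
  interpret L: prime_at "loc D P" P.locm by (rule P.loc_prime_at)
  interpret B: poly_ring D "IntD (D0 D)" by (rule D0_poly_ring)
  have D0P: "D0 D \<subseteq> loc D P" using D0_subset_loc_limit[OF PV Pp lim] by blast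
  have loc_eq: "IntD_loc D P = poly_over (loc D P)" using P by (auto simp: Lambda0_def)
  have "P \<noteq> D" using P.one_notin_P one_mem by blast
  then obtain M where M: "t_maximal D M" "P \<subseteq> M"
    using t_proper_in_t_maximal[OF t_ideal_t_proper[OF Pt] P.P_sub] by blast
  \<comment> \<open>The hypothesis on localizations covers only t-maximal \<open>P\<close>; a
    smaller \<open>P\<close> has a \<open>t\<close> whose powers give unit Vandermonde
    determinants.\<close>
  have "IntD (loc D P) \<subseteq> poly_over (loc D P)"
  proof (cases "P = M")
    case True
    then have "t_maximal D P" using M(1) by (simp only:)
    then show ?thesis using int_loc loc_eq by simp
  next
    case False
    then show ?thesis
      using P.IntD_subset_poly_over_loc_nonmaximal[OF t_maximal_prime[OF M(1)]] M(2) by blast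
  qed
  then have EL: "IntD (D0 D) \<subseteq> poly_over (loc D P)" using IntD_D0_subset_loc[OF Pp D0P] by blast
  define Q where "Q = iota ` {f \<in> IntD (D0 D). coeff f 0 \<in> P.locm}"
  have mem: "iota f \<in> Q \<longleftrightarrow> f \<in> IntD (D0 D) \<and> coeff f 0 \<in> P.locm" for f by (auto simp: Q_def)
  have c0: "coeff f 0 \<in> loc D P" if "f \<in> IntD (D0 D)" for f using that EL by (auto simp: poly_over_def)
  have "prime_ideal (iota ` IntD (D0 D)) Q"
    unfolding prime_ideal_def is_ideal_def
  proof (intro conjI ballI impI)
    show "Q \<subseteq> iota ` IntD (D0 D)" by (auto simp: Q_def)
    show "0 \<in> Q" using mem[of 0] B.zero_E by simp
    show "Q \<noteq> iota ` IntD (D0 D)" using mem[of 1] B.one_E L.one_notin_P by auto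
    show "x + y \<in> Q" if "x \<in> Q" "y \<in> Q" for x y
    proof -
      obtain f g where fg: "x = iota f" "y = iota g" using \<open>x \<in> Q\<close> \<open>y \<in> Q\<close> unfolding Q_def by blast
      then show ?thesis using that mem[of f] mem[of g] mem[of "f + g"] L.P_add
        by (simp add: iota_add B.E_add)
    qed
    show "x * y \<in> Q" if "x \<in> iota ` IntD (D0 D)" "y \<in> Q" for x y
    proof -
      obtain f g where fg: "x = iota f" "y = iota g" "f \<in> IntD (D0 D)"
        using \<open>x \<in> iota ` IntD (D0 D)\<close> \<open>y \<in> Q\<close> unfolding Q_def by blast
      then show ?thesis using that(2) mem[of g] mem[of "f * g"] L.P_mult[OF c0[OF fg(3)]]
        by (simp add: iota_mult B.E_mult coeff_mult_0)
    qed
    show "x \<in> Q \<or> y \<in> Q" if "x \<in> iota ` IntD (D0 D)" "y \<in> iota ` IntD (D0 D)" "x * y \<in> Q" for x y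
    proof -
      obtain f g where fg: "x = iota f" "y = iota g" "f \<in> IntD (D0 D)" "g \<in> IntD (D0 D)"
        using \<open>x \<in> _\<close> \<open>y \<in> _\<close> by blast
      then show ?thesis using that(3) mem[of f] mem[of g] mem[of "f * g"] L.P_prime[OF c0[OF fg(3)] c0[OF fg(4)]]
        by (simp add: iota_mult coeff_mult_0)
    qed
  qed
  then interpret Q: poly_prime D "IntD (D0 D)" Q by unfold_locales
  have ctr: "Q.ctr = P" unfolding Q.ctr_def using mem B.const_E P.locm_ring_iff P.P_sub by auto
  have "valuation_domain (loc (iota ` IntD (D0 D)) Q)"
    using B.ER.Prufer_prime[OF Pr Q.Q_prime] .
  moreover have "iota [:0, 1:] \<in> Q" using mem B.X_E by simp
  ultimately show False using Q.not_valuation_if_X_mem EL P(3) ctr by simp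
qed

text \<open>If some coefficient of \<open>h\<close> were a unit at \<open>P\<close>, a finite subset
  \<open>F\<close> of \<open>Q\<close> would have v-closure the whole ring: the constants in
  \<open>B\<close> together with \<open>e h\<close> for \<open>e\<close> in the inverse of the
  content of \<open>h\<close>. Let \<open>q\<close> be a multiplier of \<open>F\<close> and
  \<open>N\<close> t-maximal. If some \<open>b \<in> B\<close> is outside \<open>N\<close>, it gives
  \<open>q(d) \<in> D\<^sub>N\<close>. Otherwise \<open>N\<close> is not in
  \<open>\<Lambda>\<^sub>0\<close>, some \<open>e h\<close> has a unit coefficient at
  \<open>N\<close>, and Gauss's lemma gives \<open>q \<in> D\<^sub>N[X]\<close>.\<close>

lemma content_in_locm:
  assumes PV: "PvMD D" and Q: "poly_prime D (IntD D) Q" "t_ideal (iota ` IntD D) Q"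
    and P: "poly_prime.ctr D Q = P" "P \<noteq> {0}" "IntD D \<subseteq> poly_over (loc D P)"
    and B: "finite B" "B \<subseteq> P" "\<And>N. N \<in> Lambda0 D \<Longrightarrow> \<not> B \<subseteq> N"
    and h: "h \<in> IntD D" "iota h \<in> Q"
  shows "h \<in> poly_over (prime_at.locm D P)"
proof (rule ccontr)
  interpret Q: poly_prime D "IntD D" Q by (rule Q(1))
  interpret P: prime_at D P using Q.P.prime_at_axioms P(1) by simp
  interpret L: prime_at "loc D P" P.locm by (rule P.loc_prime_at)
  interpret K: subdom "qfield D" by (rule subdom_qfield)
  assume "h \<notin> poly_over P.locm"
  then obtain i where i: "coeff h i \<notin> P.locm" by (auto simp: poly_over_def)
  have hiL: "coeff h i \<in> loc D P" using h(1) P(3) by (auto simp: poly_over_def)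
  have hi: "coeff h i \<noteq> 0" "inverse (coeff h i) \<in> loc D P" using i hiL by (auto simp: P.locm_iff)
  have hK: "h \<in> poly_over (qfield D)" by (rule IntD_poly_over[OF h(1)])
  have "i \<le> degree h" "h \<noteq> 0" using hi by (auto intro: le_degree)
  then have his: "coeff h i \<in> set (coeffs h)" by (intro coeff_in_coeffs)
  have "finite (set (coeffs h))" "set (coeffs h) \<subseteq> qfield D" "\<not> set (coeffs h) \<subseteq> {0}"
    using hK his hi by (auto simp: poly_over_def coeffs_def)
  then obtain E where E: "finite E" "E \<subseteq> colon D (set (coeffs h))"
    "\<And>y. y \<in> qfield D \<Longrightarrow> (\<And>e c. e \<in> E \<Longrightarrow> c \<in> set (coeffs h) \<Longrightarrow> y * (e * c) \<in> D) \<Longrightarrow> y \<in> D"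
    using PvMD_t_invertible[OF PV, of "set (coeffs h)"] by metis
  \<comment> \<open>\<open>B\<close> itself may have no nonzero element; a nonzero constant in
    \<open>F\<close> guarantees that multipliers are polynomials.\<close>
  obtain c0 where c0: "c0 \<in> P" "c0 \<noteq> 0" using P(2) P.P_0 by blast
  have c0D: "c0 \<in> D" using c0 P.P_sub by blast
  have cs: "coeff h k \<in> insert 0 (set (coeffs h))" for k
    using coeff_in_coeffs[OF \<open>h \<noteq> 0\<close>, of k] by (cases "k \<le> degree h") (auto simp: coeff_eq_0)
  have eh: "smult e h \<in> poly_over D" if "e \<in> E" for e
  proof (rule poly_overI)
    show "coeff (smult e h) k \<in> D" for k using E(2) that cs[of k] by (auto simp: colon_def)
  qed
  \<comment> \<open>\<open>e\<close> need not be in \<open>D\<close>, but it is in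
    \<open>D\<^sub>P\<close>, being \<open>e\<close> times the unit coefficient divided by that
    unit.\<close>
  have ehQ: "iota (smult e h) \<in> Q" if e: "e \<in> E" for e
  proof -
    have "coeff (smult e h) i * inverse (coeff h i) \<in> loc D P"
      using poly_overD[OF eh[OF e]] P.mem_loc hi by (intro L.mult_mem) auto
    then have "e \<in> loc D P" using hi(1) by (simp add: mult.assoc)
    then obtain s where s: "s \<in> D" "s \<notin> P" "s * e \<in> D" using P.loc_common_denominator[of "{e}"] by auto
    have "iota (smult s (smult e h)) \<in> Q" using Q.Q_smult[OF s(3) h] by simp
    then show ?thesis using Q.Q_smult_cancel s P(1) eh[OF e] E.DE by blast
  qed
  define F where "F = (\<lambda>b. [:b:]) ` insert c0 B \<union> (\<lambda>e. smult e h) ` E"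
  have FE: "F \<subseteq> IntD D"
    unfolding F_def using E.const_E c0D B P.P_sub eh E.DE by auto
  have "iota [:b:] \<in> Q" if "b \<in> insert c0 B" for b
    using that c0 B(2) unfolding P(1)[symmetric] Q.ctr_def by blast
  then have FQ: "iota ` F \<subseteq> Q"
    unfolding F_def using ehQ by auto
  have "1 * y \<in> iota ` IntD D"
    if y: "y \<in> qfield (iota ` IntD D)" "\<forall>f\<in>iota ` F. y * f \<in> iota ` IntD D" for y
  proof -
    have "iota [:c0:] \<in> iota ` F" by (simp add: F_def)
    then have "y * iota [:c0:] \<in> iota ` IntD D" using y(2) by blast
    then obtain q where q: "q \<in> poly_over (qfield D)" "y = iota q"
      using E.mem_iota_of_mult_const[OF y(1)] c0D c0 mem_qfield by blast
    have qF: "q * f \<in> IntD D" if "f \<in> F" for f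
      using y(2) that q(2) by (auto simp flip: iota_mult)
    have "poly q d \<in> D" if d: "d \<in> D" for d
    proof (rule mem_if_mem_all_loc)
      show "poly q d \<in> qfield D" using K.poly_mem[OF q(1)] d mem_qfield by blast
      fix N assume N: "t_maximal D N"
      interpret N: prime_at D N using t_maximal_prime[OF N] by unfold_locales
      interpret LN: subdom "loc D N" by (rule N.subdom_loc)
      show "poly q d \<in> loc D N"
      proof (cases "B \<subseteq> N")
        case False
        then obtain b where b: "b \<in> B" "b \<notin> N" by blast
        have bD: "b \<in> D" using b B P.P_sub by blast
        have "q * [:b:] \<in> IntD D" using b by (intro qF) (auto simp: F_def)
        then have "b * poly q d \<in> D" using IntD_poly[of "q * [:b:]" D d] d by (simp add: mult.commute)
        then show ?thesis using N.loc_cancel[OF bD b(2) N.mem_loc] by blast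
      next
        case True
        then have "N \<notin> Lambda0 D" using B(3) by blast
        then have eq: "IntD_loc D N = poly_over (loc D N)"
          using t_maximal_t_spec[OF N] by (auto simp: Lambda0_def)
        \<comment> \<open>This is t-invertibility of the content: the products of \<open>E\<close>
          with the coefficients have v-closure \<open>D\<close> and so cannot all lie in the t-ideal
          \<open>N\<close>.\<close>
        have "\<exists>e\<in>E. \<exists>k. coeff (smult e h) k \<notin> N"
        proof (rule ccontr)
          assume "\<not> ?thesis"
          then have all: "e * coeff h k \<in> N" if "e \<in> E" for e k using that by auto
          let ?C = "(\<lambda>(e, c). e * c) ` (E \<times> set (coeffs h))"
          have CN: "?C \<subseteq> N" using all by (auto simp: coeffs_def)
          have one: "1 \<in> vclos D ?C"
            unfolding vclos_iff
          proof (intro conjI ballI impI)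
            fix y assume y: "y \<in> qfield D" "\<forall>f\<in>?C. y * f \<in> D"
            have "y \<in> D" using y(2) by (intro E(3)[OF y(1)]) force
            then show "1 * y \<in> D" by simp
          qed simp
          show False
          proof (cases "?C \<subseteq> {0}")
            case False
            have "t_ideal D N" "N \<noteq> D" using N by (auto simp: t_maximal_def)
            then have "1 \<in> N" using t_ideal_vclos[of N ?C] CN False one E(1) by auto
            then show False by simp
          next
            case True
            \<comment> \<open>If all products were zero, every element of the quotient field would
              be in \<open>D\<close>; the inverse of an element of \<open>P\<close> cannot
              be.\<close>
            have "inverse c0 \<in> D"
            proof (rule E(3))
              show "inverse c0 \<in> qfield D" using c0D mem_qfield qfield_inverse by blast
              fix e c assume "e \<in> E" "c \<in> set (coeffs h)"
              then have "e * c = 0" using True by force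
              then show "inverse c0 * (e * c) \<in> D" by (simp only: mult_zero_right zero_mem)
            qed
            then have "inverse c0 * c0 \<in> P" using c0 by (intro P.P_mult)
            then show False using c0 by simp
          qed
        qed
        then obtain e k where e: "e \<in> E" "coeff (smult e h) k \<notin> N" by blast
        have "q * smult e h \<in> IntD D" using e by (intro qF) (auto simp: F_def)
        then have "q * smult e h \<in> poly_over (loc D N)" using N.IntD_subset_IntD_loc eq by blast
        moreover have "valuation_domain (loc D N)" using PV N by (simp add: PvMD_def)
        ultimately have "q \<in> poly_over (loc D N)"
          using N.gauss_valuation[OF _ q(1) eh[OF e(1)] e(2)] by blast
        then show ?thesis using d N.mem_loc by (intro LN.poly_mem) auto
      qed
    qed
    then have "q \<in> IntD D" using q(1) by (intro IntDI)
    then show ?thesis using q(2) by simp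
  qed
  then have "1 \<in> vclos (iota ` IntD D) (iota ` F)"
    using E.ER.mem_qfield[OF E.ER.one_mem] unfolding E.ER.vclos_iff by blast
  moreover have "finite (iota ` F)" using B(1) E(1) by (simp add: F_def)
  moreover have "iota [:c0:] \<in> iota ` F" "iota [:c0:] \<noteq> 0" using c0 by (auto simp: F_def)
  then have "\<not> iota ` F \<subseteq> {0}" by blast
  ultimately have "1 \<in> Q" using E.ER.t_ideal_vclos[OF Q(2) _ FQ] by blast
  then show False using Q.Q.one_notin_P by blast
qed

lemma PvMD_IntD:
  assumes PV: "PvMD D" and Pr: "Prufer (iota ` IntD (D0 D))"
  shows "PvMD (iota ` IntD D)"
  unfolding PvMD_def
proof (intro conjI allI impI)
  show "is_subdomain (iota ` IntD D)" by (rule E.ER.sub)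
  fix Q assume Qm: "t_maximal (iota ` IntD D) Q"
  then have Qt: "t_ideal (iota ` IntD D) Q" by (simp add: t_maximal_def)
  interpret Q: poly_prime D "IntD D" Q
    using E.ER.t_maximal_prime[OF Qm] by unfold_locales
  interpret B: poly_ring D "IntD (D0 D)" by (rule D0_poly_ring)
  have Ps: "Q.ctr \<in> t_spec D" using Q.t_ideal_ctr[OF refl Qt] Q.ctr_prime by (simp add: t_spec_def)
  consider "Q.ctr = {0}" | "Q.ctr \<in> Lambda0 D" | "Q.ctr \<noteq> {0}" "Q.ctr \<notin> Lambda0 D" by blast
  then show "valuation_domain (loc (iota ` IntD D) Q)"
  proof cases
    case 1
    then show ?thesis by (rule Q.valuation_if_ctr_0)
  next
    case 2
    \<comment> \<open>The hypothesis applies because members of \<open>\<Lambda>\<^sub>0\<close> are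
      t-maximal, and elements of \<open>D\<close> outside the trace are units in the localization at
      \<open>Q\<close>.\<close>
    have "IntD (D0 D) \<subseteq> IntD_loc D Q.ctr"
      using IntD_D0_subset_loc[OF Q.ctr_prime D0_subset_loc[OF 2]] int_loc[OF Lambda0_t_maximal[OF 2]] by simp
    moreover have "iota f \<in> loc (iota ` IntD D) Q" if "f \<in> IntD_loc D Q.ctr" for f
    proof -
      obtain s where s: "s \<in> D" "s \<notin> Q.ctr" "s \<noteq> 0" "smult s f \<in> IntD D"
        using \<open>f \<in> _\<close> by (rule Q.P.IntD_locE)
      have "iota f = iota (smult s f) / iota [:s:]" using s(3) by (simp add: iota_smult)
      then show ?thesis using s E.const_E Q.const_mem_iff by (auto intro!: Q.Q.locI)
    qed
    ultimately have "iota ` IntD (D0 D) \<subseteq> loc (iota ` IntD D) Q" by blast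
    then show ?thesis
      using valuation_if_contains_Prufer[OF Q.Q.prime_at_axioms B.ER.subdom_axioms Pr]
        B.qfield_iota_E E.qfield_iota_E by simp
  next
    case 3
    obtain B where B: "finite B" "B \<subseteq> Q.ctr" "\<not> (\<exists>N\<in>Lambda0 D. B \<subseteq> N)"
      using not_limit_of_Lambda0[OF PV Pr Ps 3(2,1)] by blast
    have "IntD_loc D Q.ctr = poly_over (loc D Q.ctr)" using Ps 3 by (auto simp: Lambda0_def)
    then have sub: "IntD D \<subseteq> poly_over (loc D Q.ctr)" using Q.P.IntD_subset_IntD_loc by simp
    show ?thesis
    proof (rule Q.valuation_if_content[OF sub])
      show "valuation_domain (loc D Q.ctr)"
        using PvMD_t_prime[OF PV Q.ctr_prime Q.t_ideal_ctr[OF refl Qt]] .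
      show "f \<in> poly_over Q.P.locm" if "f \<in> IntD D" "iota f \<in> Q" for f
        using content_in_locm[OF PV Q.poly_prime_axioms Qt refl 3(1) sub B(1,2) _ that] B(3) by blast
    qed
  qed
qed

end

theorem theorem3p7:
  fixes D :: "'a::field set"
  assumes "is_subdomain D"
    and "\<forall>P. t_maximal D P \<longrightarrow> IntD_loc D P = IntD (loc D P)"
  shows "PvMD (poly_to_fract ` IntD D) \<longleftrightarrow>
           PvMD D \<and> Prufer (poly_to_fract ` IntD (D0 D))"
proof -
  interpret int_localizes D
    using assms by unfold_locales auto
  show ?thesis using PvMD_base Prufer_IntD_D0 PvMD_IntD by blast
qed

end
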